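(* The following automorphisms give a complete list of representatives of the distinct classes in $\mathrm{Out}(\mathcal O_2)$ appearing in $\lambda(\mathcal P_2^4)^{-1}$ (i.e. their classes in $\mathrm{Out}(\mathcal O_2)$ are pairwise distinct, and together they form exactly the image of $\lambda(\mathcal P_2^4)^{-1}$ in $\mathrm{Out}(\mathcal O_2)$): $$\mathrm{id},\ \lambda_F;\qquad \lambda_A,\ \lambda_A\lambda_F,\ \lambda_F\lambda_A,\ \lambda_F\lambda_A\lambda_F;$$ $$\lambda_J,\ \lambda_J\lambda_F,\ \lambda_F\lambda_J,\ \lambda_F\lambda_J\lambda_F;\qquad \lambda_G,\ \lambda_G\lambda_F,\ \lambda_F\lambda_G,\ \lambda_F\lambda_G\lambda_F.$$
   Context: $\mathcal O_2$ is the Cuntz algebra, generated by isometries $S_1,S_2$ with $S_1S_1^*+S_2S_2^*=1$. $W_2^k$ is the set of words of length $k$ in $\{1,2\}$, $S_\alpha=S_{\alpha_1}\cdots S_{\alpha_k}$. To a permutation $\sigma$ of $W_2^k$ corresponds the unitary $\sum_{\alpha\in W_2^k}S_{\sigma(\alpha)}S_\alpha^*$; $\mathcal P_2^k$ is the set of all these unitaries. A permutation and its unitary are denoted by the same letter. For a unitary $u\in\mathcal O_2$, $\lambda_u$ is the unital endomorphism with $\lambda_u(S_i)=u^*S_i$; juxtaposition of endomorphisms is composition. $\lambda(\mathcal P_2^4)^{-1}=\{\lambda_w:w\in\mathcal P_2^4\}\cap\mathrm{Aut}(\mathcal O_2)$, and $\mathrm{Out}(\mathcal O_2)=\mathrm{Aut}(\mathcal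 O_2)/\mathrm{Inn}(\mathcal O_2)$. The unitaries are: - $F=S_1S_2^*+S_2S_1^*$ (so $\lambda_F$ exchanges $S_1$ and $S_2$). - $A$: the permutation of $W_2^4$ fixing $1211,1212,1222,1221,1121,1122$, with $1111\mapsto1112$, $1112\mapsto1111$, $2222\mapsto2111$, $2221\mapsto2121$, $2211\mapsto2112$, $2212\mapsto2122$, $2122\mapsto2222$, $2121\mapsto2221$, $2112\mapsto2212$, $2111\mapsto2211$. - $J$: the transposition of $W_2^4$ exchanging $2112$ and $2212$. - $G$: the 3-cycle of $W_2^4$ with $1112\mapsto1122$, $1122\mapsto1222$, $1222\mapsto1112$ (all other words fixed). *)

theory Defs
  imports Complex_Main "HOL-Algebra.Coset" "HOL-Combinatorics.Permutations"
begin

class unital_cstar_algebra = real_normed_algebra_1 + banach +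
  fixes scaleC :: "complex \<Rightarrow> 'a \<Rightarrow> 'a"
    and star :: "'a \<Rightarrow> 'a"
  assumes scaleC_add_right: "scaleC a (x + y) = scaleC a x + scaleC a y"
    and scaleC_add_left: "scaleC (a + b) x = scaleC a x + scaleC b x"
    and scaleC_scaleC: "scaleC a (scaleC b x) = scaleC (a * b) x"
    and scaleC_of_real: "scaleC (complex_of_real r) x = r *\<^sub>R x"
    and mult_scaleC_left: "scaleC a x * y = scaleC a (x * y)"
    and mult_scaleC_right: "x * scaleC a y = scaleC a (x * y)"
    and norm_scaleC: "norm (scaleC a x) = cmod a * norm x"
    and star_star: "star (star x) = x"
    and star_add: "star (x + y) = star x + star y"
    and star_scaleC: "star (scaleC a x) = scaleC (cnj a) (star x)"
    and star_mult: "star (x * y) = star y * star x"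
    and cstar_identity: "norm (star x * x) = (norm x)\<^sup>2"

definition unitary :: "'a::unital_cstar_algebra \<Rightarrow> bool" where
  "unitary u \<longleftrightarrow> star u * u = 1 \<and> u * star u = 1"

definition star_subalgebra :: "'a::unital_cstar_algebra set \<Rightarrow> bool" where
  "star_subalgebra B \<longleftrightarrow> B \<noteq> {} \<and>
     (\<forall>x\<in>B. \<forall>y\<in>B. x + y \<in> B \<and> x * y \<in> B) \<and>
     (\<forall>x\<in>B. star x \<in> B \<and> (\<forall>c. scaleC c x \<in> B))"

definition generated_cstar_subalgebra :: "'a::unital_cstar_algebra set \<Rightarrow> 'a set" where
  "generated_cstar_subalgebra X = \<Inter>{B. star_subalgebra B \<and> closed B \<and> X \<subseteq> B}"

definition unital_star_endomorphism :: "('a::unital_cstar_algebra \<Rightarrow> 'a) \<Rightarrow> bool" where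
  "unital_star_endomorphism \<phi> \<longleftrightarrow> \<phi> 1 = 1 \<and>
     (\<forall>x y. \<phi> (x + y) = \<phi> x + \<phi> y) \<and> (\<forall>c x. \<phi> (scaleC c x) = scaleC c (\<phi> x)) \<and>
     (\<forall>x y. \<phi> (x * y) = \<phi> x * \<phi> y) \<and> (\<forall>x. \<phi> (star x) = star (\<phi> x))"

text \<open>A pair of elements is given as a function on \<open>nat\<close> of which only the values at
  1 and 2 matter.\<close>

definition cuntz_relations :: "(nat \<Rightarrow> 'a::unital_cstar_algebra) \<Rightarrow> bool" where
  "cuntz_relations T \<longleftrightarrow> star (T 1) * T 1 = 1 \<and> star (T 2) * T 2 = 1 \<and>
     T 1 * star (T 1) + T 2 * star (T 2) = 1"

text \<open>The type \<open>'a\<close> is the Cuntz algebra with canonical generators \<open>S 1\<close>, \<open>S 2\<close>: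
  the universal C*-algebra generated by two isometries satisfying the Cuntz relation. HOL cannot
  quantify over all target C*-algebras, so universality is only required for targets inside
  the algebra itself, which is what makes the endomorphisms \<open>cuntz_endo S u\<close> below exist.
  By Cuntz's uniqueness theorem \<open>universal\<close> follows from the other two conditions, so it
  excludes no model.\<close>

locale cuntz_algebra =
  fixes S :: "nat \<Rightarrow> 'a::unital_cstar_algebra"
  assumes relations: "cuntz_relations S"
    and generating: "generated_cstar_subalgebra {S 1, S 2} = UNIV"
    and universal: "cuntz_relations T \<Longrightarrow>
      \<exists>\<phi>. unital_star_endomorphism \<phi> \<and> \<phi> (S 1) = T 1 \<and> \<phi> (S 2) = T 2"

text \<open>The endomorphism usually written \<open>\<lambda>\<^sub>u\<close>; it is unique because
  *-homomorphisms of C*-algebras are automatically continuous.\<close>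

definition cuntz_endo :: "(nat \<Rightarrow> 'a::unital_cstar_algebra) \<Rightarrow> 'a \<Rightarrow> 'a \<Rightarrow> 'a" where
  "cuntz_endo S u = (THE \<phi>. unital_star_endomorphism \<phi> \<and>
     (\<forall>i\<in>{1, 2}. \<phi> (S i) = star u * S i))"

definition words :: "nat \<Rightarrow> nat list set" where
  "words k = {\<alpha>. length \<alpha> = k \<and> set \<alpha> \<subseteq> {1, 2}}"

definition word_isometry :: "(nat \<Rightarrow> 'a::unital_cstar_algebra) \<Rightarrow> nat list \<Rightarrow> 'a" where
  "word_isometry S \<alpha> = prod_list (map S \<alpha>)"

definition perm_unitary ::
    "(nat \<Rightarrow> 'a::unital_cstar_algebra) \<Rightarrow> nat \<Rightarrow> (nat list \<Rightarrow> nat list) \<Rightarrow> 'a" where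
  "perm_unitary S k \<sigma> =
     (\<Sum>\<alpha>\<in>words k. word_isometry S (\<sigma> \<alpha>) * star (word_isometry S \<alpha>))"

definition perm_unitaries :: "(nat \<Rightarrow> 'a::unital_cstar_algebra) \<Rightarrow> nat \<Rightarrow> 'a set" where
  "perm_unitaries S k = {perm_unitary S k \<sigma> | \<sigma>. \<sigma> permutes words k}"

definition Aut :: "('a::unital_cstar_algebra \<Rightarrow> 'a) monoid" where
  "Aut = \<lparr>carrier = {\<phi>. unital_star_endomorphism \<phi> \<and> bij \<phi>}, monoid.mult = (\<circ>), one = id\<rparr>"

definition Inn :: "('a::unital_cstar_algebra \<Rightarrow> 'a) set" where
  "Inn = {\<lambda>x. u * x * star u | u. unitary u}"

definition Out :: "('a::unital_cstar_algebra \<Rightarrow> 'a) set monoid" where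
  "Out = Aut Mod Inn"

text \<open>The quotient map from \<open>Aut\<close> to \<open>Out\<close>.\<close>

definition out_class :: "('a::unital_cstar_algebra \<Rightarrow> 'a) \<Rightarrow> ('a \<Rightarrow> 'a) set" where
  "out_class \<phi> = Inn #>\<^bsub>Aut\<^esub> \<phi>"

definition perm_automorphisms ::
    "(nat \<Rightarrow> 'a::unital_cstar_algebra) \<Rightarrow> nat \<Rightarrow> ('a \<Rightarrow> 'a) set" where
  "perm_automorphisms S k = cuntz_endo S ` perm_unitaries S k \<inter> carrier Aut"

definition unitary_F :: "(nat \<Rightarrow> 'a::unital_cstar_algebra) \<Rightarrow> 'a" where
  "unitary_F S = S 1 * star (S 2) + S 2 * star (S 1)"

definition perm_A :: "nat list \<Rightarrow> nat list" where
  "perm_A = id(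
     [1,1,1,1] := [1,1,1,2], [1,1,1,2] := [1,1,1,1],
     [2,2,2,2] := [2,1,1,1], [2,2,2,1] := [2,1,2,1],
     [2,2,1,1] := [2,1,1,2], [2,2,1,2] := [2,1,2,2],
     [2,1,2,2] := [2,2,2,2], [2,1,2,1] := [2,2,2,1],
     [2,1,1,2] := [2,2,1,2], [2,1,1,1] := [2,2,1,1])"

definition perm_J :: "nat list \<Rightarrow> nat list" where
  "perm_J = transpose [2,1,1,2] [2,2,1,2]"

definition perm_G :: "nat list \<Rightarrow> nat list" where
  "perm_G = id(
     [1,1,1,2] := [1,1,2,2], [1,1,2,2] := [1,2,2,2], [1,2,2,2] := [1,1,1,2])"

end

theory Submission
  imports Defs "HOL-Computational_Algebra.Formal_Power_Series" "HOL-Analysis.Elementary_Metric_Spaces"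
begin

text \<open>If \<open>\<sigma>(pj) = iq\<close> with \<open>p\<close> and \<open>q\<close> of length 3, then \<open>\<lambda>\<^sub>\<sigma>(S\<^sub>i)S\<^sub>q = S\<^sub>pS\<^sub>j\<close>. Hence \<open>\<sigma>\<close> is a transducer with the
  eight words of length 3 as states, bijective on pairs of a state and a letter: in state \<open>p\<close> it reads \<open>j\<close>,
  writes \<open>i\<close> and moves to \<open>q\<close>. A path from \<open>p\<close> to \<open>q\<close> that reads \<open>J\<close> and writes \<open>I\<close> yields
  \<open>\<lambda>\<^sub>\<sigma>(S\<^sub>I)S\<^sub>q = S\<^sub>pS\<^sub>J\<close>. If \<open>\<lambda>\<^sub>\<sigma>\<close> is surjective, two distinct states \<open>p\<close> and \<open>q\<close> cannot have cycles reading the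
  same word, nor cycles writing the same word: otherwise \<open>S\<^sub>pS\<^sub>q\<^sup>*\<close> or \<open>S\<^sub>pS\<^sub>p\<^sup>*\<close> would not be a limit of
  images of gauge-invariant polynomials, as the compressions of such polynomials by long words are scalars.
  A search finds that, up to renaming the states, exactly 14 transducers satisfy these two conditions, and a
  renaming of the states changes \<open>\<lambda>\<^sub>\<sigma>\<close> by an inner automorphism.

  The representatives are invertible since \<open>\<lambda>\<^sub>F\<close> and \<open>\<lambda>\<^sub>J\<close> are involutions, the square of \<open>\<lambda>\<^sub>A\<lambda>\<^sub>F\<close> is inner, and
  \<open>\<lambda>\<^sub>G\<close> has an inverse coming from a permutation of words of length 6. They are told apart by their action on
  periodic orbits: an automorphism \<open>\<phi>\<close> sends \<open>p\<close> to \<open>q\<close> if \<open>\<phi>(S\<^sub>p)y = yS\<^sub>q\<close> for some isometry \<open>y\<close>, inner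
  automorphisms fix every word up to rotation, and the 14 actions on the nine primitive necklaces of length 6
  are distinct.\<close>

section \<open>Contractivity of endomorphisms\<close>

text \<open>The 16! permutations are too many to examine one by one. The classification becomes
  feasible because both cycle conditions can be tested on partial tables and because states carry no
  names: they are labelled in the order in which they are met, starting from the state that the
  first letter leaves in place. Transitions are chosen before outputs, so the condition on written
  words is applied only to transition graphs that already satisfy the one on read words. Both
  conditions are derived as necessary ones; that they suffice is seen from the outcome, since every
  survivor is a representative with an explicit inverse, up to an inner automorphism. Identities
  between endomorphisms are decided on the generators, and identities in the algebra on words of one
  length, whose range projections sum to 1. This turns invertibility into a finite computation with
  words; continuity, hence contractivity, is what justifies the first reduction. In telling classes
  apart, the obstacle is that \<open>sends\<close> could a priori relate one orbit to
  several.\<close>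

lemma star_zero [simp]: "star (0::'a::unital_cstar_algebra) = 0"
  using star_add[of 0 "0::'a"] by simp

lemma star_minus: "star (- x) = - star (x::'a::unital_cstar_algebra)"
  using star_add[of x "- x"] by (simp add: add_eq_0_iff)

lemma star_one [simp]: "star (1::'a::unital_cstar_algebra) = 1"
  using star_mult[of "star 1" "1::'a"] by (simp add: star_star)

lemma star_sum: "star (\<Sum>i\<in>I. f i) = (\<Sum>i\<in>I. star (f i :: 'a::unital_cstar_algebra))"
  by (induction I rule: infinite_finite_induct) (simp_all add: star_add)

lemma scaleC_one [simp]: "scaleC 1 x = (x::'a::unital_cstar_algebra)"
  using scaleC_of_real[of 1 x] by simp

lemma scaleC_zero [simp]: "scaleC 0 x = (0::'a::unital_cstar_algebra)"
  using scaleC_of_real[of 0 x] by simp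

lemma scaleC_zero_right [simp]: "scaleC c 0 = (0::'a::unital_cstar_algebra)"
  using scaleC_add_right[of c 0 "0::'a"] by simp

lemma scaleC_minus_right: "scaleC c (- x) = - scaleC c (x::'a::unital_cstar_algebra)"
  using scaleC_add_right[of c x "- x"] by (simp add: add_eq_0_iff)

lemma scaleC_minus_left: "scaleC (- c) x = - scaleC c (x::'a::unital_cstar_algebra)"
  using scaleC_add_left[of c "- c" x] by (simp add: add_eq_0_iff)

lemma scaleC_diff_right: "scaleC c (x - y) = scaleC c x - scaleC c (y::'a::unital_cstar_algebra)"
  using scaleC_add_right[of c x "- y"] by (simp add: scaleC_minus_right)

lemma scaleC_sum_right: "scaleC c (\<Sum>i\<in>I. f i) = (\<Sum>i\<in>I. scaleC c (f i :: 'a::unital_cstar_algebra))"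
  by (induction I rule: infinite_finite_induct) (simp_all add: scaleC_add_right)

lemma scaleC_sum_left: "scaleC (\<Sum>i\<in>I. f i) x = (\<Sum>i\<in>I. scaleC (f i) (x :: 'a::unital_cstar_algebra))"
  by (induction I rule: infinite_finite_induct) (simp_all add: scaleC_add_left)

lemma star_scaleR: "star (r *\<^sub>R x) = r *\<^sub>R star (x::'a::unital_cstar_algebra)"
  by (simp add: star_scaleC flip: scaleC_of_real)

lemma norm_star [simp]: "norm (star x) = norm (x::'a::unital_cstar_algebra)"
proof -
  have le: "norm y \<le> norm (star y)" for y :: 'a
  proof (cases "norm y = 0")
    case False
    have "norm y * norm y \<le> norm (star y) * norm y"
      using cstar_identity[of y] norm_mult_ineq[of "star y" y] by (simp add: power2_eq_square)
    with False show ?thesis by simp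
  qed simp
  from le[of x] le[of "star x"] show ?thesis by (simp add: star_star)
qed

lemma norm_isometry: "star v * v = 1 \<Longrightarrow> norm (v::'a::unital_cstar_algebra) = 1"
  using cstar_identity[of v] by (simp add: power2_eq_1_iff) (metis norm_ge_zero not_one_le_zero neg_0_le_iff_le le_minus_one_simps(3))

lemma bounded_linear_star: "bounded_linear (star :: 'a::unital_cstar_algebra \<Rightarrow> 'a)"
  by (rule bounded_linear_intro[where K = 1]) (simp_all add: star_add star_scaleR)

lemma endo_simps:
  assumes "unital_star_endomorphism \<phi>"
  shows "\<phi> 1 = 1" "\<phi> (x + y) = \<phi> x + \<phi> y" "\<phi> (x * y) = \<phi> x * \<phi> y" "\<phi> (star x) = star (\<phi> x)"
    "\<phi> (scaleC c x) = scaleC c (\<phi> x)" "\<phi> 0 = 0" "\<phi> (- x) = - \<phi> x" "\<phi> (x - y) = \<phi> x - \<phi> y"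
proof -
  show l: "\<phi> 1 = 1" "\<phi> (x * y) = \<phi> x * \<phi> y" "\<phi> (star x) = star (\<phi> x)"
    "\<phi> (scaleC c x) = scaleC c (\<phi> x)" and add: "\<phi> (x + y) = \<phi> x + \<phi> y" for x y
    using assms by (simp_all add: unital_star_endomorphism_def)
  show z: "\<phi> 0 = 0" using add[of 0 0] by simp
  show m: "\<phi> (- x) = - \<phi> x" for x using add[of x "- x"] z by (simp add: add_eq_0_iff)
  show "\<phi> (x - y) = \<phi> x - \<phi> y" using add[of x "- y"] m by simp
qed

lemma endo_sum:
  assumes "unital_star_endomorphism \<phi>"
  shows "\<phi> (\<Sum>i\<in>I. f i) = (\<Sum>i\<in>I. \<phi> (f i))"
  by (induction I rule: infinite_finite_induct) (simp_all add: endo_simps[OF assms])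

text \<open>Crude, but it lets a geometric series dominate the binomial series when
  \<open>norm a < 1\<close>.\<close>

lemma abs_gbinomial_half_le: "\<bar>(1/2 :: real) gchoose n\<bar> \<le> 1"
proof (induction n)
  case (Suc n)
  have "(1/2 :: real) gchoose Suc n = (1/2 gchoose n) * ((1/2 - real n) / real (Suc n))"
    by (simp add: gbinomial_prod_rev prod.atLeast0_lessThan_Suc)
  moreover have "\<bar>(1/2 - real n) / real (Suc n)\<bar> \<le> 1" by (simp add: field_simps abs_if)
  ultimately show ?case using Suc mult_mono[of "\<bar>(1/2 :: real) gchoose n\<bar>" 1 "\<bar>(1/2 - real n) / real (Suc n)\<bar>" 1]
    by (simp only: abs_mult) simp
qed simp

text \<open>The square root of \<open>1 - a\<close> is its binomial series.\<close>

lemma ex_sqrt_one_minus: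
  fixes a :: "'a::unital_cstar_algebra"
  assumes "norm a < 1" "star a = a"
  shows "\<exists>b. star b = b \<and> b * b = 1 - a \<and> (\<forall>x. x * a = a * x \<longrightarrow> x * b = b * x)"
proof -
  define c where "c n = (-1) ^ n * ((1/2 :: real) gchoose n)" for n
  define f where "f n = c n *\<^sub>R a ^ n" for n
  have "norm (f n) \<le> norm a ^ n" for n
  proof -
    have "norm (f n) \<le> \<bar>c n\<bar> * norm (a ^ n)" by (simp add: f_def)
    also have "\<dots> \<le> 1 * norm a ^ n"
      using abs_gbinomial_half_le[of n] norm_power_ineq[of a n]
      by (intro mult_mono) (simp_all add: c_def abs_mult)
    finally show ?thesis by simp
  qed
  hence sn: "summable (\<lambda>n. norm (f n))"
    using assms(1) summable_comparison_test'[OF summable_geometric[of "norm a"], of 0 "\<lambda>n. norm (f n)"]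
    by simp
  hence sf: "summable f" by (rule summable_norm_cancel)
  define b where "b = suminf f"
  have "(\<lambda>k. \<Sum>i\<le>k. f i * f (k - i)) sums (b * b)"
    unfolding b_def by (rule Cauchy_product_sums[OF sn sn])
  moreover have "(\<Sum>i\<le>k. f i * f (k - i)) = (if k = 0 then 1 else if k = 1 then - a else 0)" for k
  proof -
    have "f i * f (k - i) = ((-1) ^ k * ((1/2 gchoose i) * (1/2 gchoose (k - i)))) *\<^sub>R a ^ k" if "i \<le> k" for i
      using that by (simp add: f_def c_def flip: power_add)
    hence "(\<Sum>i\<le>k. f i * f (k - i)) = ((-1) ^ k * (\<Sum>i\<le>k. (1/2 gchoose i) * (1/2 gchoose (k - i)))) *\<^sub>R a ^ k"
      by (simp add: sum_distrib_left flip: scaleR_left.sum)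
    \<comment> \<open>Vandermonde for 1/2 + 1/2 = 1: the squared series has the binomial
      coefficients of exponent 1, which vanish from the third on.\<close>
    also have "(\<Sum>i\<le>k. (1/2 gchoose i) * ((1/2 :: real) gchoose (k - i))) = 1 gchoose k"
      using gbinomial_Vandermonde[of "1/2 :: real" "1/2" k] by (simp add: atLeast0AtMost)
    also have "(1 :: real) gchoose k = of_nat (1 choose k)" by (simp add: binomial_gbinomial)
    finally show ?thesis
      by (cases k; cases "k - 1") (simp_all add: binomial_eq_0)
  qed
  ultimately have "(\<lambda>k::nat. if k = 0 then 1 else if k = 1 then - a else 0) sums (b * b)" by simp
  moreover have "(\<lambda>k::nat. if k = 0 then 1 else if k = 1 then - a else 0) sums (\<Sum>k\<in>{0::nat, 1}. if k = 0 then 1 else if k = 1 then - a else 0)"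
    by (rule sums_finite) auto
  ultimately have "b * b = 1 - a" using sums_unique2 by fastforce
  moreover have "star b = b"
  proof -
    have "star (a ^ n) = a ^ n" for n
      by (induction n) (simp_all add: star_mult assms(2) power_commutes)
    thus ?thesis
      using bounded_linear.suminf[OF bounded_linear_star sf] by (simp add: b_def f_def[abs_def] star_scaleR)
  qed
  moreover have "x * b = b * x" if "x * a = a * x" for x
  proof -
    have "x * a ^ n = a ^ n * x" for n
      by (induction n) (simp, metis mult.assoc power_Suc that)
    hence "x * f n = f n * x" for n by (simp add: f_def)
    thus ?thesis unfolding b_def
      using suminf_mult[OF sf, of x] suminf_mult2[OF sf, of x] by simp
  qed
  ultimately show ?thesis by blast
qed

text \<open>A self-adjoint contraction \<open>h\<close> is the real part of the unitary \<open>h + i sqrt (1 - h\<^sup>2)\<close>, and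
  unitaries are mapped to unitaries.\<close>

lemma endo_contractive:
  fixes \<phi> :: "'a::unital_cstar_algebra \<Rightarrow> 'a"
  assumes \<phi>: "unital_star_endomorphism \<phi>"
  shows "norm (\<phi> x) \<le> norm x"
proof -
  have unit: "norm (\<phi> h) \<le> 1" if h: "star h = h" "norm h < 1" for h
  proof -
    have "norm (h * h) < 1"
      using h norm_mult_ineq[of h h] mult_strict_mono'[of "norm h" 1 "norm h" 1] by simp
    \<comment> \<open>The root commutes with everything that commutes with \<open>h * h\<close>, in
      particular with \<open>h\<close>; this cancels the cross terms of
      \<open>star u * u\<close>.\<close>
    from ex_sqrt_one_minus[OF this] obtain b where b: "star b = b" "b * b = 1 - h * h" "h * b = b * h"
      using h(1) by (metis mult.assoc star_mult)
    define u where "u = h + scaleC \<i> b"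
    have su: "star u = h - scaleC \<i> b"
      by (simp add: u_def star_add star_scaleC h b scaleC_minus_left)
    have "star u * u = h * h + b * b"
      unfolding su by (simp add: u_def algebra_simps mult_scaleC_left mult_scaleC_right scaleC_scaleC b(3)
        scaleC_minus_left scaleC_add_right scaleC_diff_right)
    hence "star u * u = 1" using b(2) by simp
    hence "star (\<phi> u) * \<phi> u = 1" using endo_simps[OF \<phi>] by metis
    hence nu: "norm (\<phi> u) = 1" by (rule norm_isometry)
    have "2 *\<^sub>R h = u + star u" unfolding su by (simp add: u_def scaleR_2)
    hence "2 *\<^sub>R \<phi> h = \<phi> u + star (\<phi> u)"
      using endo_simps[OF \<phi>] by (metis scaleR_2)
    hence "2 * norm (\<phi> h) \<le> 2"
      using norm_triangle_ineq[of "\<phi> u" "star (\<phi> u)"] nu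
      by (metis norm_scaleR abs_numeral norm_star one_add_one)
    thus ?thesis by simp
  qed
  have sa: "norm (\<phi> h) \<le> norm h" if h: "star h = h" for h
  proof (rule field_le_epsilon)
    fix e :: real assume "0 < e"
    \<comment> \<open>The margin \<open>e\<close> brings the rescaled element strictly below norm 1,
      as the square root requires, and covers \<open>h = 0\<close>.\<close>
    define r where "r = norm h + e"
    have r: "r > 0" using \<open>0 < e\<close> by (simp add: r_def add_nonneg_pos)
    have "norm (inverse r *\<^sub>R h) < 1" using \<open>0 < e\<close> r by (simp add: r_def field_simps)
    hence "norm (\<phi> (inverse r *\<^sub>R h)) \<le> 1" by (intro unit) (simp_all add: star_scaleR h)
    moreover have "\<phi> (inverse r *\<^sub>R h) = inverse r *\<^sub>R \<phi> h"
      using endo_simps(5)[OF \<phi>] by (simp flip: scaleC_of_real)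
    ultimately show "norm (\<phi> h) \<le> norm h + e" using r by (simp add: field_simps r_def)
  qed
  have "norm (\<phi> x) ^ 2 = norm (\<phi> (star x * x))"
    by (simp add: endo_simps[OF \<phi>] cstar_identity)
  also have "\<dots> \<le> norm (star x * x)" by (rule sa) (simp add: star_mult star_star)
  also have "\<dots> = norm x ^ 2" by (rule cstar_identity)
  finally show ?thesis by (simp add: power2_le_iff_abs_le)
qed

section \<open>Words in the generators\<close>

text \<open>With booleans as letters every list is a word: side conditions on the alphabet
  disappear, and finite checks can compute.\<close>

definition letter :: "bool \<Rightarrow> nat" where
  "letter b = (if b then 2 else 1)"

definition bwords :: "nat \<Rightarrow> bool list set" where
  "bwords k = {w. length w = k}"

lemma finite_bwords [simp]: "finite (bwords k)"
  using finite_lists_length_eq[of "UNIV :: bool set" k] by (simp add: bwords_def)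

lemma bwords_0: "bwords 0 = {[]}"
  by (auto simp: bwords_def)

lemma bwords_Suc: "bwords (Suc k) = case_prod (#) ` (UNIV \<times> bwords k)"
  by (force simp: bwords_def length_Suc_conv)

text \<open>A run of the transducer: \<open>s\<close> permutes the state followed by the letter
  read; the head of the result is written and its tail is the next state.\<close>

fun outs :: "(bool list \<Rightarrow> bool list) \<Rightarrow> bool list \<Rightarrow> bool list \<Rightarrow> bool list" where
  "outs s p [] = []"
| "outs s p (j # J) = hd (s (p @ [j])) # outs s (tl (s (p @ [j]))) J"

fun dest :: "(bool list \<Rightarrow> bool list) \<Rightarrow> bool list \<Rightarrow> bool list \<Rightarrow> bool list" where
  "dest s p [] = p"
| "dest s p (j # J) = dest s (tl (s (p @ [j]))) J"

lemma outs_append: "outs s p (J @ K) = outs s p J @ outs s (dest s p J) K"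
  by (induction J arbitrary: p) simp_all

lemma dest_append: "dest s p (J @ K) = dest s (dest s p J) K"
  by (induction J arbitrary: p) simp_all

lemma length_outs [simp]: "length (outs s p J) = length J"
  by (induction J arbitrary: p) simp_all

lemma dest_repeat: "dest s p J = p \<Longrightarrow> dest s p (concat (replicate m J)) = p"
  by (induction m) (simp_all add: dest_append)

lemma outs_repeat:
  "dest s p J = p \<Longrightarrow> outs s p (concat (replicate m J)) = concat (replicate m (outs s p J))"
  by (induction m) (simp_all add: outs_append)

lemma length_repeat: "length (concat (replicate m J)) = m * length J"
  by (induction m) simp_all

context cuntz_algebra
begin

definition V :: "bool list \<Rightarrow> 'a" where
  "V w = word_isometry S (map letter w)"

lemma V_Nil [simp]: "V [] = 1"
  by (simp add: V_def word_isometry_def)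

lemma V_Cons: "V (b # w) = S (letter b) * V w"
  by (simp add: V_def word_isometry_def)

lemma V_append: "V (u @ w) = V u * V w"
  by (induction u) (simp_all add: V_Cons mult.assoc)

lemma star_S_S: "star (S (letter a)) * S (letter b) = (if a = b then 1 else 0)"
proof -
  have r: "star (S 1) * S 1 = 1" "star (S 2) * S 2 = 1" "S 1 * star (S 1) + S 2 * star (S 2) = 1"
    using relations by (simp_all add: cuntz_relations_def)
  have "star (S 1) * S 2 = star (S 1) * (S 1 * star (S 1) + S 2 * star (S 2)) * S 2"
    unfolding r(3) by simp
  also have "\<dots> = star (S 1) * S 1 * (star (S 1) * S 2) + star (S 1) * S 2 * (star (S 2) * S 2)"
    by (simp add: algebra_simps)
  finally have 12: "star (S 1) * S 2 = 0" by (simp add: r[unfolded One_nat_def])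
  hence "star (star (S 1) * S 2) = star 0" by simp
  hence "star (S 2) * S 1 = 0" by (simp only: star_mult star_star star_zero)
  with 12 r show ?thesis by (simp add: letter_def)
qed

lemma sum_S: "(\<Sum>b\<in>UNIV. S (letter b) * star (S (letter b))) = 1"
  using relations by (simp add: cuntz_relations_def letter_def UNIV_bool add.commute)

lemma star_V_V: "length u = length w \<Longrightarrow> star (V u) * V w = (if u = w then 1 else 0)"
proof (induction u w rule: list_induct2)
  case (Cons a u b w)
  have "star (V (a # u)) * V (b # w) = star (V u) * (star (S (letter a)) * S (letter b)) * V w"
    by (simp add: V_Cons star_mult mult.assoc)
  with Cons show ?case by (cases "a = b"; cases "u = w") (simp_all add: star_S_S)
qed simp

lemma norm_V [simp]: "norm (V w) = 1"
  by (rule norm_isometry) (simp add: star_V_V)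

lemma star_V_V_append:
  assumes "length u \<le> length w"
  shows "star (V u) * V w = (if take (length u) w = u then V (drop (length u) w) else 0)"
proof -
  have "star (V u) * V w = star (V u) * V (take (length u) w) * V (drop (length u) w)"
    by (simp add: mult.assoc flip: V_append)
  thus ?thesis using assms by (auto simp: star_V_V)
qed

lemma sum_V: "(\<Sum>w\<in>bwords k. V w * star (V w)) = 1"
proof (induction k)
  case (Suc k)
  have "(\<Sum>w\<in>bwords (Suc k). V w * star (V w)) =
      (\<Sum>(b, w)\<in>UNIV \<times> bwords k. V (b # w) * star (V (b # w)))"
    unfolding bwords_Suc by (subst sum.reindex) (auto simp: inj_on_def intro!: sum.cong)
  also have "\<dots> = (\<Sum>b\<in>UNIV. \<Sum>w\<in>bwords k. S (letter b) * (V w * star (V w)) * star (S (letter b)))"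
    by (simp add: sum.cartesian_product V_Cons star_mult mult.assoc)
  also have "\<dots> = (\<Sum>b\<in>UNIV. S (letter b) * star (S (letter b)))"
    by (simp add: Suc flip: sum_distrib_left sum_distrib_right)
  finally show ?case by (simp add: sum_S)
qed (simp add: bwords_0)

text \<open>The range projections of the words of length \<open>k\<close> sum to 1, so an element is
  determined by its products with the \<open>V w\<close>.\<close>

lemma eq_if_eq_on_words:
  assumes "\<And>w. length w = k \<Longrightarrow> x * V w = y * V w"
  shows "x = y"
proof -
  have "z = (\<Sum>w\<in>bwords k. z * V w * star (V w))" for z
    using arg_cong[OF sum_V[of k], of "\<lambda>t. z * t"] by (simp add: sum_distrib_left mult.assoc)
  thus ?thesis using assms by (metis (mono_tags, lifting) bwords_def mem_Collect_eq sum.cong)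
qed

section \<open>Permutation unitaries and their endomorphisms\<close>

definition U :: "nat \<Rightarrow> (bool list \<Rightarrow> bool list) \<Rightarrow> 'a" where
  "U k s = (\<Sum>w\<in>bwords k. V (s w) * star (V w))"

lemma U_V: "length w = k \<Longrightarrow> U k s * V w = V (s w)"
proof -
  assume w: "length w = k"
  have "U k s * V w = (\<Sum>v\<in>bwords k. V (s v) * (star (V v) * V w))"
    by (simp add: U_def sum_distrib_right mult.assoc)
  also have "\<dots> = (\<Sum>v\<in>bwords k. if v = w then V (s v) else 0)"
    by (rule sum.cong) (auto simp: star_V_V w bwords_def)
  also have "\<dots> = V (s w)"
    using w by (subst sum.delta) (simp_all add: bwords_def[symmetric], simp add: bwords_def)
  finally show ?thesis .
qed

lemma U_V_append: "length w = k \<Longrightarrow> U k s * V (w @ x) = V (s w @ x)"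
  by (simp add: V_append U_V flip: mult.assoc)

lemma unitary_U:
  assumes "bij_betw s (bwords k) (bwords k)"
  shows "unitary (U k s)"
proof -
  have len: "length (s w) = k" if "length w = k" for w
    using bij_betwE[OF assms] that by (auto simp: bwords_def)
  have inj: "s w = s v \<longleftrightarrow> w = v" if "length w = k" "length v = k" for w v
    using inj_on_eq_iff[OF bij_betw_imp_inj_on[OF assms], of w v] that by (simp add: bwords_def)
  have star: "star (U k s) = (\<Sum>w\<in>bwords k. V w * star (V (s w)))"
    by (simp add: U_def star_sum star_mult star_star)
  have UV: "star (U k s) * V (s w) = V w" if w: "length w = k" for w
  proof -
    have "star (U k s) * V (s w) = (\<Sum>v\<in>bwords k. V v * (star (V (s v)) * V (s w)))"
      by (simp add: star sum_distrib_right mult.assoc)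
    also have "\<dots> = (\<Sum>v\<in>bwords k. if v = w then V v else 0)"
      by (rule sum.cong) (auto simp: star_V_V len inj w bwords_def)
    also have "\<dots> = V w"
      using w by (subst sum.delta) (simp_all add: bwords_def[symmetric], simp add: bwords_def)
    finally show ?thesis .
  qed
  have "star (U k s) * U k s = 1"
    by (rule eq_if_eq_on_words[of k]) (simp add: mult.assoc U_V UV)
  moreover have "U k s * star (U k s) = 1"
  proof (rule eq_if_eq_on_words[of k])
    fix w :: "bool list" assume "length w = k"
    hence "w \<in> s ` bwords k" unfolding bij_betw_imp_surj_on[OF assms] by (simp add: bwords_def)
    then obtain v where "length v = k" "w = s v" by (auto simp: bwords_def)
    thus "U k s * star (U k s) * V w = 1 * V w" by (simp add: mult.assoc U_V UV)
  qed
  ultimately show ?thesis by (simp add: unitary_def)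
qed

lemma star_U_V:
  assumes "bij_betw s (bwords k) (bwords k)" "length w = k"
  shows "star (U k s) * V (s w) = V w"
  using unitary_U[OF assms(1)] U_V[OF assms(2), of s] by (metis mult.assoc mult.left_neutral unitary_def)

lemma words_eq: "words k = map letter ` bwords k"
proof
  show "words k \<subseteq> map letter ` bwords k"
  proof
    fix \<alpha> assume \<alpha>: "\<alpha> \<in> words k"
    hence "\<alpha> = map letter (map (\<lambda>i. i = 2) \<alpha>)"
      by (simp add: words_def) (rule map_idI[symmetric], auto simp: letter_def)
    moreover have "map (\<lambda>i. i = 2) \<alpha> \<in> bwords k" using \<alpha> by (simp add: words_def bwords_def)
    ultimately show "\<alpha> \<in> map letter ` bwords k" by blast
  qed
qed (auto simp: words_def bwords_def letter_def)

lemma inj_map_letter: "inj (map letter)"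
  by (rule inj_mapI) (auto simp: inj_def letter_def split: if_splits)

lemma perm_unitary_eq_U:
  assumes "\<And>w. length w = k \<Longrightarrow> \<sigma> (map letter w) = map letter (s w)"
  shows "perm_unitary S k \<sigma> = U k s"
proof -
  have "perm_unitary S k \<sigma> = (\<Sum>w\<in>bwords k. word_isometry S (\<sigma> (map letter w)) * star (V w))"
    unfolding perm_unitary_def words_eq
    by (subst sum.reindex) (simp_all add: V_def inj_on_subset[OF inj_map_letter])
  also have "\<dots> = U k s"
    unfolding U_def V_def by (rule sum.cong) (simp_all add: assms bwords_def)
  finally show ?thesis .
qed

lemma perm_unitaries_eq: "perm_unitaries S k = {U k s | s. bij_betw s (bwords k) (bwords k)}"
proof (intro equalityI subsetI)
  fix u assume "u \<in> perm_unitaries S k"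
  then obtain \<sigma> where \<sigma>: "\<sigma> permutes words k" "u = perm_unitary S k \<sigma>"
    by (auto simp: perm_unitaries_def)
  define s where "s = inv_into UNIV (map letter) \<circ> \<sigma> \<circ> map letter"
  have bl: "bij_betw (map letter) (bwords k) (words k)"
    unfolding words_eq by (rule inj_on_imp_bij_betw[OF inj_on_subset[OF inj_map_letter]]) simp
  have bl': "bij_betw (inv_into UNIV (map letter)) (words k) (bwords k)"
    unfolding words_eq bij_betw_def using inj_map_letter
    by (auto simp: inj_on_def image_image)
  have "bij_betw s (bwords k) (bwords k)"
    unfolding s_def using bl bl' permutes_imp_bij[OF \<sigma>(1)] by (meson bij_betw_trans)
  moreover have "\<sigma> (map letter w) = map letter (s w)" if "length w = k" for w
  proof -
    have "\<sigma> (map letter w) \<in> words k"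
      unfolding permutes_in_image[OF \<sigma>(1)] using that by (simp add: words_eq bwords_def)
    hence "\<sigma> (map letter w) \<in> range (map letter)" by (auto simp: words_eq)
    thus ?thesis by (simp add: s_def f_inv_into_f)
  qed
  ultimately show "u \<in> {U k s | s. bij_betw s (bwords k) (bwords k)}"
    using perm_unitary_eq_U \<sigma>(2) by blast
next
  fix u assume "u \<in> {U k s | s. bij_betw s (bwords k) (bwords k)}"
  then obtain s where s: "bij_betw s (bwords k) (bwords k)" "u = U k s" by blast
  \<comment> \<open>\<open>permutes\<close> demands the identity outside \<open>words k\<close>,
    whereas \<open>bij_betw\<close> leaves \<open>s\<close> arbitrary on words of other
    lengths.\<close>
  define \<sigma> where "\<sigma> \<alpha> = (if \<alpha> \<in> words k then map letter (s (inv_into UNIV (map letter) \<alpha>)) else \<alpha>)" for \<alpha>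
  have \<sigma>: "\<sigma> (map letter w) = map letter (s w)" if "length w = k" for w
    using that inj_map_letter by (simp add: \<sigma>_def words_eq bwords_def)
  have "bij_betw \<sigma> (words k) (words k)"
  proof (rule bij_betw_imageI)
    show "inj_on \<sigma> (words k)"
    proof (rule inj_onI)
      fix \<alpha> \<beta> assume "\<alpha> \<in> words k" "\<beta> \<in> words k" and eq: "\<sigma> \<alpha> = \<sigma> \<beta>"
      then obtain v w where vw: "\<alpha> = map letter v" "\<beta> = map letter w" "v \<in> bwords k" "w \<in> bwords k"
        by (auto simp: words_eq)
      with eq \<sigma> inj_map_letter have "s v = s w" by (auto simp: bwords_def dest: injD)
      with vw s(1) show "\<alpha> = \<beta>" by (metis bij_betw_imp_inj_on inj_onD)
    qed
    have "\<sigma> ` words k = map letter ` s ` bwords k"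
      unfolding words_eq image_image by (rule image_cong) (auto simp: \<sigma> bwords_def)
    thus "\<sigma> ` words k = words k" using bij_betw_imp_surj_on[OF s(1)] by (simp add: words_eq)
  qed
  hence "\<sigma> permutes words k" by (rule bij_imp_permutes) (simp add: \<sigma>_def)
  moreover have "u = perm_unitary S k \<sigma>" using perm_unitary_eq_U[of k \<sigma> s] \<sigma> s(2) by simp
  ultimately show "u \<in> perm_unitaries S k"
    unfolding perm_unitaries_def by blast
qed

text \<open>By contractivity the set where both maps agree is closed, hence a C*-subalgebra
  containing the generators.\<close>

lemma endo_eqI:
  assumes \<phi>: "unital_star_endomorphism \<phi>" and \<psi>: "unital_star_endomorphism \<psi>"
    and eq: "\<And>b. \<phi> (S (letter b)) = \<psi> (S (letter b))"
  shows "\<phi> = \<psi>"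
proof -
  have bl: "bounded_linear \<chi>" if "unital_star_endomorphism \<chi>" for \<chi> :: "'a \<Rightarrow> 'a"
    by (rule bounded_linear_intro[where K = 1])
      (use endo_simps[OF that] endo_contractive[OF that] in \<open>simp_all flip: scaleC_of_real\<close>)
  let ?B = "{x. \<phi> x = \<psi> x}"
  have "closed ?B"
    using bl[OF \<phi>] bl[OF \<psi>] by (intro closed_Collect_eq bounded_linear.continuous_on[OF _ continuous_on_id])
  moreover have "star_subalgebra ?B"
    unfolding star_subalgebra_def using endo_simps[OF \<phi>] endo_simps[OF \<psi>]
    by (auto intro: exI[of _ 1])
  moreover have "{S 1, S 2} \<subseteq> ?B"
    using eq[of False] eq[of True] by (simp add: letter_def)
  ultimately have "generated_cstar_subalgebra {S 1, S 2} \<subseteq> ?B"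
    unfolding generated_cstar_subalgebra_def by blast
  thus ?thesis using generating by auto
qed

text \<open>Resolves the definite description: existence comes from \<open>universal\<close>, since
  multiplying by the unitary \<open>star u\<close> preserves the Cuntz relations, and uniqueness
  from \<open>endo_eqI\<close>.\<close>

lemma cuntz_endo:
  assumes u: "unitary u"
  shows "unital_star_endomorphism (cuntz_endo S u)" "cuntz_endo S u (S (letter b)) = star u * S (letter b)"
proof -
  have uu: "star u * u = 1" "u * star u = 1" using u by (simp_all add: unitary_def)
  let ?T = "\<lambda>i. star u * S i"
  have cancel: "star (star u * x) * (star u * y) = star x * y" for x y
    by (metis (no_types) star_mult star_star mult.assoc uu(2) mult.left_neutral)
  have "cuntz_relations ?T"
    unfolding cuntz_relations_def
  proof (intro conjI)
    show "star (?T 1) * ?T 1 = 1" "star (?T 2) * ?T 2 = 1"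
      unfolding cancel using relations by (simp_all add: cuntz_relations_def)
    have "?T 1 * star (?T 1) + ?T 2 * star (?T 2) = star u * (S 1 * star (S 1) + S 2 * star (S 2)) * u"
      by (simp add: star_mult star_star algebra_simps)
    also have "S 1 * star (S 1) + S 2 * star (S 2) = 1" using relations by (simp add: cuntz_relations_def)
    finally show "?T 1 * star (?T 1) + ?T 2 * star (?T 2) = 1" by (simp add: uu)
  qed
  from universal[OF this] obtain \<phi> where
    \<phi>: "unital_star_endomorphism \<phi>" "\<phi> (S 1) = ?T 1" "\<phi> (S 2) = ?T 2" by blast
  have "cuntz_endo S u = \<phi>"
    unfolding cuntz_endo_def
  proof (rule the_equality)
    show "unital_star_endomorphism \<phi> \<and> (\<forall>i\<in>{1, 2}. \<phi> (S i) = star u * S i)" using \<phi> by simp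
    fix \<psi> assume "unital_star_endomorphism \<psi> \<and> (\<forall>i\<in>{1, 2}. \<psi> (S i) = star u * S i)"
    with \<phi> show "\<psi> = \<phi>" by (intro endo_eqI) (auto simp: letter_def)
  qed
  thus "unital_star_endomorphism (cuntz_endo S u)" "cuntz_endo S u (S (letter b)) = star u * S (letter b)"
    using \<phi> by (simp_all add: letter_def)
qed

lemma endo_comp:
  "unital_star_endomorphism \<phi> \<Longrightarrow> unital_star_endomorphism \<psi> \<Longrightarrow> unital_star_endomorphism (\<phi> \<circ> \<psi>)"
  by (simp add: unital_star_endomorphism_def)

lemma endo_conj:
  assumes "unitary u"
  shows "unital_star_endomorphism (\<lambda>x. u * x * star u)"
proof -
  have uu: "star u * u = 1" "u * star u = 1" using assms by (simp_all add: unitary_def)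
  have "u * (x * y) * star u = u * x * star u * (u * y * star u)" for x y
    by (metis (no_types) mult.assoc mult.left_neutral uu(1))
  thus ?thesis
    by (simp add: unital_star_endomorphism_def uu distrib_left distrib_right mult_scaleC_left
        mult_scaleC_right star_mult star_star mult.assoc)
qed

abbreviation \<Lambda> :: "nat \<Rightarrow> (bool list \<Rightarrow> bool list) \<Rightarrow> 'a \<Rightarrow> 'a" where
  "\<Lambda> k s \<equiv> cuntz_endo S (U k s)"

lemma \<Lambda>_endo: "bij_betw s (bwords k) (bwords k) \<Longrightarrow> unital_star_endomorphism (\<Lambda> k s)"
  by (rule cuntz_endo[OF unitary_U])

lemma \<Lambda>_S: "bij_betw s (bwords k) (bwords k) \<Longrightarrow> \<Lambda> k s (S (letter b)) = star (U k s) * S (letter b)"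
  by (rule cuntz_endo[OF unitary_U])

lemma \<Lambda>_step:
  assumes s: "bij_betw s (bwords k) (bwords k)" and w: "length w = k" "s w = i # q"
  shows "\<Lambda> k s (S (letter i)) * V q = V w"
proof -
  have "star (U k s) * V (i # q) = V w" using star_U_V[OF s w(1)] w(2) by simp
  thus ?thesis by (simp add: \<Lambda>_S[OF s] V_Cons mult.assoc)
qed

lemma \<Lambda>_path:
  assumes s: "bij_betw s (bwords (Suc n)) (bwords (Suc n))"
  shows "length p = n \<Longrightarrow> \<Lambda> (Suc n) s (V (outs s p J)) * V (dest s p J) = V (p @ J)"
proof (induction J arbitrary: p)
  case Nil
  thus ?case by (simp add: endo_simps[OF \<Lambda>_endo[OF s]])
next
  case (Cons j J)
  have "s (p @ [j]) \<in> bwords (Suc n)" using Cons.prems bij_betwE[OF s] by (simp add: bwords_def)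
  then obtain i q where q: "s (p @ [j]) = i # q" "length q = n"
    by (auto simp: bwords_def length_Suc_conv)
  have "\<Lambda> (Suc n) s (V (outs s p (j # J))) * V (dest s p (j # J)) =
      \<Lambda> (Suc n) s (S (letter i)) * (\<Lambda> (Suc n) s (V (outs s q J)) * V (dest s q J))"
    by (simp add: q V_Cons endo_simps[OF \<Lambda>_endo[OF s]] mult.assoc)
  also have "\<dots> = \<Lambda> (Suc n) s (S (letter i)) * V q * V J"
    by (simp add: Cons.IH[OF q(2)] V_append mult.assoc)
  also have "\<dots> = V (p @ [j]) * V J"
    using \<Lambda>_step[OF s _ q(1)] Cons.prems by simp
  finally show ?case by (simp flip: V_append)
qed

end

section \<open>Cycles of surjective permutative endomorphisms\<close>

context cuntz_algebra
begin

text \<open>The relation \<open>R\<close> restricts the lengths in a monomial: the full relation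
  gives the dense *-algebra of all polynomials, equality its gauge-invariant part.\<close>

inductive_set polys :: "(nat \<Rightarrow> nat \<Rightarrow> bool) \<Rightarrow> 'a set" for R where
  monomial: "R (length u) (length v) \<Longrightarrow> V u * star (V v) \<in> polys R"
| add: "a \<in> polys R \<Longrightarrow> b \<in> polys R \<Longrightarrow> a + b \<in> polys R"
| scale: "a \<in> polys R \<Longrightarrow> scaleC c a \<in> polys R"

abbreviation "all_polys \<equiv> polys (\<lambda>_ _. True)"
abbreviation "core_polys \<equiv> polys (=)"

lemma zero_polys: "R 0 0 \<Longrightarrow> 0 \<in> polys R"
  using polys.scale[OF polys.monomial[of R "[]" "[]"], of 0] by simp

lemma mult_monomials: "V u * star (V v) * (V u' * star (V v')) \<in> all_polys"
proof (cases "length v \<le> length u'")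
  case True
  have "V u * (star (V v) * V u') * star (V v') \<in> all_polys"
    using polys.monomial[of "\<lambda>_ _. True" "u @ drop (length v) u'" v'] zero_polys[of "\<lambda>_ _. True"]
    by (simp add: star_V_V_append[OF True] V_append)
  thus ?thesis by (simp add: mult.assoc)
next
  case False
  hence "length u' \<le> length v" by simp
  from arg_cong[OF star_V_V_append[OF this], of star]
  have "star (V v) * V u' = (if take (length u') v = u' then star (V (drop (length u') v)) else 0)"
    by (simp add: star_mult star_star)
  hence "V u * (star (V v) * V u') * star (V v') \<in> all_polys"
    using polys.monomial[of "\<lambda>_ _. True" u "v' @ drop (length u') v"] zero_polys[of "\<lambda>_ _. True"]
    by (simp add: V_append star_mult mult.assoc)
  thus ?thesis by (simp add: mult.assoc)
qed

lemma mult_monomial_poly: "b \<in> all_polys \<Longrightarrow> V u * star (V v) * b \<in> all_polys"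
  by (induction rule: polys.induct)
    (auto simp: distrib_left mult_scaleC_right intro: mult_monomials polys.add polys.scale)

lemma mult_polys: "a \<in> all_polys \<Longrightarrow> b \<in> all_polys \<Longrightarrow> a * b \<in> all_polys"
  by (induction rule: polys.induct)
    (auto simp: distrib_right mult_scaleC_left intro: mult_monomial_poly polys.add polys.scale)

lemma star_polys: "a \<in> all_polys \<Longrightarrow> star a \<in> all_polys"
  by (induction rule: polys.induct)
    (auto simp: star_mult star_star star_add star_scaleC intro: polys.intros)

lemma bounded_linear_scaleC: "bounded_linear (scaleC c :: 'a \<Rightarrow> 'a)"
  by (rule bounded_linear_intro[where K = "cmod c"])
    (simp_all add: scaleC_add_right norm_scaleC scaleC_scaleC mult.commute flip: scaleC_of_real)

lemma closure_polys: "closure all_polys = UNIV"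
proof -
  let ?B = "closure all_polys"
  have B: "z \<in> ?B" if "\<And>n. h n \<in> all_polys" "h \<longlonglongrightarrow> z" for h z
    unfolding closure_sequential using that by blast
  have "star_subalgebra ?B"
    unfolding star_subalgebra_def
  proof (intro conjI ballI allI)
    show "?B \<noteq> {}" using zero_polys[of "\<lambda>_ _. True"] closure_subset by blast
  next
    fix x y assume "x \<in> ?B" "y \<in> ?B"
    then obtain f g where fg: "\<And>n. f n \<in> all_polys" "f \<longlonglongrightarrow> x" "\<And>n. g n \<in> all_polys" "g \<longlonglongrightarrow> y"
      by (auto simp: closure_sequential)
    show "x + y \<in> ?B" by (rule B[of "\<lambda>n. f n + g n"]) (simp_all add: fg polys.add tendsto_add)
    show "x * y \<in> ?B" by (rule B[of "\<lambda>n. f n * g n"]) (simp_all add: fg mult_polys tendsto_mult)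
  next
    fix x and c :: complex assume "x \<in> ?B"
    then obtain f where f: "\<And>n. f n \<in> all_polys" "f \<longlonglongrightarrow> x" by (auto simp: closure_sequential)
    show "star x \<in> ?B"
      by (rule B[of "\<lambda>n. star (f n)"]) (simp_all add: f star_polys bounded_linear.tendsto[OF bounded_linear_star])
    show "scaleC c x \<in> ?B"
      by (rule B[of "\<lambda>n. scaleC c (f n)"])
        (simp_all add: f polys.scale bounded_linear.tendsto[OF bounded_linear_scaleC])
  qed
  moreover have "{S 1, S 2} \<subseteq> ?B"
    using polys.monomial[of "\<lambda>_ _. True" "[False]" "[]"] polys.monomial[of "\<lambda>_ _. True" "[True]" "[]"]
      closure_subset[of all_polys] by (auto simp: V_Cons letter_def)
  ultimately have "generated_cstar_subalgebra {S 1, S 2} \<subseteq> ?B"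
    unfolding generated_cstar_subalgebra_def by blast
  thus ?thesis using generating by auto
qed

lemma poly_approx: "e > 0 \<Longrightarrow> \<exists>a\<in>all_polys. norm (a - x) < e"
  using closure_polys by (metis UNIV_I closure_approachable dist_norm)

section \<open>The gauge action and its averages\<close>

text \<open>The conjugate compensates the star in the definition of \<^const>\<open>cuntz_endo\<close>, so that \<open>gauge z\<close>
  multiplies each generator by \<open>z\<close>.\<close>

definition gauge :: "complex \<Rightarrow> 'a \<Rightarrow> 'a" where
  "gauge z = cuntz_endo S (scaleC (cnj z) 1)"

lemma
  assumes "cmod z = 1"
  shows gauge_endo: "unital_star_endomorphism (gauge z)"
    and gauge_S: "gauge z (S (letter b)) = scaleC z (S (letter b))"
proof -
  have "z * cnj z = 1" using assms complex_norm_square[of z] by simp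
  hence "unitary (scaleC (cnj z) 1 :: 'a)"
    by (simp add: unitary_def star_scaleC mult_scaleC_left mult_scaleC_right scaleC_scaleC mult.commute)
  from cuntz_endo[OF this] show "unital_star_endomorphism (gauge z)"
    "gauge z (S (letter b)) = scaleC z (S (letter b))"
    by (simp_all add: gauge_def star_scaleC mult_scaleC_left)
qed

lemma gauge_V: "cmod z = 1 \<Longrightarrow> gauge z (V w) = scaleC (z ^ length w) (V w)"
  by (induction w) (simp_all add: V_Cons endo_simps[OF gauge_endo] gauge_S mult_scaleC_left
      mult_scaleC_right scaleC_scaleC mult.commute)

lemma gauge_monomial:
  "cmod z = 1 \<Longrightarrow> gauge z (V u * star (V v)) = scaleC (z ^ length u * cnj z ^ length v) (V u * star (V v))"
  by (simp add: endo_simps[OF gauge_endo] gauge_V star_scaleC mult_scaleC_left mult_scaleC_right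
      scaleC_scaleC mult.commute)

lemma gauge_core_monomial:
  assumes "cmod z = 1" "length u = length v"
  shows "gauge z (V u * star (V v)) = V u * star (V v)"
proof -
  have "z * cnj z = 1" using assms complex_norm_square[of z] by simp
  hence "z ^ length v * cnj z ^ length v = 1" by (simp flip: power_mult_distrib)
  thus ?thesis using assms by (simp add: gauge_monomial)
qed

text \<open>\<open>s\<close> preserves lengths, so \<open>U k s\<close> has degree zero and is
  gauge-invariant; both composites then agree on the generators.\<close>

lemma gauge_\<Lambda>:
  assumes z: "cmod z = 1" and s: "bij_betw s (bwords k) (bwords k)"
  shows "gauge z (\<Lambda> k s x) = \<Lambda> k s (gauge z x)"
proof -
  have "gauge z (U k s) = U k s"
    unfolding U_def endo_sum[OF gauge_endo[OF z]]
    by (rule sum.cong) (use bij_betwE[OF s] in \<open>auto simp: bwords_def intro: gauge_core_monomial[OF z]\<close>)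
  hence "gauge z \<circ> \<Lambda> k s = \<Lambda> k s \<circ> gauge z"
    by (intro endo_eqI endo_comp gauge_endo \<Lambda>_endo z s)
      (simp add: \<Lambda>_S[OF s] gauge_S[OF z] endo_simps[OF gauge_endo[OF z]] endo_simps[OF \<Lambda>_endo[OF s]]
        mult_scaleC_right)
  thus ?thesis by (metis comp_apply)
qed

text \<open>Averaging over the \<open>N\<close>-th roots of unity instead of the circle already kills all monomials
  whose degree is nonzero and less than \<open>N\<close> in absolute value.\<close>

definition average :: "nat \<Rightarrow> 'a \<Rightarrow> 'a" where
  "average N x = scaleC (1 / of_nat N) (\<Sum>k<N. gauge (cis (2 * pi * real k / real N)) x)"

lemma average_linear:
  "average N (x + y) = average N x + average N y" "average N (x - y) = average N x - average N y"
  "average N (scaleC c x) = scaleC c (average N x)"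
  by (simp_all add: average_def endo_simps[OF gauge_endo] sum.distrib sum_subtractf scaleC_add_right
      scaleC_diff_right scaleC_scaleC mult.commute flip: scaleC_sum_right)

lemma norm_average_le:
  assumes "N > 0"
  shows "norm (average N x) \<le> norm x"
proof -
  have "norm (\<Sum>k<N. gauge (cis (2 * pi * real k / real N)) x) \<le> (\<Sum>k<N. norm x)"
    by (rule sum_norm_le) (simp add: endo_contractive gauge_endo)
  thus ?thesis using assms by (simp add: average_def norm_scaleC norm_divide field_simps)
qed

lemma average_fixed:
  assumes "N > 0" "\<And>z. cmod z = 1 \<Longrightarrow> gauge z x = x"
  shows "average N x = x"
proof -
  have "(\<Sum>k<N. gauge (cis (2 * pi * real k / real N)) x) = (\<Sum>k<N. scaleC 1 x)"
    by (rule sum.cong) (simp_all add: assms(2))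
  also have "\<dots> = scaleC (\<Sum>k<N. 1) x" by (simp only: scaleC_sum_left)
  finally show ?thesis using assms(1) by (simp add: average_def scaleC_scaleC)
qed

lemma average_\<Lambda>: "bij_betw s (bwords k) (bwords k) \<Longrightarrow> average N (\<Lambda> k s x) = \<Lambda> k s (average N x)"
  by (simp add: average_def gauge_\<Lambda> endo_simps[OF \<Lambda>_endo] endo_sum[OF \<Lambda>_endo])

lemma average_monomial:
  assumes "length u < N" "length v < N"
  shows "average N (V u * star (V v)) = (if length u = length v then V u * star (V v) else 0)"
proof (cases "length u = length v")
  case True
  thus ?thesis using assms by (simp add: average_fixed gauge_core_monomial)
next
  case False
  define t where "t = 2 * pi * (real (length u) - real (length v)) / real N"
  \<comment> \<open>Otherwise \<open>N\<close> would divide the degree, which is nonzero and smaller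
    than \<open>N\<close> in absolute value. As an \<open>N\<close>-th root of unity other than 1,
    \<open>cis t\<close> then makes the geometric sum vanish.\<close>
  have "cis t \<noteq> 1"
  proof
    assume "cis t = 1"
    hence "cos t = 1" by (metis cis.sel(1) one_complex.sel(1))
    then obtain m :: int where "t = of_int m * 2 * pi" by (auto simp: cos_one_2pi_int)
    hence "real (length u) - real (length v) = of_int m * real N"
    proof -
      have "2 * pi * (real (length u) - real (length v)) = 2 * pi * (of_int m * real N)"
        using \<open>t = of_int m * 2 * pi\<close> assms by (simp add: t_def field_simps)
      thus ?thesis by simp
    qed
    hence *: "int (length u) - int (length v) = m * int N"
      by (metis (mono_tags, opaque_lifting) of_int_diff of_int_eq_iff of_int_mult of_int_of_nat_eq)
    with False have "m \<noteq> 0" by auto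
    hence "1 * int N \<le> \<bar>m\<bar> * int N" by (intro mult_right_mono) auto
    hence "int N \<le> \<bar>m * int N\<bar>" by (simp add: abs_mult)
    with * assms show False by linarith
  qed
  have "cis t ^ N = cis (2 * pi * (real (length u) - real (length v)))"
    using assms by (simp add: DeMoivre t_def)
  also have "\<dots> = cis (2 * pi * real_of_int (int (length u) - int (length v)))" by simp
  also have "\<dots> = 1" by (rule cis_multiple_2pi) simp
  finally have tN: "cis t ^ N = 1" .
  have "cis (2 * pi * real k / real N) ^ length u * cnj (cis (2 * pi * real k / real N)) ^ length v = cis t ^ k" for k
    using assms by (simp add: DeMoivre cis_cnj cis_mult t_def field_simps)
  hence "(\<Sum>k<N. gauge (cis (2 * pi * real k / real N)) (V u * star (V v))) =
      scaleC (\<Sum>k<N. cis t ^ k) (V u * star (V v))"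
    by (simp add: gauge_monomial scaleC_sum_left)
  also have "(\<Sum>k<N. cis t ^ k) = 0" using \<open>cis t \<noteq> 1\<close> tN by (simp add: sum_gp_strict)
  finally show ?thesis using False by (simp add: average_def)
qed

lemma average_core: "a \<in> all_polys \<Longrightarrow> \<exists>n. \<forall>N>n. average N a \<in> core_polys"
proof (induction rule: polys.induct)
  case (monomial u v)
  have "average N (V u * star (V v)) \<in> core_polys" if "N > max (length u) (length v)" for N
    using that polys.monomial[of "(=)" u v] zero_polys[of "(=)"] by (simp add: average_monomial)
  thus ?case by blast
next
  case (add a b)
  then obtain m n where "\<forall>N>m. average N a \<in> core_polys" "\<forall>N>n. average N b \<in> core_polys" by blast
  hence "\<forall>N>max m n. average N (a + b) \<in> core_polys" by (simp add: average_linear polys.add)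
  thus ?case by blast
qed (auto simp: average_linear intro: polys.scale)

text \<open>A preimage of \<open>y\<close> is approximated by a polynomial, which is then averaged.
  Averaging commutes with the endomorphism, fixes \<open>y\<close> and does not increase norms, so
  the approximation survives.\<close>

lemma core_approx:
  assumes s: "bij_betw s (bwords k) (bwords k)" and surj: "surj (\<Lambda> k s)"
    and inv: "\<And>z. cmod z = 1 \<Longrightarrow> gauge z y = y" and e: "e > 0"
  shows "\<exists>a\<in>core_polys. norm (\<Lambda> k s a - y) < e"
proof -
  obtain x where x: "\<Lambda> k s x = y" using surj by (metis surjD)
  obtain a where a: "a \<in> all_polys" "norm (a - x) < e" using poly_approx[OF e] by blast
  obtain n where n: "\<forall>N>n. average N a \<in> core_polys" using average_core[OF a(1)] by blast
  define N where "N = Suc n"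
  have "average N y = y" using inv by (simp add: average_fixed N_def)
  hence "\<Lambda> k s (average N a) - y = average N (\<Lambda> k s (a - x))"
    by (simp add: average_linear average_\<Lambda>[OF s] endo_simps[OF \<Lambda>_endo[OF s]] x flip: average_\<Lambda>[OF s])
  hence "norm (\<Lambda> k s (average N a) - y) \<le> norm (\<Lambda> k s (a - x))"
    using norm_average_le[of N] by (simp add: N_def)
  also have "\<dots> \<le> norm (a - x)" by (rule endo_contractive[OF \<Lambda>_endo[OF s]])
  finally show ?thesis using a(2) n by (intro bexI[of _ "average N a"]) (auto simp: N_def)
qed

text \<open>Words at least as long as both words of a monomial absorb them and leave two remainders
  of equal length, whose product is 0 or 1.\<close>

lemma core_scalar:
  "a \<in> core_polys \<Longrightarrow> \<exists>n. \<forall>u v. length u = length v \<longrightarrow> n \<le> length u \<longrightarrow>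
     (\<exists>c. star (V u) * a * V v = scaleC c 1)"
proof (induction rule: polys.induct)
  case (monomial w x)
  have "\<exists>c. star (V u) * (V w * star (V x)) * V v = scaleC c 1"
    if uv: "length u = length v" "length w \<le> length u" for u v
  proof -
    have "star (V u) * V w = (if take (length w) u = w then star (V (drop (length w) u)) else 0)"
      using arg_cong[OF star_V_V_append[OF uv(2)], of star] by (simp add: star_mult star_star)
    moreover have "star (V x) * V v = (if take (length x) v = x then V (drop (length x) v) else 0)"
      using uv monomial by (intro star_V_V_append) simp
    moreover have "star (V (drop (length w) u)) * V (drop (length x) v) \<in> {1, 0}"
      using uv monomial by (simp add: star_V_V)
    ultimately have "star (V u) * V w * (star (V x) * V v) \<in> {1, 0}" by auto
    hence "star (V u) * (V w * star (V x)) * V v \<in> {1, 0}" by (simp add: mult.assoc)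
    thus ?thesis by (metis empty_iff insert_iff scaleC_one scaleC_zero)
  qed
  thus ?case by blast
next
  case (add a b)
  then obtain m n where
    m: "\<And>u v. length u = length v \<Longrightarrow> m \<le> length u \<Longrightarrow> \<exists>c. star (V u) * a * V v = scaleC c 1" and
    n: "\<And>u v. length u = length v \<Longrightarrow> n \<le> length u \<Longrightarrow> \<exists>c. star (V u) * b * V v = scaleC c 1" by blast
  have "\<exists>c. star (V u) * (a + b) * V v = scaleC c 1" if "length u = length v" "max m n \<le> length u" for u v
  proof -
    from that m n obtain c d where "star (V u) * a * V v = scaleC c 1" "star (V u) * b * V v = scaleC d 1"
      by (meson max.bounded_iff)
    hence "star (V u) * (a + b) * V v = scaleC (c + d) 1"
      by (simp add: distrib_left distrib_right scaleC_add_left)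
    thus ?thesis by blast
  qed
  thus ?case by blast
next
  case (scale a c)
  then obtain n where
    n: "\<And>u v. length u = length v \<Longrightarrow> n \<le> length u \<Longrightarrow> \<exists>c. star (V u) * a * V v = scaleC c 1" by blast
  have "\<exists>d. star (V u) * scaleC c a * V v = scaleC d 1" if "length u = length v" "n \<le> length u" for u v
  proof -
    from n[OF that] obtain d where "star (V u) * a * V v = scaleC d 1" by blast
    hence "star (V u) * scaleC c a * V v = scaleC (c * d) 1"
      by (simp add: mult_scaleC_left mult_scaleC_right scaleC_scaleC)
    thus ?thesis by blast
  qed
  thus ?case by blast
qed

lemma long_cycle:
  assumes "dest s p J = p" "J \<noteq> []"
  shows "dest s p (concat (replicate m J)) = p" "m \<le> length (concat (replicate m J))"
proof -
  show "dest s p (concat (replicate m J)) = p" using assms(1) by (rule dest_repeat)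
  have "m * 1 \<le> m * length J" using assms(2) by (intro mult_le_mono2) (simp add: Suc_leI)
  thus "m \<le> length (concat (replicate m J))" by (simp add: length_repeat)
qed

text \<open>Compressing the image along cycles is the image of a compression by the words written.
  With long cycles these are long, so \<open>core_scalar\<close> applies to \<open>a\<close>
  itself.\<close>

lemma \<Lambda>_compress:
  assumes s: "bij_betw s (bwords (Suc n)) (bwords (Suc n))"
    and p: "length p = n" "dest s p J = p" and q: "length q = n" "dest s q K = q"
  shows "star (V (p @ J)) * \<Lambda> (Suc n) s a * V (q @ K) =
    star (V p) * \<Lambda> (Suc n) s (star (V (outs s p J)) * a * V (outs s q K)) * V q"
proof -
  have "V (p @ J) = \<Lambda> (Suc n) s (V (outs s p J)) * V p" "V (q @ K) = \<Lambda> (Suc n) s (V (outs s q K)) * V q"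
    using \<Lambda>_path[OF s p(1), of J] \<Lambda>_path[OF s q(1), of K] p q by simp_all
  thus ?thesis by (simp add: star_mult endo_simps[OF \<Lambda>_endo[OF s]] mult.assoc)
qed

lemma norm_compress_le: "norm (star (V u) * x * V v) \<le> norm x"
proof -
  have "norm (star (V u) * x * V v) \<le> norm (star (V u) * x)"
    using norm_mult_ineq[of "star (V u) * x" "V v"] by simp
  also have "\<dots> \<le> norm x" using norm_mult_ineq[of "star (V u)" x] by simp
  finally show ?thesis .
qed

text \<open>Along repetitions of the common word \<open>J\<close>, the compressed image of a core
  polynomial is a multiple of \<open>star (V p) * V q\<close>, hence 0, while
  \<open>V p * star (V q)\<close> compresses to 1. So the latter has distance at least 1 from all
  such images.\<close>

lemma surj_input_cycle_unique:
  assumes s: "bij_betw s (bwords (Suc n)) (bwords (Suc n))" and surj: "surj (\<Lambda> (Suc n) s)"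
    and p: "length p = n" "dest s p J = p" and q: "length q = n" "dest s q J = q" and J: "J \<noteq> []"
  shows "p = q"
proof (rule ccontr)
  assume "p \<noteq> q"
  have "cmod z = 1 \<Longrightarrow> gauge z (V p * star (V q)) = V p * star (V q)" for z
    using p q by (simp add: gauge_core_monomial)
  from core_approx[OF s surj this, of 1] obtain a where
    a: "a \<in> core_polys" "norm (\<Lambda> (Suc n) s a - V p * star (V q)) < 1" by auto
  obtain m where m: "\<And>u v. length u = length v \<Longrightarrow> m \<le> length u \<Longrightarrow> \<exists>c. star (V u) * a * V v = scaleC c 1"
    using core_scalar[OF a(1)] by blast
  define K where "K = concat (replicate m J)"
  have K: "dest s p K = p" "dest s q K = q" "m \<le> length K"
    using long_cycle[OF p(2) J] long_cycle[OF q(2) J] by (simp_all add: K_def)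
  obtain c where "star (V (outs s p K)) * a * V (outs s q K) = scaleC c 1" using m K(3) by force
  hence "star (V (p @ K)) * \<Lambda> (Suc n) s a * V (q @ K) = scaleC c (star (V p) * V q)"
    by (simp add: \<Lambda>_compress[OF s p(1) K(1) q(1) K(2)] endo_simps[OF \<Lambda>_endo[OF s]]
        mult_scaleC_left mult_scaleC_right)
  hence "star (V (p @ K)) * \<Lambda> (Suc n) s a * V (q @ K) = 0"
    using \<open>p \<noteq> q\<close> p q by (simp add: star_V_V)
  moreover have "star (V (p @ K)) * (V p * star (V q)) * V (q @ K) = 1"
  proof -
    have "star (V (p @ K)) * V p = star (V K)" "star (V q) * V (q @ K) = V K"
      by (simp_all add: V_append star_mult star_V_V mult.assoc)
        (simp_all add: star_V_V flip: mult.assoc)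
    hence "star (V (p @ K)) * V p * (star (V q) * V (q @ K)) = 1" by (simp add: star_V_V)
    thus ?thesis by (simp add: mult.assoc)
  qed
  ultimately have "star (V (p @ K)) * (\<Lambda> (Suc n) s a - V p * star (V q)) * V (q @ K) = - 1"
    by (simp add: right_diff_distrib left_diff_distrib)
  with norm_compress_le[of "p @ K" "\<Lambda> (Suc n) s a - V p * star (V q)" "q @ K"] a(2) show False by simp
qed

text \<open>Equal outputs give the same scalar \<open>c\<close> at both cycles, whereas
  \<open>V p * star (V p)\<close> compresses to 1 at \<open>p\<close> and to 0 at \<open>q\<close>;
  no \<open>c\<close> lies within 1/2 of both.\<close>

lemma surj_output_cycle_unique:
  assumes s: "bij_betw s (bwords (Suc n)) (bwords (Suc n))" and surj: "surj (\<Lambda> (Suc n) s)"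
    and p: "length p = n" "dest s p J = p" and q: "length q = n" "dest s q K = q" and J: "J \<noteq> []"
    and out: "outs s p J = outs s q K"
  shows "p = q"
proof (rule ccontr)
  assume "p \<noteq> q"
  have "cmod z = 1 \<Longrightarrow> gauge z (V p * star (V p)) = V p * star (V p)" for z
    by (simp add: gauge_core_monomial)
  from core_approx[OF s surj this, of "1/2"] obtain a where
    a: "a \<in> core_polys" "norm (\<Lambda> (Suc n) s a - V p * star (V p)) < 1/2" by auto
  obtain m where m: "\<And>u v. length u = length v \<Longrightarrow> m \<le> length u \<Longrightarrow> \<exists>c. star (V u) * a * V v = scaleC c 1"
    using core_scalar[OF a(1)] by blast
  have KJ: "length K = length J" using out by (metis length_outs)
  hence "K \<noteq> []" using J by auto
  define J' K' where "J' = concat (replicate m J)" "K' = concat (replicate m K)"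
  have cyc: "dest s p J' = p" "dest s q K' = q" "m \<le> length J'"
    using long_cycle[OF p(2) J] long_cycle[OF q(2) \<open>K \<noteq> []\<close>] by (simp_all add: J'_K'_def)
  have out': "outs s p J' = outs s q K'" using out by (simp add: J'_K'_def outs_repeat p q)
  obtain c where c: "star (V (outs s p J')) * a * V (outs s p J') = scaleC c 1" using m cyc(3) by force
  have "star (V (p @ J')) * \<Lambda> (Suc n) s a * V (p @ J') = scaleC c 1"
    "star (V (q @ K')) * \<Lambda> (Suc n) s a * V (q @ K') = scaleC c 1"
    using c out' by (simp_all add: \<Lambda>_compress[OF s p(1) cyc(1) p(1) cyc(1)]
        \<Lambda>_compress[OF s q(1) cyc(2) q(1) cyc(2)] endo_simps[OF \<Lambda>_endo[OF s]]
        mult_scaleC_left mult_scaleC_right star_V_V)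
  moreover have "star (V (p @ J')) * (V p * star (V p)) * V (p @ J') = 1"
  proof -
    have "star (V (p @ J')) * V p = star (V J')" "star (V p) * V (p @ J') = V J'"
      by (simp_all add: V_append star_mult star_V_V mult.assoc)
        (simp_all add: star_V_V flip: mult.assoc)
    hence "star (V (p @ J')) * V p * (star (V p) * V (p @ J')) = 1" by (simp add: star_V_V)
    thus ?thesis by (simp add: mult.assoc)
  qed
  moreover have "star (V (q @ K')) * (V p * star (V p)) * V (q @ K') = 0"
  proof -
    have "star (V p) * V (q @ K') = 0"
      using \<open>p \<noteq> q\<close> p q by (simp add: V_append star_V_V flip: mult.assoc)
    thus ?thesis by (simp add: mult.assoc)
  qed
  ultimately have *: "star (V (p @ J')) * (\<Lambda> (Suc n) s a - V p * star (V p)) * V (p @ J') = scaleC c 1 - 1"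
    "star (V (q @ K')) * (\<Lambda> (Suc n) s a - V p * star (V p)) * V (q @ K') = scaleC c 1"
    by (simp_all add: right_diff_distrib left_diff_distrib)
  have "norm (scaleC c 1 - 1 :: 'a) < 1/2"
    using a(2) norm_compress_le[of "p @ J'" "\<Lambda> (Suc n) s a - V p * star (V p)" "p @ J'"] unfolding * by simp
  moreover have "norm (scaleC c 1 :: 'a) < 1/2"
    using a(2) norm_compress_le[of "q @ K'" "\<Lambda> (Suc n) s a - V p * star (V p)" "q @ K'"] unfolding * by simp
  ultimately show False using norm_triangle_ineq4[of "scaleC c 1 :: 'a" "scaleC c 1 - 1"] by simp
qed

end

section \<open>Transducers with eight states\<close>


text \<open>For a finite automaton on \<open>Q\<close> this is equivalent to every sufficiently long
  word sending all states to a single one. The form with cycles is what surjectivity yields.\<close>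

definition resets :: "'q set \<Rightarrow> (bool \<Rightarrow> 'q \<Rightarrow> 'q) \<Rightarrow> bool" where
  "resets Q d \<longleftrightarrow> (\<forall>w p q. w \<noteq> [] \<longrightarrow> p \<in> Q \<longrightarrow> q \<in> Q \<longrightarrow>
     fold d w p = p \<longrightarrow> fold d w q = q \<longrightarrow> p = q)"

section \<open>Search through partial transition tables\<close>

datatype label = L0 | L1 | L2 | L3 | L4 | L5 | L6 | L7

datatype 'a table = Table "'a option" "'a option" "'a option" "'a option"
  "'a option" "'a option" "'a option" "'a option"

fun entry :: "'a table \<Rightarrow> label \<Rightarrow> 'a option" where
  "entry (Table a b c d e f g h) L0 = a"
| "entry (Table a b c d e f g h) L1 = b"
| "entry (Table a b c d e f g h) L2 = c"
| "entry (Table a b c d e f g h) L3 = d"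
| "entry (Table a b c d e f g h) L4 = e"
| "entry (Table a b c d e f g h) L5 = f"
| "entry (Table a b c d e f g h) L6 = g"
| "entry (Table a b c d e f g h) L7 = h"

fun set_entry :: "'a table \<Rightarrow> label \<Rightarrow> 'a \<Rightarrow> 'a table" where
  "set_entry (Table a b c d e f g h) L0 x = Table (Some x) b c d e f g h"
| "set_entry (Table a b c d e f g h) L1 x = Table a (Some x) c d e f g h"
| "set_entry (Table a b c d e f g h) L2 x = Table a b (Some x) d e f g h"
| "set_entry (Table a b c d e f g h) L3 x = Table a b c (Some x) e f g h"
| "set_entry (Table a b c d e f g h) L4 x = Table a b c d (Some x) f g h"
| "set_entry (Table a b c d e f g h) L5 x = Table a b c d e (Some x) g h"
| "set_entry (Table a b c d e f g h) L6 x = Table a b c d e f (Some x) h"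
| "set_entry (Table a b c d e f g h) L7 x = Table a b c d e f g (Some x)"

definition blank :: "'a table" where
  "blank = Table None None None None None None None None"

definition labels :: "label list" where
  "labels = [L0, L1, L2, L3, L4, L5, L6, L7]"

text \<open>Whether some input word of length at most \<open>n\<close> maps the pair \<open>{a, b}\<close> onto \<open>{p, q}\<close>. The nested
  conditionals, here and below, make rewriting lazy.\<close>

fun merges :: "label table \<Rightarrow> label table \<Rightarrow> nat \<Rightarrow> label \<Rightarrow> label \<Rightarrow> label \<Rightarrow> label \<Rightarrow> bool" where
  "merges F G n a b p q =
    (if a = b then False
     else if (if a = p then b = q else if a = q then b = p else False) then True
     else (case n of 0 \<Rightarrow> False | Suc m \<Rightarrow>
       if (case entry F a of None \<Rightarrow> False | Some x \<Rightarrow>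
            (case entry F b of None \<Rightarrow> False | Some y \<Rightarrow> merges F G m x y p q)) then True
       else (case entry G a of None \<Rightarrow> False | Some x \<Rightarrow>
            (case entry G b of None \<Rightarrow> False | Some y \<Rightarrow> merges F G m x y p q))))"

declare merges.simps [simp del]

text \<open>Looks for a cycle of pairs through the new edge from \<open>v\<close> to
  \<open>t\<close>: the successors of \<open>v\<close> and \<open>q\<close> along the same letter
  must not be led back to the pair of \<open>v\<close> and \<open>q\<close>. The bound 6 only limits
  the pruning; an overlooked cycle cannot discard a valid table.\<close>

fun conflict :: "label table \<Rightarrow> label table \<Rightarrow> label table \<Rightarrow> label \<Rightarrow> label \<Rightarrow> label list \<Rightarrow> bool" where
  "conflict H F G v t [] = False"
| "conflict H F G v t (q # qs) =
    (if (case entry H q of None \<Rightarrow> False | Some x \<Rightarrow>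
          merges F G 6 t x v q) then True
     else conflict H F G v t qs)"

fun pick :: "label table \<Rightarrow> label table \<Rightarrow> label list \<Rightarrow> (label \<times> bool) option" where
  "pick F G [] = None"
| "pick F G (v # vs) = (case entry F v of None \<Rightarrow> Some (v, False) | Some _ \<Rightarrow>
     (case entry G v of None \<Rightarrow> Some (v, True) | Some _ \<Rightarrow> pick F G vs))"

fun in_edges :: "label table \<Rightarrow> label table \<Rightarrow> label \<Rightarrow> label list \<Rightarrow> (label \<times> bool) list" where
  "in_edges F G b [] = []"
| "in_edges F G b (v # vs) =
    (if entry F v = Some b then [(v, False)] else []) @
    (if entry G v = Some b then [(v, True)] else []) @ in_edges F G b vs"

type_synonym solution = "label table \<times> label table \<times> bool table \<times> bool table"

text \<open>Marks a branch that was given up, for lack of depth or because a label has not exactly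
  two incoming edges. Soundness holds with this alternative; comparison with the explicit list of
  results excludes it.\<close>

definition failure :: solution where
  "failure = (blank, blank, blank, blank)"

text \<open>\<open>H\<close> and \<open>K\<close> hold the predecessors along edges with output \<^const>\<open>False\<close> and \<^const>\<open>True\<close>, \<open>A\<close> and
  \<open>B\<close> the outputs of the edges with input \<^const>\<open>False\<close> and \<^const>\<open>True\<close>.\<close>

function (sequential) outputs ::
    "label table \<Rightarrow> label table \<Rightarrow> label table \<Rightarrow> label table \<Rightarrow> bool table \<Rightarrow> bool table \<Rightarrow>
      label list \<Rightarrow> solution list"
  and outputs_step ::
    "label table \<Rightarrow> label table \<Rightarrow> label table \<Rightarrow> label table \<Rightarrow> bool table \<Rightarrow> bool table \<Rightarrow>
      label \<Rightarrow> label \<Rightarrow> label \<Rightarrow> label list \<Rightarrow> solution list" where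
  "outputs F G H K A B [] = [(F, G, A, B)]"
| "outputs F G H K A B (b # bs) = (case in_edges F G b labels of
     [(v, j), (v', j')] \<Rightarrow>
       outputs_step F G (set_entry H b v) (set_entry K b v')
         (if j then (if j' then A else set_entry A v' True)
          else (if j' then set_entry A v False else set_entry (set_entry A v False) v' True))
         (if j then (if j' then set_entry (set_entry B v False) v' True else set_entry B v False)
          else (if j' then set_entry B v' True else B))
         b v v' bs @
       outputs_step F G (set_entry H b v') (set_entry K b v)
         (if j then (if j' then A else set_entry A v' False)
          else (if j' then set_entry A v True else set_entry (set_entry A v True) v' False))
         (if j then (if j' then set_entry (set_entry B v True) v' False else set_entry B v True)
          else (if j' then set_entry B v' False else B))
         b v' v bs
   | _ \<Rightarrow> [failure])"
| "outputs_step F G H K A B b v v' bs =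
    (if conflict H H K b v labels then [] else if conflict K H K b v' labels then []
     else outputs F G H K A B bs)"
  by pat_completeness auto
termination
  by (relation "measure (case_sum (\<lambda>(_,_,_,_,_,_,bs). 2 * length bs)
     (\<lambda>(_,_,_,_,_,_,_,_,_,bs). 2 * length bs + 1))") auto

text \<open>Depth-first search for the partial transition tables \<open>F\<close> and \<open>G\<close> of the two inputs. The states met so
  far have the labels \<open>ks\<close>, latest first; \<open>fs\<close> are the unused labels, and \<open>os\<close> the used ones with only one
  known incoming edge (a state has exactly two, one for each output).\<close>

function (sequential) search ::
    "nat \<Rightarrow> label table \<Rightarrow> label table \<Rightarrow> label list \<Rightarrow> label list \<Rightarrow> label list \<Rightarrow> solution list"
  and tries ::
    "nat \<Rightarrow> label table \<Rightarrow> label table \<Rightarrow> label \<Rightarrow> bool \<Rightarrow> label list \<Rightarrow> label list \<Rightarrow> label list \<Rightarrow>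
      label list \<Rightarrow> solution list"
  and search_step ::
    "nat \<Rightarrow> label table \<Rightarrow> label table \<Rightarrow> label table \<Rightarrow> label \<Rightarrow> label \<Rightarrow> label list \<Rightarrow> label list \<Rightarrow>
      label list \<Rightarrow> solution list" where
  "search n F G ks fs os = (case pick F G ks of
     None \<Rightarrow> (case fs of [] \<Rightarrow> outputs F G blank blank blank blank labels | _ # _ \<Rightarrow> [])
   | Some (v, j) \<Rightarrow> (case n of 0 \<Rightarrow> [failure] | Suc m \<Rightarrow>
       tries m F G v j ks fs [] os @
       (case fs of [] \<Rightarrow> [] | x # xs \<Rightarrow>
         (if j then search m F (set_entry G v x) (x # ks) xs (x # os)
          else search m (set_entry F v x) G (x # ks) xs (x # os)))))"
| "tries m F G v j ks fs us [] = []"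
| "tries m F G v j ks fs us (t # ts) =
    (if j then search_step m (set_entry G v t) F (set_entry G v t) v t ks fs (us @ ts)
     else search_step m (set_entry F v t) (set_entry F v t) G v t ks fs (us @ ts)) @
    tries m F G v j ks fs (t # us) ts"
| "search_step m H F G v t ks fs os = (if conflict H F G v t ks then [] else search m F G ks fs os)"
  by pat_completeness auto
termination
  by (relation "measures [case_sum (\<lambda>(n,_). 2 * n) (case_sum (\<lambda>(m,_). 2 * m + 1) (\<lambda>(m,_). 2 * m + 1)),
     case_sum (\<lambda>_. 0) (case_sum (\<lambda>(_,_,_,_,_,_,_,_,ts). Suc (length ts)) (\<lambda>_. 0))]") auto

declare outputs_step.simps [simp del] search.simps [simp del] search_step.simps [simp del]

section \<open>Soundness of the conflict test\<close>

lemma entry_set_entry: "entry (set_entry T x y) z = (if z = x then Some y else entry T z)"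
  by (cases T; cases x; cases z; simp)

lemma entry_blank [simp]: "entry blank v = None"
  by (cases v) (simp_all add: blank_def)

lemma set_labels [simp]: "set labels = UNIV"
proof -
  have "v \<in> set labels" for v by (cases v) (simp_all add: labels_def)
  thus ?thesis by auto
qed

lemma card_label: "card (UNIV :: label set) = 8"
proof -
  have "card (set labels) = 8" by (simp add: labels_def del: set_labels)
  thus ?thesis by simp
qed

lemma finite_label: "finite (UNIV :: label set)"
  using card_label by (metis card.infinite zero_neq_numeral)

text \<open>The square of a word that exchanges two states fixes both.\<close>

lemma resets_swap:
  assumes "resets Q d" "w \<noteq> []" "p \<in> Q" "q \<in> Q" "fold d w p = q" "fold d w q = p"
  shows "p = q"
proof -
  have "fold d (w @ w) p = p" "fold d (w @ w) q = q" using assms by auto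
  with assms show ?thesis unfolding resets_def by (metis append_is_Nil_conv)
qed

definition agrees :: "(label \<Rightarrow> 'q) \<Rightarrow> label table \<Rightarrow> ('q \<Rightarrow> 'q) \<Rightarrow> bool" where
  "agrees e T f \<longleftrightarrow> (\<forall>v t. entry T v = Some t \<longrightarrow> f (e v) = e t)"

lemma agrees_blank: "agrees e blank f"
  by (simp add: agrees_def)

lemma agrees_set_entry: "agrees e T f \<Longrightarrow> f (e v) = e t \<Longrightarrow> agrees e (set_entry T v t) f"
  by (simp add: agrees_def entry_set_entry)

lemma merges_path:
  assumes "agrees e F (d False)" "agrees e G (d True)"
  shows "merges F G n a b p q \<Longrightarrow> p \<noteq> q \<and> (\<exists>w. fold d w (e a) = e p \<and> fold d w (e b) = e q \<or>
    fold d w (e a) = e q \<and> fold d w (e b) = e p)"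
proof (induction n arbitrary: a b)
  case 0
  have "fold d [] x = x" for x by simp
  with 0 show ?case by (subst (asm) merges.simps) (metis nat.case(1))
next
  case (Suc n)
  have ab: "a \<noteq> b" using Suc.prems by (subst (asm) merges.simps) (auto split: if_splits)
  show ?case
  proof (cases "a = p \<and> b = q \<or> a = q \<and> b = p")
    case True
    have "fold d [] x = x" for x by simp
    with True ab show ?thesis by metis
  next
    case False
    have "\<exists>j x y. entry (if j then G else F) a = Some x \<and> entry (if j then G else F) b = Some y \<and>
        merges F G n x y p q"
      using Suc.prems ab False
      apply (subst (asm) merges.simps)
      apply (auto split: if_splits option.splits)
      done
    then obtain j x y where
      xy: "entry (if j then G else F) a = Some x" "entry (if j then G else F) b = Some y"
        "merges F G n x y p q" by blast
    have d: "d j (e a) = e x" "d j (e b) = e y"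
      using xy(1,2) assms unfolding agrees_def by (cases j; simp)+
    from Suc.IH[OF xy(3)] obtain w where "p \<noteq> q"
      and w: "fold d w (e x) = e p \<and> fold d w (e y) = e q \<or> fold d w (e x) = e q \<and> fold d w (e y) = e p"
      by blast
    have "fold d (j # w) (e a) = fold d w (e x)" "fold d (j # w) (e b) = fold d w (e y)"
      using d by simp_all
    with w \<open>p \<noteq> q\<close> show ?thesis by metis
  qed
qed

text \<open>The letter of the new edge followed by the merging word fixes \<open>v\<close> and
  \<open>q\<close> or exchanges them, and \<open>resets\<close> forbids either.\<close>

lemma conflict_not_resets:
  assumes "agrees e F (d False)" "agrees e G (d True)" "agrees e H (d j)"
    and "inj_on e (set ks)" "e ` set ks \<subseteq> Q" "entry H v = Some t" "v \<in> set ks"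
    and "conflict H F G v t qs" "set qs \<subseteq> set ks"
  shows "\<not> resets Q d"
  using assms(8,9)
proof (induction qs)
  case (Cons q qs)
  show ?case
  proof (cases "conflict H F G v t qs")
    case True
    with Cons show ?thesis by simp
  next
    case False
    then obtain x n where x: "entry H q = Some x" "merges F G n t x v q"
      using Cons.prems by (auto split: option.splits if_splits)
    from merges_path[OF assms(1,2) this(2)] obtain w where "v \<noteq> q" and
      w: "fold d w (e t) = e v \<and> fold d w (e x) = e q \<or> fold d w (e t) = e q \<and> fold d w (e x) = e v"
      by blast
    have d: "d j (e v) = e t" "d j (e q) = e x"
      using assms(3,6) x(1) by (simp_all add: agrees_def)
    have Q: "e v \<in> Q" "e q \<in> Q" "e v \<noteq> e q"
      using assms(4,5,7) Cons.prems \<open>v \<noteq> q\<close> by (auto dest: inj_onD)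
    show ?thesis
    proof
      assume r: "resets Q d"
      have f: "fold d (j # w) (e v) = fold d w (e t)" "fold d (j # w) (e q) = fold d w (e x)"
        using d by simp_all
      from w show False
      proof
        assume "fold d w (e t) = e v \<and> fold d w (e x) = e q"
        with f r Q show False unfolding resets_def by (metis list.distinct(1))
      next
        assume "fold d w (e t) = e q \<and> fold d w (e x) = e v"
        with resets_swap[OF r, of "j # w" "e v" "e q"] f Q show False by simp
      qed
    qed
  qed
qed simp

lemma pick_NoneD:
  "pick F G ks = None \<Longrightarrow> v \<in> set ks \<Longrightarrow> \<exists>t u. entry F v = Some t \<and> entry G v = Some u"
  by (induction ks) (auto split: option.splits)

lemma pick_SomeD:
  "pick F G ks = Some (v, j) \<Longrightarrow> v \<in> set ks \<and> entry (if j then G else F) v = None"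
  by (induction ks) (auto split: option.splits)

lemma set_in_edges:
  "set (in_edges F G b vs) = {(v, j). v \<in> set vs \<and> entry (if j then G else F) v = Some b}"
  by (induction vs) auto

text \<open>Inverting \<open>\<Phi>\<close> exchanges reading and writing, so the condition on
  cycles with equal outputs becomes \<open>resets\<close> for the predecessor map, and one conflict
  test serves both directions.\<close>

locale transducer =
  fixes Q :: "'q set" and \<Phi> :: "bool \<times> 'q \<Rightarrow> bool \<times> 'q"
  assumes bij: "bij_betw \<Phi> (UNIV \<times> Q) (UNIV \<times> Q)"
    and card_states: "card Q = 8"
    and forward: "resets Q (\<lambda>j p. snd (\<Phi> (j, p)))"
    and backward: "resets Q (\<lambda>i q. snd (inv_into (UNIV \<times> Q) \<Phi> (i, q)))"
begin

definition \<delta> :: "bool \<Rightarrow> 'q \<Rightarrow> 'q" where "\<delta> j p = snd (\<Phi> (j, p))"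
definition \<omega> :: "bool \<Rightarrow> 'q \<Rightarrow> bool" where "\<omega> j p = fst (\<Phi> (j, p))"
definition \<pi> :: "bool \<Rightarrow> 'q \<Rightarrow> 'q" where "\<pi> i q = snd (inv_into (UNIV \<times> Q) \<Phi> (i, q))"

lemma \<Phi>_eq: "\<Phi> (j, p) = (\<omega> j p, \<delta> j p)"
  by (simp add: \<delta>_def \<omega>_def)

lemma resets_\<delta>: "resets Q \<delta>" and resets_\<pi>: "resets Q \<pi>"
  using forward backward by (simp_all add: \<delta>_def[abs_def] \<pi>_def[abs_def])

lemma finite_states: "finite Q"
  using card_states by (metis card.infinite zero_neq_numeral)

lemma \<delta>_closed: "p \<in> Q \<Longrightarrow> \<delta> j p \<in> Q"
  using bij_betwE[OF bij] by (metis SigmaD2 SigmaI UNIV_I \<delta>_def prod.collapse)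

lemma \<pi>_eq: "p \<in> Q \<Longrightarrow> \<pi> (\<omega> j p) (\<delta> j p) = p"
  using inv_into_f_f[OF bij_betw_imp_inj_on[OF bij], of "(j, p)"] by (simp add: \<pi>_def \<Phi>_eq)

lemma edge_unique:
  "p \<in> Q \<Longrightarrow> p' \<in> Q \<Longrightarrow> \<omega> j p = \<omega> j' p' \<Longrightarrow> \<delta> j p = \<delta> j' p' \<Longrightarrow> j = j' \<and> p = p'"
  using inj_onD[OF bij_betw_imp_inj_on[OF bij], of "(j, p)" "(j', p')"] by (simp add: \<Phi>_eq)

lemma edge_into: "q \<in> Q \<Longrightarrow> \<exists>j p. p \<in> Q \<and> \<omega> j p = i \<and> \<delta> j p = q"
proof -
  assume "q \<in> Q"
  hence "(i, q) \<in> \<Phi> ` (UNIV \<times> Q)" using bij by (simp add: bij_betw_def)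
  thus ?thesis unfolding image_iff by (metis SigmaD2 \<Phi>_eq old.prod.exhaust prod.inject)
qed

lemma fold_replicate_\<delta>: "fold \<delta> (replicate n False) p = (\<delta> False ^^ n) p"
  by (induction n arbitrary: p) (simp_all add: funpow_swap1)

text \<open>Iteration runs into a cycle. A state on it and its successor have loops reading the same
  power of \<open>False\<close>, so they coincide.\<close>

lemma fixed_state:
  assumes "R \<subseteq> Q" "R \<noteq> {}" "\<And>p. p \<in> R \<Longrightarrow> \<delta> False p \<in> R"
  shows "\<exists>p\<in>R. \<delta> False p = p"
proof -
  obtain p0 where "p0 \<in> R" using assms by blast
  define f where "f n = (\<delta> False ^^ n) p0" for n
  have fR: "f n \<in> R" for n
    by (induction n) (use \<open>p0 \<in> R\<close> assms(3) in \<open>auto simp: f_def\<close>)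
  have "\<not> inj f"
    using fR assms(1) finite_states by (metis finite_subset infinite_UNIV_nat finite_imageD image_subsetI)
  then obtain m n where mn: "m < n" "f m = f n"
    unfolding inj_def by (metis linorder_neqE_nat)
  define p where "p = f m"
  define k where "k = n - m"
  have "(\<delta> False ^^ k) p = f (k + m)" by (simp add: p_def f_def funpow_add)
  also have "\<dots> = p" using mn by (simp add: k_def p_def)
  finally have k: "(\<delta> False ^^ k) p = p" .
  have k': "(\<delta> False ^^ k) (\<delta> False p) = \<delta> False p"
    using k by (metis funpow_swap1)
  have "p \<in> R" by (simp add: p_def fR)
  have "replicate k False \<noteq> []" using mn by (simp add: k_def)
  with k k' \<open>p \<in> R\<close> assms(1,3) resets_\<delta> have "p = \<delta> False p"
    unfolding resets_def by (metis fold_replicate_\<delta> subsetD)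
  with \<open>p \<in> R\<close> show ?thesis by metis
qed

text \<open>By counting, \<open>\<Phi>\<close> maps the edges out of \<open>R\<close> onto those
  into \<open>R\<close>, so the complement is closed under \<open>False\<close> as well. Both sets
  would then contain a state fixed by \<open>False\<close>.\<close>

lemma closed_states:
  assumes "R \<subseteq> Q" "R \<noteq> {}" "\<And>j p. p \<in> R \<Longrightarrow> \<delta> j p \<in> R"
  shows "R = Q"
proof (rule ccontr)
  assume "R \<noteq> Q"
  have "\<Phi> ` (UNIV \<times> R) = UNIV \<times> R"
  proof (rule endo_inj_surj)
    show "finite ((UNIV :: bool set) \<times> R)"
      using finite_subset[OF assms(1) finite_states] by simp
    show "\<Phi> ` (UNIV \<times> R) \<subseteq> UNIV \<times> R" using assms(3) by (auto simp: \<Phi>_eq)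
    show "inj_on \<Phi> (UNIV \<times> R)"
      by (rule inj_on_subset[OF bij_betw_imp_inj_on[OF bij]]) (use assms(1) in auto)
  qed
  have out: "\<delta> False p \<in> Q - R" if p: "p \<in> Q - R" for p
  proof -
    have "\<delta> False p \<notin> R"
    proof
      assume "\<delta> False p \<in> R"
      hence "\<Phi> (False, p) \<in> \<Phi> ` (UNIV \<times> R)"
        unfolding \<open>\<Phi> ` (UNIV \<times> R) = UNIV \<times> R\<close> by (simp add: \<Phi>_eq)
      then obtain j r where "r \<in> R" "\<Phi> (False, p) = \<Phi> (j, r)" by auto
      with p assms(1) edge_unique[of p r False j] show False by (auto simp: \<Phi>_eq)
    qed
    with p \<delta>_closed show ?thesis by blast
  qed
  obtain p where p: "p \<in> R" "\<delta> False p = p" using fixed_state[of R] assms by blast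
  obtain q where q: "q \<in> Q - R" "\<delta> False q = q"
    using fixed_state[of "Q - R"] out \<open>R \<noteq> Q\<close> assms(1) by blast
  have "fold \<delta> [False] p = p" "fold \<delta> [False] q = q" using p q by simp_all
  with p q assms(1) resets_\<delta> have "p = q" unfolding resets_def by (metis DiffD1 list.distinct(1) subsetD)
  with p q show False by blast
qed

section \<open>Soundness of the search\<close>

definition describes :: "(label \<Rightarrow> 'q) \<Rightarrow> solution \<Rightarrow> bool" where
  "describes e s \<longleftrightarrow> bij_betw e UNIV Q \<and> (case s of (F, G, A, B) \<Rightarrow> \<forall>v. \<exists>t u a b.
     entry F v = Some t \<and> entry G v = Some u \<and> entry A v = Some a \<and> entry B v = Some b \<and>
     \<Phi> (False, e v) = (a, e t) \<and> \<Phi> (True, e v) = (b, e u))"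

text \<open>Here \<open>bs\<close> lists the labels whose two incoming edges have not been given outputs yet.\<close>

definition outputs_inv where
  "outputs_inv e F G H K A B bs \<longleftrightarrow> bij_betw e UNIV Q \<and> agrees e F (\<delta> False) \<and> agrees e G (\<delta> True) \<and>
     (\<forall>v. entry F v \<noteq> None \<and> entry G v \<noteq> None) \<and> agrees e H (\<pi> False) \<and> agrees e K (\<pi> True) \<and>
     (\<forall>v a. entry A v = Some a \<longrightarrow> \<omega> False (e v) = a) \<and> (\<forall>v a. entry B v = Some a \<longrightarrow> \<omega> True (e v) = a) \<and>
     (\<forall>v t. t \<notin> set bs \<longrightarrow> entry F v = Some t \<longrightarrow> entry A v \<noteq> None) \<and>
     (\<forall>v t. t \<notin> set bs \<longrightarrow> entry G v = Some t \<longrightarrow> entry B v \<noteq> None)"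

text \<open>Both ways of giving different outputs to the two edges into a label are tried. The true
  one is never pruned, because the predecessor map satisfies \<open>resets\<close>.\<close>

lemma outputs_sound:
  "outputs_inv e F G H K A B bs \<Longrightarrow> \<exists>s\<in>set (outputs F G H K A B bs). s = failure \<or> describes e s"
proof (induction bs arbitrary: H K A B)
  case Nil
  have *: "\<exists>t. entry F v = Some t \<and> \<delta> False (e v) = e t" "\<exists>t. entry G v = Some t \<and> \<delta> True (e v) = e t"
    "entry A v = Some (\<omega> False (e v))" "entry B v = Some (\<omega> True (e v))" for v
  proof -
    have inv: "agrees e F (\<delta> False)" "agrees e G (\<delta> True)" "\<forall>v. entry F v \<noteq> None \<and> entry G v \<noteq> None"
      "\<forall>v a. entry A v = Some a \<longrightarrow> \<omega> False (e v) = a" "\<forall>v a. entry B v = Some a \<longrightarrow> \<omega> True (e v) = a"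
      "\<forall>v t. entry F v = Some t \<longrightarrow> entry A v \<noteq> None" "\<forall>v t. entry G v = Some t \<longrightarrow> entry B v \<noteq> None"
      using Nil by (simp_all add: outputs_inv_def)
    from inv(3) obtain t u where tu: "entry F v = Some t" "entry G v = Some u" by fast
    with inv(6,7) obtain a b where "entry A v = Some a" "entry B v = Some b" by fast
    with tu inv(1,2,4,5) show "\<exists>t. entry F v = Some t \<and> \<delta> False (e v) = e t"
      "\<exists>t. entry G v = Some t \<and> \<delta> True (e v) = e t"
      "entry A v = Some (\<omega> False (e v))" "entry B v = Some (\<omega> True (e v))"
      by (simp_all add: agrees_def)
  qed
  have "describes e (F, G, A, B)"
    unfolding describes_def \<Phi>_eq prod.case
  proof (intro conjI allI)
    show "bij_betw e UNIV Q" using Nil by (simp add: outputs_inv_def)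
    fix v
    from *[of v] show "\<exists>t u a b. entry F v = Some t \<and> entry G v = Some u \<and> entry A v = Some a \<and>
        entry B v = Some b \<and> (\<omega> False (e v), \<delta> False (e v)) = (a, e t) \<and>
        (\<omega> True (e v), \<delta> True (e v)) = (b, e u)" by blast
  qed
  thus ?case by simp
next
  case (Cons b bs)
  have e: "bij_betw e UNIV Q" using Cons.prems by (simp add: outputs_inv_def)
  have eQ: "e v \<in> Q" for v using bij_betwE[OF e] by simp
  have einj: "e v = e v' \<Longrightarrow> v = v'" for v v' using bij_betw_imp_inj_on[OF e] by (auto dest: injD)
  have \<delta>: "entry F v = Some t \<longleftrightarrow> \<delta> False (e v) = e t" "entry G v = Some t \<longleftrightarrow> \<delta> True (e v) = e t" for v t
  proof -
    have "agrees e F (\<delta> False)" "agrees e G (\<delta> True)" "entry F v \<noteq> None" "entry G v \<noteq> None"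
      using Cons.prems by (simp_all add: outputs_inv_def)
    thus "entry F v = Some t \<longleftrightarrow> \<delta> False (e v) = e t" "entry G v = Some t \<longleftrightarrow> \<delta> True (e v) = e t"
      by (auto simp: agrees_def dest: einj)
  qed
  have into: "\<exists>j v. \<omega> j (e v) = i \<and> \<delta> j (e v) = e b" for i
    using edge_into[OF eQ, of i b] e by (metis bij_betw_imp_surj_on imageE)
  have edges: "set (in_edges F G b labels) = {(v, j). \<delta> j (e v) = e b}"
  proof -
    have "entry (if j then G else F) v = Some b \<longleftrightarrow> \<delta> j (e v) = e b" for v j
      using \<delta> by (cases j) simp_all
    thus ?thesis unfolding set_in_edges by simp
  qed
  show ?case
  proof (cases "\<exists>x y. in_edges F G b labels = [x, y]")
    case False
    hence "outputs F G H K A B (b # bs) = [failure]" by (auto split: list.splits)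
    thus ?thesis by simp
  next
    case True
    then obtain v j v' j' where xy: "in_edges F G b labels = [(v, j), (v', j')]" by force
    have two: "{(v, j). \<delta> j (e v) = e b} = {(v, j), (v', j')}" using edges xy by simp
    have "\<delta> j (e v) = e b" "\<delta> j' (e v') = e b" using two by blast+
    \<comment> \<open>Each letter is written on some edge into \<open>e b\<close>, and there are
      only these two edges.\<close>
    have \<omega>: "\<omega> j (e v) = (\<not> \<omega> j' (e v'))"
    proof -
      have "\<omega> j (e v) = i \<or> \<omega> j' (e v') = i" for i
      proof -
        from into[of i] obtain k w where w: "\<omega> k (e w) = i" "\<delta> k (e w) = e b" by blast
        hence "(w, k) \<in> {(v, j), (v', j')}" unfolding two[symmetric] by simp
        with w show ?thesis by auto
      qed
      from this[of True] this[of False] show ?thesis by auto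
    qed
    let ?A = "if j then (if j' then A else set_entry A v' (\<omega> j' (e v'))) else (if j' then set_entry A v (\<omega> j (e v)) else set_entry (set_entry A v (\<omega> j (e v))) v' (\<omega> j' (e v')))"
    let ?B = "if j then (if j' then set_entry (set_entry B v (\<omega> j (e v))) v' (\<omega> j' (e v')) else set_entry B v (\<omega> j (e v))) else (if j' then set_entry B v' (\<omega> j' (e v')) else B)"
    have \<pi>: "\<pi> (\<omega> j (e v)) (e b) = e v" "\<pi> (\<omega> j' (e v')) (e b) = e v'"
      using \<pi>_eq[OF eQ, of j v] \<pi>_eq[OF eQ, of j' v'] \<open>\<delta> j (e v) = e b\<close> \<open>\<delta> j' (e v') = e b\<close> by simp_all
    have step: "\<exists>s\<in>set (outputs_step F G (set_entry H b u) (set_entry K b u') ?A ?B b u u' bs).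
        s = failure \<or> describes e s"
      if u: "\<pi> False (e b) = e u" "\<pi> True (e b) = e u'" for u u'
    proof -
      let ?H = "set_entry H b u" and ?K = "set_entry K b u'"
      have inv: "outputs_inv e F G ?H ?K ?A ?B bs"
        unfolding outputs_inv_def
      proof (intro conjI allI impI)
        show "agrees e ?H (\<pi> False)" "agrees e ?K (\<pi> True)"
          using Cons.prems u by (auto simp: outputs_inv_def intro: agrees_set_entry)
        fix w a
        show "entry ?A w = Some a \<Longrightarrow> \<omega> False (e w) = a" "entry ?B w = Some a \<Longrightarrow> \<omega> True (e w) = a"
          using Cons.prems unfolding outputs_inv_def by (auto simp: entry_set_entry split: if_splits)
      next
        fix w t assume t: "t \<notin> set bs"
        show "entry ?A w \<noteq> None" if "entry F w = Some t"
        proof (cases "t = b")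
          case True
          hence "(w, False) \<in> {(v, j), (v', j')}" using that unfolding two[symmetric] by (simp add: \<delta>)
          thus ?thesis by (auto simp: entry_set_entry)
        next
          case False
          with t that Cons.prems have "entry A w \<noteq> None" unfolding outputs_inv_def by (metis set_ConsD)
          thus ?thesis by (auto simp: entry_set_entry)
        qed
        show "entry ?B w \<noteq> None" if "entry G w = Some t"
        proof (cases "t = b")
          case True
          hence "(w, True) \<in> {(v, j), (v', j')}" using that unfolding two[symmetric] by (simp add: \<delta>)
          thus ?thesis by (auto simp: entry_set_entry)
        next
          case False
          with t that Cons.prems have "entry B w \<noteq> None" unfolding outputs_inv_def by (metis set_ConsD)
          thus ?thesis by (auto simp: entry_set_entry)
        qed
      qed (use Cons.prems in \<open>auto simp: outputs_inv_def\<close>)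
      have "\<not> conflict X ?H ?K b t labels" if X: "X = ?H \<and> t = u \<or> X = ?K \<and> t = u'" for X t
      proof
        assume "conflict X ?H ?K b t labels"
        moreover have "agrees e ?H (\<pi> False)" "agrees e ?K (\<pi> True)"
          using inv by (simp_all add: outputs_inv_def)
        moreover obtain k where "agrees e X (\<pi> k)" using calculation(2,3) X by blast
        moreover have "entry X b = Some t" using X by (auto simp: entry_set_entry)
        ultimately have "\<not> resets Q \<pi>"
          using conflict_not_resets[of e ?H \<pi> ?K X k labels Q b t labels] e
          by (simp add: bij_betw_def)
        thus False using resets_\<pi> by simp
      qed
      hence "outputs_step F G ?H ?K ?A ?B b u u' bs = outputs F G ?H ?K ?A ?B bs"
        unfolding outputs_step.simps by simp
      thus ?thesis using Cons.IH[OF inv] by simp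
    qed
    show ?thesis
    proof (cases "\<omega> j (e v)")
      case True
      hence "\<pi> False (e b) = e v'" "\<pi> True (e b) = e v" using \<pi> \<omega> by simp_all
      note s = step[OF this]
      have o: "\<omega> j (e v) = True" "\<omega> j' (e v') = False" using True \<omega> by simp_all
      show ?thesis
        unfolding outputs.simps xy list.case prod.case set_append bex_Un
        by (rule disjI2) (rule s[unfolded o])
    next
      case False
      hence "\<pi> False (e b) = e v" "\<pi> True (e b) = e v'" using \<pi> \<omega> by simp_all
      note s = step[OF this]
      have o: "\<omega> j (e v) = False" "\<omega> j' (e v') = True" using False \<omega> by simp_all
      show ?thesis
        unfolding outputs.simps xy list.case prod.case set_append bex_Un
        by (rule disjI1) (rule s[unfolded o])
    qed
  qed
qed

definition tb :: "label table \<Rightarrow> label table \<Rightarrow> bool \<Rightarrow> label table" where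
  "tb F G j = (if j then G else F)"

lemma entry_tb_update:
  "entry (tb (if j then F else set_entry F v t) (if j then set_entry G v t else G) i) w =
    (if i = j \<and> w = v then Some t else entry (tb F G i) w)"
  by (simp add: tb_def entry_set_entry)

text \<open>\<open>e\<close> is constrained only on the labels in use: its value at a fresh label is
  chosen when the search meets a new state.\<close>

definition search_inv where
  "search_inv e F G ks fs os \<longleftrightarrow> inj_on e (set ks) \<and> e ` set ks \<subseteq> Q \<and> ks \<noteq> [] \<and> set ks \<union> set fs = UNIV \<and>
     set ks \<inter> set fs = {} \<and> distinct fs \<and> agrees e F (\<delta> False) \<and> agrees e G (\<delta> True) \<and> set os \<subseteq> set ks \<and> distinct os \<and>
     (\<forall>v t j. entry (tb F G j) v = Some t \<longrightarrow> v \<in> set ks \<and> t \<in> set ks) \<and>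
     (\<forall>t\<in>set ks. \<exists>v j. entry (tb F G j) v = Some t) \<and>
     (\<forall>t\<in>set ks - set os. \<exists>v j v' j'. (v, j) \<noteq> (v', j') \<and> entry (tb F G j) v = Some t \<and>
        entry (tb F G j') v' = Some t)"

text \<open>Without missing edges the states met form a closed set, hence all of \<open>Q\<close>.
  This is why complete tables with labels left over may be dropped.\<close>

lemma search_complete_sound:
  assumes inv: "search_inv e F G ks fs os" and none: "pick F G ks = None"
  shows "\<exists>s\<in>set (search n F G ks fs os). s = failure \<or> (\<exists>e. describes e s)"
proof -
  have ks: "inj_on e (set ks)" "e ` set ks \<subseteq> Q" "ks \<noteq> []" "set ks \<union> set fs = UNIV" "set ks \<inter> set fs = {}"
    and ag: "agrees e F (\<delta> False)" "agrees e G (\<delta> True)"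
    and ran: "\<And>v t j. entry (tb F G j) v = Some t \<Longrightarrow> t \<in> set ks"
    using inv unfolding search_inv_def by blast+
  have "\<delta> j p \<in> e ` set ks" if "p \<in> e ` set ks" for j p
  proof -
    from that obtain v where v: "v \<in> set ks" "p = e v" by auto
    from pick_NoneD[OF none v(1)] obtain t where t: "entry (tb F G j) v = Some t"
      by (cases j) (auto simp: tb_def)
    hence "\<delta> j p = e t" using ag v(2) unfolding agrees_def tb_def by (cases j) simp_all
    with ran[OF t] show ?thesis by simp
  qed
  with closed_states[OF ks(2)] ks(3) have eQ: "e ` set ks = Q" by simp
  hence "card (set ks) = 8" using card_image[OF ks(1)] card_states by simp
  hence all: "set ks = UNIV" by (metis card_label card_subset_eq finite_label subset_UNIV)
  with ks(5) have "fs = []" by simp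
  have "outputs_inv e F G blank blank blank blank labels"
    unfolding outputs_inv_def using ks(1) eQ ag all pick_NoneD[OF none]
    by (simp add: bij_betw_def agrees_blank)
  from outputs_sound[OF this] show ?thesis using none \<open>fs = []\<close> by (auto simp: search.simps)
qed

lemma set_tries:
  "set (tries m F G v j ks fs us (ts @ t # ts')) \<supseteq>
    set (search_step m (set_entry (tb F G j) v t) (if j then F else set_entry F v t)
      (if j then set_entry G v t else G) v t ks fs ((rev ts @ us) @ ts'))"
proof (induction ts arbitrary: us)
  case (Cons a ts)
  show ?case using Cons[of "a # us"] by auto
qed (simp add: tb_def)

lemma search_sound:
  "search_inv e F G ks fs os \<Longrightarrow>
    \<exists>s\<in>set (search n F G ks fs os). s = failure \<or> (\<exists>e. describes e s)"
proof (induction n arbitrary: e F G ks fs os)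
  case 0
  show ?case
  proof (cases "pick F G ks")
    case None
    thus ?thesis using search_complete_sound[OF 0] by blast
  next
    case (Some vj)
    thus ?thesis by (cases vj) (simp add: search.simps)
  qed
next
  case (Suc n)
  show ?case
  proof (cases "pick F G ks")
    case None
    thus ?thesis using search_complete_sound[OF Suc.prems] by blast
  next
    case (Some vj)
    obtain v j where vj: "vj = (v, j)" by fastforce
    let ?T = "tb F G j"
    have v: "v \<in> set ks" and new: "entry ?T v = None"
      using pick_SomeD[of F G ks v j] Some vj by (simp_all add: tb_def)
    have ks: "inj_on e (set ks)" "e ` set ks \<subseteq> Q" "set ks \<union> set fs = UNIV" "set ks \<inter> set fs = {}" "distinct fs"
      using Suc.prems by (simp_all add: search_inv_def)
    have ag: "agrees e F (\<delta> False)" "agrees e G (\<delta> True)"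
      using Suc.prems by (simp_all add: search_inv_def)
    have dom: "w \<in> set ks" "u \<in> set ks" if "entry (tb F G i) w = Some u" for w u i
      using Suc.prems that unfolding search_inv_def by blast+
    have one: "\<exists>w i. entry (tb F G i) w = Some u" if "u \<in> set ks" for u
      using Suc.prems that unfolding search_inv_def by blast
    have two: "\<exists>a i b k. (a, i) \<noteq> (b, k) \<and> entry (tb F G i) a = Some u \<and> entry (tb F G k) b = Some u"
      if "u \<in> set ks" "u \<notin> set os" for u
      using Suc.prems that unfolding search_inv_def by blast
    show ?thesis
    proof (cases "\<delta> j (e v) \<in> e ` set ks")
      case True
      then obtain t where t: "t \<in> set ks" "\<delta> j (e v) = e t" by auto
      \<comment> \<open>Otherwise three edges would lead to \<open>e t\<close>; their outputs would
        be pairwise distinct, but there are only two letters.\<close>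
      have "t \<in> set os"
      proof (rule ccontr)
        assume "t \<notin> set os"
        then obtain a i b k where ab: "(a, i) \<noteq> (b, k)"
          "entry (tb F G i) a = Some t" "entry (tb F G k) b = Some t"
          using two[OF t(1)] by blast
        have "a \<in> set ks" "b \<in> set ks" using ab dom by blast+
        have \<delta>: "\<delta> i (e a) = e t" "\<delta> k (e b) = e t"
          using ab(2,3) ag unfolding agrees_def tb_def by (cases i; cases k; simp)+
        have ne: "(a, i) \<noteq> (v, j)" "(b, k) \<noteq> (v, j)" using ab(2,3) new by (metis option.distinct(1) prod.inject)+
        have distinct_out: "\<omega> x (e y) \<noteq> \<omega> x' (e y')"
          if "(y, x) \<noteq> (y', x')" "y \<in> set ks" "y' \<in> set ks" "\<delta> x (e y) = \<delta> x' (e y')" for x x' y y'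
        proof
          assume "\<omega> x (e y) = \<omega> x' (e y')"
          moreover have "e y \<in> Q" "e y' \<in> Q" using that ks(2) by auto
          ultimately have "x = x'" "e y = e y'" using edge_unique that(4) by blast+
          with that(1-3) inj_onD[OF ks(1)] show False by blast
        qed
        have "\<omega> i (e a) \<noteq> \<omega> k (e b)" "\<omega> i (e a) \<noteq> \<omega> j (e v)" "\<omega> k (e b) \<noteq> \<omega> j (e v)"
          using distinct_out[OF ab(1)] distinct_out[OF ne(1)] distinct_out[OF ne(2)] \<delta> t(2)
            \<open>a \<in> set ks\<close> \<open>b \<in> set ks\<close> v by simp_all
        thus False by auto
      qed
      let ?F = "if j then F else set_entry F v t" and ?G = "if j then set_entry G v t else G"
      have entries: "entry (tb ?F ?G i) w =
          (if i = j \<and> w = v then Some t else entry (tb F G i) w)" for i w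
        by (rule entry_tb_update)
      have keep: "entry (tb ?F ?G i) w = Some u" if "entry (tb F G i) w = Some u" for i w u
        using that new unfolding entries by auto
      have inv: "search_inv e ?F ?G ks fs os'" if os': "set os' = set os - {t}" "distinct os'" for os'
        unfolding search_inv_def
      proof (intro conjI)
        show "agrees e ?F (\<delta> False)" "agrees e ?G (\<delta> True)"
          using ag t by (auto intro: agrees_set_entry)
        show "\<forall>w u i. entry (tb ?F ?G i) w = Some u \<longrightarrow> w \<in> set ks \<and> u \<in> set ks"
          unfolding entries using dom v t(1) by auto
        show "\<forall>u\<in>set ks. \<exists>w i. entry (tb ?F ?G i) w = Some u"
        proof
          fix u assume "u \<in> set ks"
          from one[OF this] obtain w i where "entry (tb F G i) w = Some u" by blast
          from keep[OF this] show "\<exists>w i. entry (tb ?F ?G i) w = Some u" by blast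
        qed
        show "\<forall>u\<in>set ks - set os'. \<exists>a i b k. (a, i) \<noteq> (b, k) \<and>
            entry (tb ?F ?G i) a = Some u \<and> entry (tb ?F ?G k) b = Some u"
        proof
          fix u assume u: "u \<in> set ks - set os'"
          show "\<exists>a i b k. (a, i) \<noteq> (b, k) \<and>
            entry (tb ?F ?G i) a = Some u \<and> entry (tb ?F ?G k) b = Some u"
          proof (cases "u = t")
            case True
            obtain a i where a: "entry (tb F G i) a = Some t"
              using one[OF t(1)] by blast
            have "(a, i) \<noteq> (v, j)" using a new by (metis option.distinct(1) prod.inject)
            moreover have "entry (tb ?F ?G j) v = Some t" by (simp add: entries)
            ultimately show ?thesis using keep[OF a] True by blast
          next
            case False
            with u os' have "u \<in> set ks" "u \<notin> set os" by auto
            from two[OF this] obtain a i b k where ab: "(a, i) \<noteq> (b, k)"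
              "entry (tb F G i) a = Some u" "entry (tb F G k) b = Some u" by blast
            show ?thesis using ab(1) keep[OF ab(2)] keep[OF ab(3)] by blast
          qed
        qed
      qed (use Suc.prems that in \<open>auto simp: search_inv_def\<close>)
      let ?H = "set_entry ?T v t"
      have agF: "agrees e ?F (\<delta> False)" and agG: "agrees e ?G (\<delta> True)" and agH: "agrees e ?H (\<delta> j)"
        using ag t(2) by (cases j; simp add: tb_def agrees_set_entry)+
      have "\<not> conflict ?H ?F ?G v t ks"
      proof
        assume c: "conflict ?H ?F ?G v t ks"
        from conflict_not_resets[OF agF agG agH ks(1,2) _ v c] show False
          using resets_\<delta> by (simp add: entry_set_entry)
      qed
      hence step: "search_step n ?H ?F ?G v t ks fs os' = search n ?F ?G ks fs os'" for os'
        unfolding search_step.simps by (rule if_not_P)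
      obtain ts ts' where os: "os = ts @ t # ts'" using split_list[OF \<open>t \<in> set os\<close>] by blast
      have "distinct os" using Suc.prems by (simp add: search_inv_def)
      hence "set (rev ts @ ts') = set os - {t}" "distinct (rev ts @ ts')" unfolding os by auto
      from Suc.IH[OF inv[OF this]] obtain s where
        s: "s \<in> set (search n ?F ?G ks fs (rev ts @ ts'))" "s = failure \<or> (\<exists>e. describes e s)" by blast
      have "s \<in> set (tries n F G v j ks fs [] os)"
        using set_tries[where us = "[]"] s(1)[folded step] unfolding os append_Nil2 by blast
      with s(2) show ?thesis using Some vj by (auto simp: search.simps)
    next
      case False
      obtain x xs where fs: "fs = x # xs"
      proof (cases fs)
        case Nil
        hence "set ks = UNIV" using ks(3) by simp
        hence "e ` set ks = Q"
          using card_subset_eq[OF finite_states ks(2)] card_image[OF ks(1)] card_states card_label by simp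
        with False \<delta>_closed ks(2) v show ?thesis by blast
      qed
      define e' where "e' = e(x := \<delta> j (e v))"
      have x: "x \<notin> set ks" using ks(4) fs by auto
      have e': "e' u = e u" if "u \<in> set ks" for u using that x by (auto simp: e'_def)
      have e'x: "e' x = \<delta> j (e v)" by (simp add: e'_def)
      have dom': "w \<in> set ks" "u \<in> set ks" if "entry F w = Some u \<or> entry G w = Some u" for w u
        using dom[of False w u] dom[of True w u] that by (auto simp: tb_def)
      have ag': "agrees e' F (\<delta> False)" "agrees e' G (\<delta> True)"
        using ag dom' e' unfolding agrees_def by metis+
      let ?F = "if j then F else set_entry F v x" and ?G = "if j then set_entry G v x else G"
      have entries: "entry (tb ?F ?G i) w =
          (if i = j \<and> w = v then Some x else entry (tb F G i) w)" for i w
        by (rule entry_tb_update)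
      have keep: "entry (tb ?F ?G i) w = Some u" if "entry (tb F G i) w = Some u" for i w u
        using that new unfolding entries by auto
      have "search_inv e' ?F ?G (x # ks) xs (x # os)"
        unfolding search_inv_def
      proof (intro conjI)
        have img: "e' ` set ks = e ` set ks" using e' by simp
        show "inj_on e' (set (x # ks))"
        proof -
          have "inj_on e' (set ks)" using ks(1) inj_on_cong[of "set ks" e' e] e' by simp
          with False img e'x show ?thesis by (auto simp: inj_on_insert)
        qed
        show "e' ` set (x # ks) \<subseteq> Q" using img ks(2) e'x \<delta>_closed v by auto
        show "agrees e' ?F (\<delta> False)" "agrees e' ?G (\<delta> True)"
          using ag' e'x e'[OF v] by (cases j; simp add: agrees_set_entry)+
        show "\<forall>w u i. entry (tb ?F ?G i) w = Some u \<longrightarrow> w \<in> set (x # ks) \<and> u \<in> set (x # ks)"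
          unfolding entries using dom v by auto
        show "\<forall>u\<in>set (x # ks). \<exists>w i. entry (tb ?F ?G i) w = Some u"
        proof
          fix u assume "u \<in> set (x # ks)"
          then consider "u = x" | "u \<in> set ks" by auto
          thus "\<exists>w i. entry (tb ?F ?G i) w = Some u"
          proof cases
            case 1
            have "entry (tb ?F ?G j) v = Some x" by (simp add: entries)
            with 1 show ?thesis by blast
          next
            case 2
            from one[OF this] obtain w i where "entry (tb F G i) w = Some u" by blast
            from keep[OF this] show ?thesis by blast
          qed
        qed
        show "\<forall>u\<in>set (x # ks) - set (x # os). \<exists>a i b k. (a, i) \<noteq> (b, k) \<and>
            entry (tb ?F ?G i) a = Some u \<and> entry (tb ?F ?G k) b = Some u"
        proof
          fix u assume "u \<in> set (x # ks) - set (x # os)"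
          hence "u \<in> set ks" "u \<notin> set os" by auto
          from two[OF this] obtain a i b k where ab: "(a, i) \<noteq> (b, k)"
              "entry (tb F G i) a = Some u" "entry (tb F G k) b = Some u" by blast
          show "\<exists>a i b k. (a, i) \<noteq> (b, k) \<and>
              entry (tb ?F ?G i) a = Some u \<and> entry (tb ?F ?G k) b = Some u"
            using ab(1) keep[OF ab(2)] keep[OF ab(3)] by blast
        qed
      qed (use Suc.prems fs x in \<open>auto simp: search_inv_def\<close>)
      from Suc.IH[OF this] obtain s where
        s: "s \<in> set (search n ?F ?G (x # ks) xs (x # os))" "s = failure \<or> (\<exists>e. describes e s)" by blast
      hence "s \<in> set (search (Suc n) F G ks fs os)" using Some vj fs by (cases j) (simp_all add: search.simps)
      with s(2) show ?thesis by blast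
    qed
  qed
qed

text \<open>\<open>L0\<close> names a state fixed by \<open>False\<close>, which accounts for the
  entry given at the start.\<close>

lemma ex_solution:
  "\<exists>s\<in>set (search n (set_entry blank L0 L0) blank [L0] [L1, L2, L3, L4, L5, L6, L7] [L0]).
    s = failure \<or> (\<exists>e. describes e s)"
proof -
  have "Q \<noteq> {}" using card_states by auto
  then obtain p where p: "p \<in> Q" "\<delta> False p = p" using fixed_state[of Q] \<delta>_closed by blast
  have lab: "{L0, L1, L2, L3, L4, L5, L6, L7} = UNIV"
    using set_labels by (simp add: labels_def)
  have "search_inv (\<lambda>_. p) (set_entry blank L0 L0) blank [L0] [L1, L2, L3, L4, L5, L6, L7] [L0]"
    unfolding search_inv_def
  proof (intro conjI)
    show "set [L0] \<union> set [L1, L2, L3, L4, L5, L6, L7] = UNIV" using lab by auto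
    have "entry (tb (set_entry blank L0 L0) blank False) L0 = Some L0"
      by (simp add: tb_def entry_set_entry)
    thus "\<forall>t\<in>set [L0]. \<exists>v j. entry (tb (set_entry blank L0 L0) blank j) v = Some t" by auto
  qed (use p in \<open>auto simp: agrees_def entry_set_entry tb_def split: if_splits\<close>)
  from search_sound[OF this] show ?thesis .
qed
end

section \<open>Conjugation, composition and outer classes\<close>

lemma perm_ConsE:
  assumes "bij_betw s (bwords (Suc n)) (bwords (Suc n))" "length q = n"
  obtains w where "length w = Suc n" "s w = b # q"
proof -
  have "b # q \<in> s ` bwords (Suc n)"
    unfolding bij_betw_imp_surj_on[OF assms(1)] using assms(2) by (simp add: bwords_def)
  with that show ?thesis by (auto simp: bwords_def)
qed

context cuntz_algebra
begin

text \<open>Let the edge from \<open>p\<close> reading \<open>j\<close> write \<open>b\<close> and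
  end in \<open>q\<close>. Then both sides of the intertwining relation send \<open>V q\<close> to
  \<open>V (z p @ [j])\<close>.\<close>

lemma \<Lambda>_conj:
  assumes s: "bij_betw s (bwords (Suc n)) (bwords (Suc n))"
    and s': "bij_betw s' (bwords (Suc n)) (bwords (Suc n))"
    and z: "bij_betw z (bwords n) (bwords n)"
    and iso: "\<And>p j. length p = n \<Longrightarrow> s' (z p @ [j]) = hd (s (p @ [j])) # z (tl (s (p @ [j])))"
  shows "\<Lambda> (Suc n) s' = (\<lambda>x. U n z * x * star (U n z)) \<circ> \<Lambda> (Suc n) s"
proof (rule endo_eqI)
  fix b
  have "\<Lambda> (Suc n) s' (S (letter b)) * U n z = U n z * \<Lambda> (Suc n) s (S (letter b))"
  proof (rule eq_if_eq_on_words[of n])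
    fix q :: "bool list" assume q: "length q = n"
    then obtain w where w: "length w = Suc n" "s w = b # q" by (rule perm_ConsE[OF s])
    then obtain p j where pj: "w = p @ [j]" "length p = n"
      by (metis length_Suc_conv_rev)
    have zp: "length (z p) = n" using bij_betwE[OF z] pj by (auto simp: bwords_def)
    have "\<Lambda> (Suc n) s' (S (letter b)) * V (z q) = V (z p @ [j])"
      using iso[OF pj(2), of j] w zp pj by (intro \<Lambda>_step[OF s']) simp_all
    moreover have "U n z * (\<Lambda> (Suc n) s (S (letter b)) * V q) = V (z p @ [j])"
      by (simp add: \<Lambda>_step[OF s w] pj U_V_append)
    ultimately show "\<Lambda> (Suc n) s' (S (letter b)) * U n z * V q = U n z * \<Lambda> (Suc n) s (S (letter b)) * V q"
      by (simp add: mult.assoc U_V q)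
  qed
  moreover have "U n z * star (U n z) = 1" using unitary_U[OF z] by (simp add: unitary_def)
  ultimately show "\<Lambda> (Suc n) s' (S (letter b)) =
      ((\<lambda>x. U n z * x * star (U n z)) \<circ> \<Lambda> (Suc n) s) (S (letter b))"
  proof -
    assume eq: "\<Lambda> (Suc n) s' (S (letter b)) * U n z = U n z * \<Lambda> (Suc n) s (S (letter b))"
      and UU: "U n z * star (U n z) = 1"
    have "\<Lambda> (Suc n) s' (S (letter b)) = \<Lambda> (Suc n) s' (S (letter b)) * U n z * star (U n z)"
      by (simp add: UU mult.assoc)
    thus ?thesis by (simp add: eq)
  qed
qed (intro endo_comp endo_conj unitary_U \<Lambda>_endo s s' z)+

lemma unitary_mult: "unitary u \<Longrightarrow> unitary v \<Longrightarrow> unitary (u * v :: 'a)"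
proof -
  assume "unitary u" "unitary v"
  hence *: "star u * u = 1" "u * star u = 1" "star v * v = 1" "v * star v = 1"
    by (simp_all add: unitary_def)
  have "star (u * v) * (u * v) = star v * (star u * u) * v" "u * v * star (u * v) = u * (v * star v) * star u"
    by (simp_all add: star_mult mult.assoc)
  thus ?thesis by (simp add: unitary_def *)
qed

lemma unitary_star: "unitary u \<Longrightarrow> unitary (star u :: 'a)"
  by (simp add: unitary_def star_star)

lemma unitary_one: "unitary (1 :: 'a)"
  by (simp add: unitary_def)

lemma endo_unitary: "unital_star_endomorphism \<phi> \<Longrightarrow> unitary u \<Longrightarrow> unitary (\<phi> u :: 'a)"
  by (simp add: unitary_def flip: endo_simps(3,4)) (simp add: endo_simps(1))

lemma out_class_eq: "out_class \<phi> = {(\<lambda>x. u * \<phi> x * star u) | u. unitary (u :: 'a)}"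
  by (auto simp: out_class_def r_coset_def Inn_def Aut_def comp_def)

lemma out_class_conj:
  assumes "unitary u"
  shows "out_class ((\<lambda>x. u * x * star u) \<circ> \<phi>) = out_class (\<phi> :: 'a \<Rightarrow> 'a)"
proof -
  have uu: "star u * u = 1" "u * star u = 1" using assms by (simp_all add: unitary_def)
  have "(\<lambda>x. v * (u * \<phi> x * star u) * star v) = (\<lambda>x. (v * u) * \<phi> x * star (v * u))" for v
    by (simp add: star_mult mult.assoc)
  moreover have "(\<lambda>x. v * \<phi> x * star v) = (\<lambda>x. (v * star u) * (u * \<phi> x * star u) * star (v * star u))" for v
    by (simp add: star_mult star_star mult.assoc) (simp add: uu flip: mult.assoc)
  ultimately show ?thesis
    unfolding out_class_eq comp_def using assms unitary_mult unitary_star by auto metis+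
qed

lemma out_class_eqD:
  assumes "out_class \<phi> = out_class (\<psi> :: 'a \<Rightarrow> 'a)"
  obtains u where "unitary u" "\<phi> = (\<lambda>x. u * \<psi> x * star u)"
proof -
  have "\<phi> \<in> out_class \<phi>"
    unfolding out_class_eq using unitary_one by (auto intro!: exI[of _ 1])
  with assms that show ?thesis by (auto simp: out_class_eq)
qed

end

section \<open>Composites computed on words\<close>

fun act :: "(bool list \<Rightarrow> bool list) \<Rightarrow> nat \<Rightarrow> bool list \<Rightarrow> bool list \<Rightarrow> bool list" where
  "act t k [] x = x"
| "act t k (i # w) x = (let y = i # act t k w x in t (take k y) @ drop k y)"

text \<open>For \<open>r w = b # q\<close> this is the relation "\<open>U l z\<close> times the
  composite at \<open>S (letter b)\<close> equals \<open>S (letter b)\<close> times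
  \<open>U l z\<close>", multiplied from the right by the image of \<open>V q\<close> and by
  \<open>V x\<close>, and read off on words.\<close>

definition composes :: "(bool list \<Rightarrow> bool list) \<Rightarrow> nat \<Rightarrow> (bool list \<Rightarrow> bool list) \<Rightarrow>
    (bool list \<Rightarrow> bool list) \<Rightarrow> nat \<Rightarrow> bool list \<Rightarrow> bool list \<Rightarrow> bool" where
  "composes t k r z l w x \<longleftrightarrow> (let y = act t k w x; y' = act t k (tl (r w)) x
     in z (take l y) @ drop l y = hd (r w) # z (take l y') @ drop l y')"

lemma length_act:
  assumes "\<And>w. length w = k \<Longrightarrow> length (t w) = k" "k \<le> Suc (length x)"
  shows "length (act t k w x) = length w + length x"
  using assms by (induction w) (simp_all add: Let_def)

context cuntz_algebra
begin

text \<open>Letters of \<open>w\<close> act from the right: multiplying by the image of one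
  generator prepends its letter and applies \<open>t\<close>, the inverse of \<open>s\<close>, to
  the first \<open>Suc n\<close> letters.\<close>

lemma \<Lambda>_act:
  assumes s: "bij_betw s (bwords (Suc n)) (bwords (Suc n))"
    and t: "\<And>w. length w = Suc n \<Longrightarrow> length (t w) = Suc n \<and> s (t w) = w"
    and x: "n \<le> length x"
  shows "\<Lambda> (Suc n) s (V w) * V x = V (act t (Suc n) w x)"
proof (induction w)
  case Nil
  thus ?case by (simp add: endo_simps[OF \<Lambda>_endo[OF s]])
next
  case (Cons i w)
  define y where "y = act t (Suc n) w x"
  have y: "length y = length w + length x" unfolding y_def by (rule length_act) (use t x in auto)
  have ty: "t (take (Suc n) (i # y)) = t (i # take n y)" "length (i # take n y) = Suc n"
    using x y by simp_all
  have "\<Lambda> (Suc n) s (S (letter i)) * V (take n y) = V (t (i # take n y))"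
    using t[OF ty(2)] by (intro \<Lambda>_step[OF s]) simp_all
  hence "\<Lambda> (Suc n) s (S (letter i)) * V (take n y @ drop n y) = V (t (i # take n y) @ drop n y)"
    by (simp only: V_append flip: mult.assoc)
  hence "\<Lambda> (Suc n) s (S (letter i)) * V y = V (act t (Suc n) (i # w) x)"
    by (simp add: y_def)
  thus ?case using Cons by (simp add: V_Cons endo_simps[OF \<Lambda>_endo[OF s]] mult.assoc y_def)
qed

lemma \<Lambda>_comp_\<Lambda>:
  assumes s: "bij_betw s (bwords (Suc n)) (bwords (Suc n))"
    and t: "\<And>w. length w = Suc n \<Longrightarrow> length (t w) = Suc n \<and> s (t w) = w"
    and r: "bij_betw r (bwords (Suc m)) (bwords (Suc m))"
    and z: "bij_betw z (bwords l) (bwords l)"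
    and N: "n \<le> N" "l \<le> m + N"
    and c: "\<And>w x. length w = Suc m \<Longrightarrow> length x = N \<Longrightarrow> composes t (Suc n) r z l w x"
  shows "\<Lambda> (Suc n) s \<circ> \<Lambda> (Suc m) r = (\<lambda>x. star (U l z) * x * star (star (U l z)))"
proof (rule endo_eqI)
  fix b
  let ?\<phi> = "\<Lambda> (Suc n) s" and ?\<psi> = "\<Lambda> (Suc m) r"
  have \<phi>: "unital_star_endomorphism ?\<phi>" by (rule \<Lambda>_endo[OF s])
  have "U l z * ?\<phi> (?\<psi> (S (letter b))) * ?\<phi> (V q) = S (letter b) * U l z * ?\<phi> (V q)"
    if q: "length q = m" for q
  proof (rule eq_if_eq_on_words[of N])
    fix x :: "bool list" assume x: "length x = N"
    obtain w where w: "length w = Suc m" "r w = b # q" using perm_ConsE[OF r q] .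
    define y y' where "y = act t (Suc n) w x" and "y' = act t (Suc n) q x"
    have y: "length y = Suc m + N" "length y' = m + N"
      unfolding y_def y'_def using t x w(1) q N(1) by (simp_all add: length_act)
    have "?\<phi> (?\<psi> (S (letter b))) * ?\<phi> (V q) = ?\<phi> (V w)"
      using \<Lambda>_step[OF r w] by (metis endo_simps(3)[OF \<phi>])
    hence "U l z * ?\<phi> (?\<psi> (S (letter b))) * ?\<phi> (V q) * V x = U l z * V y"
      using \<Lambda>_act[OF s t, of x w] x N(1) by (simp add: y_def mult.assoc)
    also have "\<dots> = V (z (take l y) @ drop l y)"
      using U_V_append[of "take l y" l z "drop l y"] y N(2) by simp
    also have "\<dots> = V (b # z (take l y') @ drop l y')"
      using c[OF w(1) x] w(2) by (simp add: composes_def Let_def y_def y'_def)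
    also have "\<dots> = S (letter b) * (U l z * V y')"
      using U_V_append[of "take l y'" l z "drop l y'"] y N(2) by (simp add: V_Cons)
    also have "V y' = ?\<phi> (V q) * V x"
      using \<Lambda>_act[OF s t, of x q] x N(1) by (simp add: y'_def)
    finally show "U l z * ?\<phi> (?\<psi> (S (letter b))) * ?\<phi> (V q) * V x = S (letter b) * U l z * ?\<phi> (V q) * V x"
      by (simp add: mult.assoc)
  qed
  \<comment> \<open>The images of the range projections of words of length \<open>m\<close> still
    sum to 1, which removes the auxiliary factor.\<close>
  hence "(\<Sum>q\<in>bwords m. U l z * ?\<phi> (?\<psi> (S (letter b))) * ?\<phi> (V q) * star (?\<phi> (V q))) =
      (\<Sum>q\<in>bwords m. S (letter b) * U l z * ?\<phi> (V q) * star (?\<phi> (V q)))"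
    by (intro sum.cong) (simp_all add: bwords_def)
  moreover have "(\<Sum>q\<in>bwords m. ?\<phi> (V q) * star (?\<phi> (V q))) = 1"
    using arg_cong[OF sum_V[of m], of ?\<phi>] by (simp add: endo_sum[OF \<phi>] endo_simps[OF \<phi>])
  ultimately have "U l z * ?\<phi> (?\<psi> (S (letter b))) = S (letter b) * U l z"
    by (simp add: mult.assoc flip: sum_distrib_left)
  moreover have "star (U l z) * U l z = 1" using unitary_U[OF z] by (simp add: unitary_def)
  ultimately show "(?\<phi> \<circ> ?\<psi>) (S (letter b)) = star (U l z) * S (letter b) * star (star (U l z))"
  proof -
    assume UU: "star (U l z) * U l z = 1"
      and eq: "U l z * ?\<phi> (?\<psi> (S (letter b))) = S (letter b) * U l z"
    have "?\<phi> (?\<psi> (S (letter b))) = star (U l z) * U l z * ?\<phi> (?\<psi> (S (letter b)))" by (simp add: UU)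
    also have "\<dots> = star (U l z) * (S (letter b) * U l z)" by (simp add: mult.assoc eq)
    finally show ?thesis by (simp add: star_star mult.assoc)
  qed
qed (intro endo_comp endo_conj unitary_star unitary_U \<Lambda>_endo s r z)+

end

section \<open>Action on periodic orbits\<close>

lemma take_drop_repeat:
  "k + length p \<le> m * length p \<Longrightarrow> take (length p) (drop k (concat (replicate m p))) = rotate k p"
proof (induction m arbitrary: k)
  case (Suc m)
  show ?case
  proof (cases "length p \<le> k")
    case True
    then obtain i where i: "k = i + length p" by (metis le_iff_add add.commute)
    have "rotate k p = rotate i p" unfolding i by (metis mod_add_self2 rotate_conv_mod)
    with Suc i show ?thesis by simp
  next
    case False
    show ?thesis
    proof (cases m)
      case 0
      with Suc.prems show ?thesis by simp
    next
      case m': (Suc m')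
      have "rotate k p = drop k p @ take k p"
        using False rotate_drop_take[of k p] by simp
      thus ?thesis using False by (simp add: m')
    qed
  qed
qed simp

context cuntz_algebra
begin

text \<open>The relation \<open>sends \<phi> p q\<close> is the shadow of an automorphism of the two-sided shift that maps the
  periodic orbit of \<open>p\<close> to that of \<open>q\<close>.\<close>

definition sends :: "('a \<Rightarrow> 'a) \<Rightarrow> bool list \<Rightarrow> bool list \<Rightarrow> bool" where
  "sends \<phi> p q \<longleftrightarrow> (\<exists>y. star y * y = 1 \<and> \<phi> (V p) * y = y * V q)"

lemma V_repeat_intertwines:
  "V p * y = y * V r \<Longrightarrow> V (concat (replicate m p)) * y = y * V (concat (replicate m r))"
proof (induction m)
  case (Suc m)
  thus ?case using Suc by (simp add: V_append mult.assoc) (simp add: flip: mult.assoc)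
qed simp

text \<open>A monomial compressed by high powers of \<open>V p\<close> and \<open>V r\<close> vanishes unless the infinite words
  \<open>ppp\<dots>\<close> and \<open>rrr\<dots>\<close> have a common tail; hence so does every intertwiner.\<close>

lemma intertwiner_rotate:
  assumes y: "star y * y = 1" "V p * y = y * V r" and len: "length r = length p" "p \<noteq> []"
  shows "\<exists>k. r = rotate k p"
proof (rule ccontr)
  assume no: "\<nexists>k. r = rotate k p"
  have ne: "rotate i p \<noteq> rotate j r" for i j
  proof
    assume eq: "rotate i p = rotate j r"
    \<comment> \<open>Rotating on by \<open>j * (length r - 1)\<close> completes a multiple of the
      length and so undoes the rotation by \<open>j\<close>.\<close>
    have "j * (length r - 1) + j = length r * j" using len by (cases r) (simp_all add: algebra_simps)
    hence "rotate (j * (length r - 1)) (rotate j r) = rotate (length r * j) r"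
      by (simp add: rotate_rotate)
    also have "\<dots> = r" using rotate_conv_mod[of "length r * j" r] by simp
    finally have "r = rotate (j * (length r - 1) + i) p" by (simp add: rotate_rotate flip: eq)
    thus False using no by blast
  qed
  let ?P = "\<lambda>m. concat (replicate m p)" and ?R = "\<lambda>m. concat (replicate m r)"
  have "\<exists>n. \<forall>m>n. star (V (?P m)) * a * V (?R m) = 0" if "a \<in> all_polys" for a
    using that
  proof (induction rule: polys.induct)
    case (monomial u v)
    have "star (V (?P m)) * (V u * star (V v)) * V (?R m) = 0" if m: "length u + length v < m" for m
    proof -
      have "Suc (length u + length v) * length p \<le> m * length p"
        using m by (intro mult_le_mono1) simp
      moreover have "length u \<le> length u * length p" "length v \<le> length v * length p"
        using len(2) by (cases p; simp)+
      ultimately have lens: "length u + length p \<le> m * length p" "length v + length p \<le> m * length p"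
        unfolding mult_Suc add_mult_distrib by linarith+
      let ?s = "drop (length u) (?P m)" and ?s' = "drop (length v) (?R m)"
      have t: "take (length p) ?s = rotate (length u) p" "take (length p) ?s' = rotate (length v) r"
        using take_drop_repeat[OF lens(1)] take_drop_repeat[of "length v" r m] lens(2) len(1) by simp_all
      have ls: "length p \<le> length ?s" "length p \<le> length ?s'"
        using lens by (simp_all add: length_repeat len(1))
      have s: "star (V ?s) * V ?s' = 0"
      proof -
        have "V ?s = V (rotate (length u) p) * V (drop (length p) ?s)"
          "V ?s' = V (rotate (length v) r) * V (drop (length p) ?s')"
          unfolding t[symmetric] V_append[symmetric] append_take_drop_id by (rule refl)+
        hence "star (V ?s) * V ?s' = star (V (drop (length p) ?s)) *
            (star (V (rotate (length u) p)) * V (rotate (length v) r)) * V (drop (length p) ?s')"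
          by (simp add: star_mult mult.assoc)
        also have "star (V (rotate (length u) p)) * V (rotate (length v) r) = 0"
          using ne len by (simp add: star_V_V)
        finally show ?thesis by simp
      qed
      have "star (V (?P m)) * V u = (if take (length u) (?P m) = u then star (V ?s) else 0)"
        using arg_cong[OF star_V_V_append[of u "?P m"], of star] lens
        by (simp add: star_mult star_star length_repeat)
      moreover have "star (V v) * V (?R m) = (if take (length v) (?R m) = v then V ?s' else 0)"
        using lens by (intro star_V_V_append) (simp add: length_repeat len(1))
      ultimately have "star (V (?P m)) * V u * (star (V v) * V (?R m)) = 0" using s by simp
      thus ?thesis by (simp add: mult.assoc)
    qed
    thus ?case by blast
  next
    case (add a b)
    then obtain i j where "\<forall>m>i. star (V (?P m)) * a * V (?R m) = 0"
      "\<forall>m>j. star (V (?P m)) * b * V (?R m) = 0" by blast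
    hence "\<forall>m>max i j. star (V (?P m)) * (a + b) * V (?R m) = 0"
      by (simp add: distrib_left distrib_right)
    thus ?case by blast
  next
    case (scale a c)
    then obtain i where "\<forall>m>i. star (V (?P m)) * a * V (?R m) = 0" by blast
    hence "\<forall>m>i. star (V (?P m)) * scaleC c a * V (?R m) = 0"
      by (simp add: mult_scaleC_left mult_scaleC_right)
    thus ?case by blast
  qed
  moreover obtain a where a: "a \<in> all_polys" "norm (a - y) < 1" using poly_approx[of 1] by auto
  ultimately obtain m where m: "star (V (?P m)) * a * V (?R m) = 0" by blast
  \<comment> \<open>Unlike a polynomial, \<open>y\<close> is reproduced by every such compression,
    since powers of \<open>V r\<close> pass through it as powers of \<open>V p\<close>.\<close>
  have "star (V (?P m)) * y * V (?R m) = star (V (?P m)) * (V (?P m) * y)"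
    by (simp add: V_repeat_intertwines[OF y(2)] mult.assoc)
  also have "\<dots> = y" by (simp add: star_V_V flip: mult.assoc)
  finally have "star (V (?P m)) * (a - y) * V (?R m) = - y"
    using m by (simp add: right_diff_distrib left_diff_distrib)
  hence "norm y < 1" using norm_compress_le[of "?P m" "a - y" "?R m"] a(2) by simp
  with norm_isometry[OF y(1)] show False by simp
qed

lemma sends_comp:
  assumes \<phi>: "unital_star_endomorphism \<phi>" and "sends \<psi> p q" "sends \<phi> q r"
  shows "sends (\<phi> \<circ> \<psi>) p r"
proof -
  from assms obtain y z where y: "star y * y = 1" "\<psi> (V p) * y = y * V q"
    and z: "star z * z = 1" "\<phi> (V q) * z = z * V r" unfolding sends_def by blast
  have yy: "star (\<phi> y) * \<phi> y = 1" using y(1) by (metis endo_simps(1,3,4)[OF \<phi>])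
  have "star (\<phi> y * z) * (\<phi> y * z) = star z * (star (\<phi> y) * \<phi> y) * z"
    by (simp add: star_mult mult.assoc)
  hence "star (\<phi> y * z) * (\<phi> y * z) = 1" using yy z(1) by simp
  moreover have "\<phi> (\<psi> (V p)) * (\<phi> y * z) = \<phi> y * (\<phi> (V q) * z)"
    using arg_cong[OF y(2), of \<phi>] by (simp add: endo_simps[OF \<phi>] flip: mult.assoc)
  ultimately show ?thesis unfolding sends_def by (metis comp_apply mult.assoc z(2))
qed

lemma sends_conj:
  assumes "sends \<phi> p q" "unitary u"
  shows "sends (\<lambda>x. u * \<phi> x * star u) p q"
proof -
  from assms(1) obtain y where y: "star y * y = 1" "\<phi> (V p) * y = y * V q" unfolding sends_def by blast
  have u: "star u * (u * x) = x" for x using assms(2) by (simp add: unitary_def flip: mult.assoc)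
  have "star (u * y) * (u * y) = 1" by (simp add: star_mult mult.assoc u y(1))
  moreover have "u * \<phi> (V p) * star u * (u * y) = u * y * V q" by (simp add: mult.assoc u y(2))
  ultimately show ?thesis unfolding sends_def by blast
qed

text \<open>\<open>V d\<close> intertwines \<open>V (d @ e)\<close> with
  \<open>V (e @ d)\<close>.\<close>

lemma sends_rotate:
  assumes "sends \<phi> p q"
  shows "sends \<phi> p (rotate k q)"
proof -
  from assms obtain y where y: "star y * y = 1" "\<phi> (V p) * y = y * V q" unfolding sends_def by blast
  define d e where "d = take (k mod length q) q" and "e = drop (k mod length q) q"
  have de: "q = d @ e" "rotate k q = e @ d" by (simp_all add: d_def e_def rotate_drop_take)
  have "star (y * V d) * (y * V d) = star (V d) * (star y * y) * V d" by (simp add: star_mult mult.assoc)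
  hence "star (y * V d) * (y * V d) = 1" using y(1) by (simp add: star_V_V)
  moreover have "\<phi> (V p) * (y * V d) = y * V d * V (e @ d)"
    using y(2) unfolding de(1) by (simp add: V_append flip: mult.assoc)
  ultimately show ?thesis unfolding sends_def de(2) by blast
qed

lemma sends_inner:
  assumes "sends (\<lambda>x. u * x * star u) p q" "unitary u" "length q = length p" "p \<noteq> []"
  shows "\<exists>k. q = rotate k p"
proof -
  from sends_conj[OF assms(1) unitary_star[OF assms(2)]]
  have "sends (\<lambda>x. x) p q"
    using assms(2) by (simp add: unitary_def star_star mult.assoc) (simp add: flip: mult.assoc)
  with assms(3,4) show ?thesis unfolding sends_def by (metis intertwiner_rotate)
qed

lemma sends_\<Lambda>:
  assumes "bij_betw s (bwords (Suc n)) (bwords (Suc n))" "length c = n" "dest s c J = c"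
  shows "sends (\<Lambda> (Suc n) s) (outs s c J) J"
  using \<Lambda>_path[OF assms(1,2), of J] assms(3) unfolding sends_def
  by (intro exI[of _ "V c"]) (simp add: star_V_V V_append)

text \<open>The last clause of \<open>tracked\<close>, a left inverse up to an inner automorphism, is what makes \<open>f\<close> an
  invariant of the outer class.\<close>

definition tracks :: "bool list set \<Rightarrow> ('a \<Rightarrow> 'a) \<Rightarrow> (bool list \<Rightarrow> bool list) \<Rightarrow> bool" where
  "tracks X \<phi> f \<longleftrightarrow> unital_star_endomorphism \<phi> \<and> (\<forall>p\<in>X. f p \<in> X \<and> sends \<phi> p (f p))"

definition tracked :: "bool list set \<Rightarrow> ('a \<Rightarrow> 'a) \<Rightarrow> (bool list \<Rightarrow> bool list) \<Rightarrow> bool" where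
  "tracked X \<phi> f \<longleftrightarrow> bij \<phi> \<and> tracks X \<phi> f \<and> (\<exists>\<psi> g u. tracks X \<psi> g \<and> (\<forall>q\<in>X. f (g q) = q) \<and>
     unitary u \<and> \<psi> \<circ> \<phi> = (\<lambda>x. u * x * star u))"

lemma tracks_comp: "tracks X \<phi> f \<Longrightarrow> tracks X \<psi> g \<Longrightarrow> tracks X (\<phi> \<circ> \<psi>) (f \<circ> g)"
  unfolding tracks_def by (auto intro: endo_comp sends_comp)

lemma tracked_comp:
  assumes "tracked X \<phi> f" "tracked X \<phi>' f'"
  shows "tracked X (\<phi> \<circ> \<phi>') (f \<circ> f')"
proof -
  from assms(1) obtain \<psi> g u where 1: "tracks X \<psi> g" "\<forall>q\<in>X. f (g q) = q" "unitary u"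
    "\<psi> \<circ> \<phi> = (\<lambda>x. u * x * star u)" unfolding tracked_def by blast
  from assms(2) obtain \<psi>' g' u' where 2: "tracks X \<psi>' g'" "\<forall>q\<in>X. f' (g' q) = q" "unitary u'"
    "\<psi>' \<circ> \<phi>' = (\<lambda>x. u' * x * star u')" unfolding tracked_def by blast
  have \<psi>': "unital_star_endomorphism \<psi>'" using 2(1) by (simp add: tracks_def)
  have "(\<psi>' \<circ> \<psi>) \<circ> (\<phi> \<circ> \<phi>') = (\<lambda>x. \<psi>' u * u' * x * star (\<psi>' u * u'))"
  proof
    fix x
    have "\<psi> (\<phi> y) = u * y * star u" "\<psi>' (\<phi>' y) = u' * y * star u'" for y
      using fun_cong[OF 1(4), of y] fun_cong[OF 2(4), of y] by simp_all
    thus "((\<psi>' \<circ> \<psi>) \<circ> (\<phi> \<circ> \<phi>')) x = \<psi>' u * u' * x * star (\<psi>' u * u')"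
      by (simp add: endo_simps[OF \<psi>'] star_mult mult.assoc)
  qed
  moreover have "unitary (\<psi>' u * u')" using 1(3) 2(3) \<psi>' by (simp add: unitary_mult endo_unitary)
  moreover have "tracks X (\<psi>' \<circ> \<psi>) (g' \<circ> g)" "tracks X (\<phi> \<circ> \<phi>') (f \<circ> f')" "bij (\<phi> \<circ> \<phi>')"
    using 1(1) 2(1) assms by (auto simp: tracked_def tracks_comp bij_comp)
  moreover have "\<forall>q\<in>X. (f \<circ> f') ((g' \<circ> g) q) = q"
    using 1(1,2) 2(2) by (simp add: tracks_def)
  ultimately show ?thesis unfolding tracked_def by blast
qed

text \<open>Conjugation does not affect \<open>sends\<close>, so \<open>\<phi>\<close> also sends
  \<open>p\<close> to \<open>f' p\<close>. Going back along the left inverse of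
  \<open>\<phi>\<close> is inner in total, so \<open>g (f' p)\<close> is a rotation of
  \<open>p\<close>, hence \<open>p\<close>; now apply \<open>f\<close>.\<close>

lemma tracked_out_class:
  assumes X: "\<And>p q k. p \<in> X \<Longrightarrow> q \<in> X \<Longrightarrow> q = rotate k p \<Longrightarrow> q = p"
      "\<And>p q. p \<in> X \<Longrightarrow> q \<in> X \<Longrightarrow> length p = length q" "[] \<notin> X"
    and tr: "tracked X \<phi> f" "tracked X \<phi>' f'" and eq: "out_class \<phi> = out_class \<phi>'" and p: "p \<in> X"
  shows "f p = f' p"
proof -
  obtain u where u: "unitary u" "\<phi> = (\<lambda>x. u * \<phi>' x * star u)" using out_class_eqD[OF eq] .
  from tr(1) obtain \<psi> g v where \<psi>: "tracks X \<psi> g" "\<forall>q\<in>X. f (g q) = q" "unitary v"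
    "\<psi> \<circ> \<phi> = (\<lambda>x. v * x * star v)" unfolding tracked_def by blast
  have \<psi>': "unital_star_endomorphism \<psi>" "f' p \<in> X" "g (f' p) \<in> X"
    using \<psi>(1) tr(2) p by (auto simp: tracks_def tracked_def)
  have "sends \<phi> p (f' p)" unfolding u(2) using tr(2) p by (intro sends_conj u(1)) (auto simp: tracked_def tracks_def)
  moreover have "sends \<psi> (f' p) (g (f' p))" using \<psi>(1) \<psi>'(2) by (auto simp: tracks_def)
  ultimately have "sends (\<lambda>x. v * x * star v) p (g (f' p))"
    using sends_comp[OF \<psi>'(1)] \<psi>(4) by metis
  from sends_inner[OF this \<psi>(3)] obtain k where "g (f' p) = rotate k p" using X(2,3) p \<psi>'(3) by metis
  with X(1)[OF p \<psi>'(3)] have "g (f' p) = p" by blast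
  thus ?thesis using \<psi>(2) \<psi>'(2) by metis
qed

end

section \<open>The representatives as word permutations\<close>

abbreviation (input) I :: bool where "I \<equiv> False"
abbreviation (input) II :: bool where "II \<equiv> True"

text \<open>\<open>flip_out\<close> composes with \<lambda>_F on the right, changing the letter
  written. \<open>flip_in\<close> composes on the left: it changes the letter read and both states,
  but not the letter written.\<close>

definition flip_out :: "(bool list \<Rightarrow> bool list) \<Rightarrow> bool list \<Rightarrow> bool list" where
  "flip_out s w = (case s w of [] \<Rightarrow> [] | i # q \<Rightarrow> (\<not> i) # q)"

definition flip_in :: "(bool list \<Rightarrow> bool list) \<Rightarrow> bool list \<Rightarrow> bool list" where
  "flip_in s w = (case s (map Not w) of [] \<Rightarrow> [] | i # q \<Rightarrow> i # map Not q)"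

definition cycle3 :: "bool list \<Rightarrow> bool list \<Rightarrow> bool list \<Rightarrow> bool list \<Rightarrow> bool list" where
  "cycle3 a b c w = (if w = a then b else if w = b then c else if w = c then a else w)"

fun A_word :: "bool list \<Rightarrow> bool list" where
  "A_word [a, b, c, d] =
    (if a then if b then [II, I, c \<noteq> d, \<not> c] else [II, II, c, d]
     else if b then [a, b, c, d] else if c then [a, b, c, d] else [I, I, I, \<not> d])"
| "A_word w = w"

fun J_word :: "bool list \<Rightarrow> bool list" where
  "J_word [a, b, c, d] = (if a then if c then [a, b, c, d] else [a, b \<noteq> d, c, d] else [a, b, c, d])"
| "J_word w = w"

definition G_word :: "bool list \<Rightarrow> bool list" where
  "G_word = cycle3 [I, I, I, II] [I, I, II, II] [I, II, II, II]"

definition rep_words :: "(bool list \<Rightarrow> bool list) list" where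
  "rep_words = [id, flip_out id, A_word, flip_out A_word, flip_in A_word, flip_out (flip_in A_word), J_word, flip_out J_word, flip_in J_word, flip_out (flip_in J_word), G_word, flip_out G_word, flip_in G_word, flip_out (flip_in G_word)]"

text \<open>The inverses of the word permutations of \<open>\<lambda>\<^sub>A\<lambda>\<^sub>F\<close> and \<open>\<lambda>\<^sub>G\<close>; the permutation \<open>twist_word\<close>, whose
  unitary implements the square of \<open>\<lambda>\<^sub>A\<lambda>\<^sub>F\<close>; and the permutation of length 6 defining the inverse of \<open>\<lambda>\<^sub>G\<close>,
  with its own inverse.\<close>

fun AF_inv_word :: "bool list \<Rightarrow> bool list" where
  "AF_inv_word [a, b, c, d] =
    (if a then if b then [I, b, c, d] else if c then [I, b, c, d] else [I, I, I, \<not> d]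
     else if b then [II, I, c, d] else [II, II, \<not> d, c = d])"
| "AF_inv_word w = w"

definition G_inv_word :: "bool list \<Rightarrow> bool list" where
  "G_inv_word = cycle3 [I, I, I, II] [I, II, II, II] [I, I, II, II]"

fun twist_word :: "bool list \<Rightarrow> bool list" where
  "twist_word [a, b, c, d, e, f] =
    (if a then [a, \<not> b, (\<not> c) \<noteq> (b \<and> d),
       if b then (if c then d \<and> e else d \<or> \<not> e) else (if c then d = e else d),
       if b then e else if f then e else if c then e \<noteq> (d = e) else e \<noteq> d, f]
     else [a, \<not> b, c \<noteq> (d \<and> \<not> b), d, e, f])"
| "twist_word w = w"

definition G6_word :: "bool list \<Rightarrow> bool list" where
  "G6_word w =
    cycle3 [I, II, II, II, II, I] [I, I, I, I, II, I] [I, I, II, II, II, I]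
    (cycle3 [I, II, II, II, II, II] [I, I, I, II, II, II] [I, I, II, II, II, II]
    (cycle3 [I, I, II, II, I, I] [I, I, I, II, I, I] [I, II, II, II, I, I]
    (cycle3 [I, I, II, II, I, II] [I, I, I, II, I, II] [I, II, II, II, I, II] w)))"

definition G6_inv_word :: "bool list \<Rightarrow> bool list" where
  "G6_inv_word w =
    cycle3 [I, II, II, II, II, I] [I, I, II, II, II, I] [I, I, I, I, II, I]
    (cycle3 [I, II, II, II, II, II] [I, I, II, II, II, II] [I, I, I, II, II, II]
    (cycle3 [I, I, II, II, I, I] [I, II, II, II, I, I] [I, I, I, II, I, I]
    (cycle3 [I, I, II, II, I, II] [I, II, II, II, I, II] [I, I, I, II, I, II] w)))"

section \<open>Finite checks on words\<close>

primrec words_list :: "nat \<Rightarrow> bool list list" where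
  "words_list 0 = [[]]"
| "words_list (Suc k) = map ((#) I) (words_list k) @ map ((#) II) (words_list k)"

lemma set_words_list: "set (words_list k) = bwords k"
  by (induction k) (auto simp: bwords_0 bwords_Suc UNIV_bool)

definition has_length :: "nat \<Rightarrow> bool list \<Rightarrow> bool" where
  "has_length k w \<longleftrightarrow> length w = k"

definition permutation :: "nat \<Rightarrow> (bool list \<Rightarrow> bool list) \<Rightarrow> bool" where
  "permutation k s \<longleftrightarrow> distinct (map s (words_list k)) \<and> list_all (has_length k) (map s (words_list k))"

lemma permutation_bij:
  assumes "permutation k s"
  shows "bij_betw s (bwords k) (bwords k)"
proof -
  have "inj_on s (bwords k)" "s ` bwords k \<subseteq> bwords k"
    using assms by (auto simp: permutation_def distinct_map set_words_list list_all_iff has_length_def bwords_def)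
  thus ?thesis by (simp add: bij_betw_def endo_inj_surj)
qed

definition inverts :: "nat \<Rightarrow> (bool list \<Rightarrow> bool list) \<Rightarrow> (bool list \<Rightarrow> bool list) \<Rightarrow> bool list \<Rightarrow> bool" where
  "inverts k s t w \<longleftrightarrow> has_length k (t w) \<and> s (t w) = w"

lemma invertsD:
  "list_all (inverts k s t) (words_list k) \<Longrightarrow> length w = k \<Longrightarrow> length (t w) = k \<and> s (t w) = w"
  by (simp add: list_all_iff set_words_list bwords_def inverts_def has_length_def)

lemma inverts_bij:
  assumes "list_all (inverts k s t) (words_list k)"
  shows "bij_betw t (bwords k) (bwords k)" "bij_betw s (bwords k) (bwords k)"
proof -
  have st: "\<And>w. w \<in> bwords k \<Longrightarrow> t w \<in> bwords k \<and> s (t w) = w"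
    using invertsD[OF assms] by (simp add: bwords_def)
  have "inj_on t (bwords k)" by (rule inj_onI) (metis st)
  moreover have "t ` bwords k \<subseteq> bwords k" using st by auto
  ultimately have "t ` bwords k = bwords k" by (simp add: endo_inj_surj)
  with \<open>inj_on t (bwords k)\<close> show t: "bij_betw t (bwords k) (bwords k)" by (simp add: bij_betw_def)
  have "inv_into (bwords k) t w = s w" if "w \<in> bwords k" for w
  proof -
    have "w \<in> t ` bwords k" using \<open>t ` bwords k = bwords k\<close> that by simp
    then obtain v where "v \<in> bwords k" "w = t v" by auto
    thus ?thesis using st \<open>inj_on t (bwords k)\<close> by simp
  qed
  with bij_betw_inv_into[OF t] show "bij_betw s (bwords k) (bwords k)" by (simp cong: bij_betw_cong)
qed

lemma permutation_reps: "list_all (permutation 4) rep_words"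
  by code_simp

lemma inverse_words:
  "list_all (inverts 4 (flip_out A_word) AF_inv_word) (words_list 4)"
  "list_all (inverts 4 J_word J_word) (words_list 4)"
  "list_all (inverts 4 G_word G_inv_word) (words_list 4)"
  "list_all (inverts 6 G6_word G6_inv_word) (words_list 6)"
  by code_simp+

lemma permutation_twist: "permutation 6 twist_word"
  by code_simp

definition composes_all where
  "composes_all t k r z l xs w \<longleftrightarrow> list_all (composes t k r z l w) xs"

text \<open>Three further letters are enough: together with the three of \<open>tl (r w)\<close>
  they give the six on which \<open>twist_word\<close> acts.\<close>

lemma composes_AF:
  "list_all (composes_all AF_inv_word 4 (flip_out A_word) twist_word
      6 (words_list 3))
    (words_list 4)"
  by code_simp

text \<open>Length 0 makes the conjugating unitary 1, so the square is the identity exactly.\<close>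

lemma composes_J:
  "list_all (composes_all J_word 4 J_word id 0
      (words_list 3))
    (words_list 4)"
  by code_simp

lemma composes_G:
  "list_all (composes_all G_inv_word 4 G6_word id 0
      (words_list 3))
    (words_list 6)"
  "list_all (composes_all G6_inv_word 6 G_word id 0
      (words_list 5))
    (words_list 4)"
  by code_simp+

text \<open>One word from each rotation class of primitive words of length 6; there are (64 - 8 - 4
  + 2)/6 = 9 classes.\<close>

definition necklaces :: "bool list list" where
  "necklaces = [[I, I, I, I, I, II], [I, I, I, I, II, II], [I, I, I, II, I, II], [I, I, I, II, II, II], [I, I, II, I, II, II], [I, I, II, II, I, II], [I, I, II, II, II, II], [I, II, I, II, II, II], [I, II, II, II, II, II]]"

fun rotation :: "nat \<Rightarrow> bool list \<Rightarrow> bool list \<Rightarrow> bool" where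
  "rotation 0 p q = (p = q)"
| "rotation (Suc n) p q = (if p = q then True else rotation n (rotate1 p) q)"

text \<open>Five steps exhaust the rotations of a word of length 6. The default \<open>p\<close> is
  a rotation of \<open>p\<close> too; that a necklace is really reached is certified by
  \<open>moves_ok\<close>.\<close>

fun necklace_in :: "bool list list \<Rightarrow> bool list \<Rightarrow> bool list" where
  "necklace_in [] p = p"
| "necklace_in (q # qs) p =
    (if rotation 5 p q then q else necklace_in qs p)"

text \<open>A cycle \<open>(c, J)\<close> is a state and an input word that leads back to it; the orbit of the output word is
  mapped to the orbit of \<open>J\<close>.\<close>

fun moves :: "(bool list \<Rightarrow> bool list) \<Rightarrow> (bool list \<times> bool list) list \<Rightarrow> bool list \<Rightarrow> bool list" where
  "moves s [] p = []"
| "moves s ((c, J) # cs) p = (if outs s c J = p then necklace_in necklaces J else moves s cs p)"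

definition cycle_ok :: "nat \<Rightarrow> (bool list \<Rightarrow> bool list) \<Rightarrow> bool list \<times> bool list \<Rightarrow> bool" where
  "cycle_ok n s cJ \<longleftrightarrow> has_length n (fst cJ) \<and> dest s (fst cJ) (snd cJ) = fst cJ"

definition moves_ok :: "(bool list \<Rightarrow> bool list) \<Rightarrow> (bool list \<times> bool list) list \<Rightarrow> bool list \<Rightarrow> bool" where
  "moves_ok s cs p \<longleftrightarrow> moves s cs p \<in> set necklaces"

text \<open>One cycle for each necklace, writing it. Words of length 1 leave the empty word as the
  only state.\<close>

definition cycles_F :: "(bool list \<times> bool list) list" where
  "cycles_F = [([], [II, II, II, II, II, I]),
    ([], [II, II, II, II, I, I]),
    ([], [II, II, II, I, II, I]),
    ([], [II, II, II, I, I, I]),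
    ([], [II, II, I, II, I, I]),
    ([], [II, II, I, I, II, I]),
    ([], [II, II, I, I, I, I]),
    ([], [II, I, II, I, I, I]),
    ([], [II, I, I, I, I, I])]"

definition cycles_J :: "(bool list \<times> bool list) list" where
  "cycles_J = [([I, I, I], [I, I, II, I, I, I]),
    ([I, I, I], [I, II, II, I, I, I]),
    ([I, I, I], [II, I, II, I, I, I]),
    ([I, I, I], [II, II, II, I, I, I]),
    ([I, I, II], [I, II, II, II, I, II]),
    ([I, I, II], [I, I, II, II, I, II]),
    ([I, I, II], [II, II, II, II, I, II]),
    ([I, II, I], [II, II, I, I, II, I]),
    ([I, II, II], [II, II, I, I, II, II])]"

definition cycles_AF :: "(bool list \<times> bool list) list" where
  "cycles_AF = [([II, I, I], [I, I, II, II, I, I]),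
    ([II, I, I], [I, II, I, I, I, I]),
    ([II, I, I], [II, I, II, II, I, I]),
    ([II, I, I], [II, II, II, I, I, I]),
    ([II, I, II], [I, II, I, I, I, II]),
    ([II, I, II], [I, I, II, II, I, II]),
    ([II, I, II], [II, II, II, I, I, II]),
    ([II, II, I], [II, II, II, I, II, I]),
    ([II, II, II], [II, II, II, I, II, II])]"

definition cycles_G :: "(bool list \<times> bool list) list" where
  "cycles_G = [([I, I, I], [I, II, II, I, I, I]),
    ([I, I, I], [I, I, II, I, I, I]),
    ([I, II, II], [II, I, II, I, II, II]),
    ([I, I, I], [II, II, II, I, I, I]),
    ([I, I, II], [I, II, II, I, I, II]),
    ([I, I, I], [II, I, II, I, I, I]),
    ([I, II, II], [II, II, II, I, II, II]),
    ([I, II, I], [I, II, II, I, II, I]),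
    ([I, I, II], [II, II, II, I, I, II])]"

definition cycles_G6 :: "(bool list \<times> bool list) list" where
  "cycles_G6 = [([I, I, I, I, II], [II, I, I, I, I, II]),
    ([I, I, I, I, I], [II, I, I, I, I, I]),
    ([I, I, II, II, I], [II, I, I, II, II, I]),
    ([I, I, I, II, II], [II, I, I, I, II, II]),
    ([I, I, II, I, II], [II, I, I, II, I, II]),
    ([I, II, II, II, I], [II, I, II, II, II, I]),
    ([I, II, II, II, II], [II, I, II, II, II, II]),
    ([I, II, I, I, I], [II, I, II, I, I, I]),
    ([I, I, II, II, II], [II, I, I, II, II, II])]"

definition "move_F = moves (map Not) cycles_F"
definition "move_J = moves J_word cycles_J"
definition "move_AF = moves (flip_out A_word) cycles_AF"
definition "move_G = moves G_word cycles_G"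
definition "move_G6 = moves G6_word cycles_G6"

lemma cycles_ok:
  "list_all (cycle_ok 0 (map Not)) cycles_F" "list_all (moves_ok (map Not) cycles_F) necklaces"
  "list_all (cycle_ok 3 J_word) cycles_J" "list_all (moves_ok J_word cycles_J) necklaces"
  "list_all (cycle_ok 3 (flip_out A_word)) cycles_AF"
  "list_all (moves_ok (flip_out A_word) cycles_AF) necklaces"
  "list_all (cycle_ok 3 G_word) cycles_G" "list_all (moves_ok G_word cycles_G) necklaces"
  "list_all (cycle_ok 5 G6_word) cycles_G6"
  "list_all (moves_ok G6_word cycles_G6) necklaces"
  by code_simp+

lemma moves_inverse:
  "map move_F (map move_F necklaces) = necklaces" "map move_J (map move_J necklaces) = necklaces"
  "map move_AF (map move_AF necklaces) = necklaces" "map move_G (map move_G6 necklaces) = necklaces"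
  by code_simp+

text \<open>\<lambda>_A enters as (\<lambda>_A \<lambda>_F) \<lambda>_F, since it is \<lambda>_A
  \<lambda>_F whose square is inner.\<close>

definition rep_moves :: "(bool list \<Rightarrow> bool list) list" where
  "rep_moves = [id, move_F,
    move_AF \<circ> move_F, move_AF, move_F \<circ> (move_AF \<circ> move_F), move_F \<circ> move_AF,
    move_J, move_J \<circ> move_F, move_F \<circ> move_J, move_F \<circ> move_J \<circ> move_F,
    move_G, move_G \<circ> move_F, move_F \<circ> move_G, move_F \<circ> move_G \<circ> move_F]"

definition image_of :: "bool list list \<Rightarrow> (bool list \<Rightarrow> bool list) \<Rightarrow> bool list list" where
  "image_of ps f = map f ps"

lemma distinct_rep_moves: "distinct (map (image_of necklaces) rep_moves)"
  by code_simp

definition apart :: "bool list \<Rightarrow> bool list \<Rightarrow> bool" where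
  "apart p q \<longleftrightarrow> (if rotation 5 p q then q = p else True)"

definition all_apart :: "bool list list \<Rightarrow> bool list \<Rightarrow> bool" where
  "all_apart ps p \<longleftrightarrow> list_all (apart p) ps"

lemma necklaces_apart: "list_all (all_apart necklaces) necklaces"
  by code_simp

lemma length_necklaces: "list_all (has_length 6) necklaces"
  by code_simp

section \<open>The search results as labelled representatives\<close>

fun word_table :: "bool list list \<Rightarrow> bool list table" where
  "word_table [a, b, c, d, e, f, g, h] =
    Table (Some a) (Some b) (Some c) (Some d) (Some e) (Some f) (Some g) (Some h)"
| "word_table _ = blank"

definition tabulate :: "(label \<Rightarrow> 'a option) \<Rightarrow> 'a table" where
  "tabulate f = Table (f L0) (f L1) (f L2) (f L3) (f L4) (f L5) (f L6) (f L7)"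

fun label_in :: "label list \<Rightarrow> bool list table \<Rightarrow> bool list \<Rightarrow> label option" where
  "label_in [] W q = None"
| "label_in (v # vs) W q = (if entry W v = Some q then Some v else label_in vs W q)"

definition successor :: "(bool list \<Rightarrow> bool list) \<Rightarrow> bool list table \<Rightarrow> bool \<Rightarrow> label \<Rightarrow> label option" where
  "successor r W j v = (case entry W v of None \<Rightarrow> None | Some p \<Rightarrow> label_in labels W (tl (r (p @ [j]))))"

definition out_letter :: "(bool list \<Rightarrow> bool list) \<Rightarrow> bool list table \<Rightarrow> bool \<Rightarrow> label \<Rightarrow> bool option" where
  "out_letter r W j v = (case entry W v of None \<Rightarrow> None | Some p \<Rightarrow> Some (hd (r (p @ [j]))))"

fun solution_of :: "(bool list \<Rightarrow> bool list) \<times> bool list table \<Rightarrow> solution" where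
  "solution_of (r, W) = (tabulate (successor r W I), tabulate (successor r W II),
     tabulate (out_letter r W I), tabulate (out_letter r W II))"

text \<open>The labels of the search, in the order in which it finds the solutions, as states of the
  representatives.\<close>

definition models :: "((bool list \<Rightarrow> bool list) \<times> bool list table) list" where
  "models = [(id, word_table [[I, I, I], [I, I, II], [I, II, I], [II, I, I], [II, I, II], [I, II, II], [II, II, I], [II, II, II]]),
    (flip_out id, word_table [[I, I, I], [I, I, II], [I, II, I], [II, I, I], [II, I, II], [I, II, II], [II, II, I], [II, II, II]]),
    (flip_out (flip_in J_word), word_table [[I, I, I], [I, I, II], [II, II, I], [II, I, I], [II, I, II], [I, II, I], [I, II, II], [II, II, II]]),
    (flip_in J_word, word_table [[I, I, I], [I, I, II], [II, II, I], [II, I, I], [II, I, II], [I, II, I], [I, II, II], [II, II, II]]),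
    (J_word, word_table [[I, I, I], [I, I, II], [I, II, I], [II, I, I], [II, I, II], [I, II, II], [II, II, I], [II, II, II]]),
    (flip_out J_word, word_table [[I, I, I], [I, I, II], [I, II, I], [II, I, I], [II, I, II], [I, II, II], [II, II, I], [II, II, II]]),
    (flip_in A_word, word_table [[II, II, II], [II, II, I], [II, I, I], [I, I, I], [II, I, II], [I, II, I], [I, I, II], [I, II, II]]),
    (flip_out (flip_in A_word), word_table [[II, II, II], [II, II, I], [II, I, I], [I, I, I], [II, I, II], [I, II, I], [I, I, II], [I, II, II]]),
    (G_word, word_table [[I, I, I], [I, II, II], [II, II, I], [II, I, I], [I, I, II], [I, II, I], [II, I, II], [II, II, II]]),
    (flip_out G_word, word_table [[I, I, I], [I, II, II], [II, II, I], [II, I, I], [I, I, II], [I, II, I], [II, I, II], [II, II, II]]),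
    (flip_out A_word, word_table [[II, I, I], [II, I, II], [II, II, I], [I, I, II], [I, II, I], [I, II, II], [II, II, II], [I, I, I]]),
    (A_word, word_table [[II, I, I], [II, I, II], [II, II, I], [I, I, II], [I, II, I], [I, II, II], [II, II, II], [I, I, I]]),
    (flip_out (flip_in G_word), word_table [[I, I, I], [I, I, II], [I, II, I], [II, I, I], [II, II, I], [II, I, II], [I, II, II], [II, II, II]]),
    (flip_in G_word, word_table [[I, I, I], [I, I, II], [I, II, I], [II, I, I], [II, II, I], [II, I, II], [I, II, II], [II, II, II]])]"

text \<open>Of the sixteen edges one is given, so fifteen steps fill the tables.\<close>

lemma search_result: "search 15 (set_entry blank L0 L0) blank [L0] [L1, L2, L3, L4, L5, L6, L7] [L0] = map solution_of models"
  by code_simp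

lemma solution_entry:
  assumes "solution_of (r, W) = (F, G, A, B)"
  shows "entry F v = successor r W I v" "entry G v = successor r W II v"
    "entry A v = out_letter r W I v" "entry B v = out_letter r W II v"
  using assms by (cases v; auto simp: tabulate_def)+

lemma label_inD: "label_in vs W q = Some v \<Longrightarrow> entry W v = Some q"
  by (induction vs) (auto split: if_splits)

definition full_table :: "bool list table \<Rightarrow> bool" where
  "full_table W \<longleftrightarrow> (let ws = map (entry W) labels in distinct ws \<and> None \<notin> set ws \<and>
     list_all (\<lambda>w. case w of None \<Rightarrow> False | Some p \<Rightarrow> has_length 3 p) ws)"

definition model_ok :: "(bool list \<Rightarrow> bool list) \<times> bool list table \<Rightarrow> bool" where
  "model_ok m \<longleftrightarrow> full_table (snd m)"

lemma models_full: "list_all model_ok models"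
  by code_simp

lemma models_reps: "fst ` set models \<subseteq> set rep_words"
proof -
  \<comment> \<open>Functions cannot be compared by evaluation, so membership goes through the
    positions of the models in \<open>rep_words\<close>.\<close>
  have "map fst models = map ((!) rep_words) [0, 1, 9, 8, 6, 7, 4, 5, 10, 11, 3, 2, 13, 12]"
    by (simp add: models_def rep_words_def)
  hence "fst ` set models = (!) rep_words ` set [0, 1, 9, 8, 6, 7, 4, 5, 10, 11, 3, 2, 13, 12]"
    by (metis set_map)
  moreover have "length rep_words = 14" by (simp add: rep_words_def)
  ultimately show ?thesis by (auto intro!: nth_mem)
qed

lemma full_table_entry: "full_table W \<Longrightarrow> entry W v \<noteq> None"
proof -
  assume "full_table W"
  hence "None \<notin> range (entry W)" by (simp add: full_table_def Let_def)
  thus ?thesis by (metis rangeI)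
qed

lemma solution_not_failure:
  assumes "full_table W"
  shows "solution_of (r, W) \<noteq> failure"
proof
  assume "solution_of (r, W) = failure"
  from solution_entry(3)[OF this[unfolded failure_def], of L0] full_table_entry[OF assms, of L0]
  show False by (auto simp: out_letter_def)
qed

lemma full_table_bij:
  assumes "full_table W"
  shows "bij_betw (\<lambda>v. the (entry W v)) UNIV (bwords 3)"
proof -
  have ws: "distinct (map (entry W) labels)" "\<And>v. \<exists>p. entry W v = Some p \<and> length p = 3"
  proof -
    show "distinct (map (entry W) labels)" using assms by (simp add: full_table_def Let_def)
    fix v
    obtain p where "entry W v = Some p" using full_table_entry[OF assms, of v] by blast
    moreover have "case entry W v of None \<Rightarrow> False | Some p \<Rightarrow> has_length 3 p"
      using assms by (simp add: full_table_def Let_def list_all_iff)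
    ultimately show "\<exists>p. entry W v = Some p \<and> length p = 3" by (simp add: has_length_def)
  qed
  have "inj (entry W)" using ws(1) by (simp add: distinct_map)
  hence inj: "inj (\<lambda>v. the (entry W v))"
    unfolding inj_def by (metis ws(2) option.sel)
  moreover have "range (\<lambda>v. the (entry W v)) \<subseteq> bwords 3"
    by (auto simp: bwords_def) (metis ws(2) option.sel)
  moreover have "card (bwords 3) = card (UNIV :: label set)"
    using card_lists_length_eq[of "UNIV :: bool set" 3] by (simp add: bwords_def card_label)
  ultimately have "range (\<lambda>v. the (entry W v)) = bwords 3"
    by (intro card_subset_eq) (simp_all add: card_image)
  with inj show ?thesis by (simp add: bij_betw_def)
qed

lemma fold_dest: "fold (\<lambda>j p. tl (s (p @ [j]))) J p = dest s p J"
  by (induction J arbitrary: p) simp_all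

lemma bij_snoc:
  "bij_betw (\<lambda>(j, p). p @ [j]) (UNIV \<times> bwords n) (bwords (Suc n))"
  by (rule bij_betw_byWitness[where f' = "\<lambda>w. (last w, butlast w)"])
    (auto simp: bwords_def simp del: append_butlast_last_id intro!: append_butlast_last_id)

lemma bij_hd_tl: "bij_betw (\<lambda>w. (hd w, tl w)) (bwords (Suc n)) (UNIV \<times> bwords n)"
  by (rule bij_betw_byWitness[where f' = "\<lambda>(i, q). i # q"]) (auto simp: bwords_def length_Suc_conv)

section \<open>Classification\<close>

context cuntz_algebra
begin

lemma transducer_if_surj:
  assumes s: "bij_betw s (bwords 4) (bwords 4)" and surj: "surj (\<Lambda> 4 s)"
  shows "transducer (bwords 3) (\<lambda>(j, p). (hd (s (p @ [j])), tl (s (p @ [j]))))"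
proof -
  let ?\<Phi> = "\<lambda>(j, p). (hd (s (p @ [j])), tl (s (p @ [j])))"
  have s': "bij_betw s (bwords (Suc 3)) (bwords (Suc 3))" using s by simp
  have surj': "surj (\<Lambda> (Suc 3) s)" using surj by simp
  have \<Phi>: "?\<Phi> = (\<lambda>w. (hd w, tl w)) \<circ> s \<circ> (\<lambda>(j, p). p @ [j])" by auto
  have bij: "bij_betw ?\<Phi> (UNIV \<times> bwords 3) (UNIV \<times> bwords 3)"
    unfolding \<Phi> using bij_snoc[of 3] s' bij_hd_tl[of 3] by (meson bij_betw_trans)
  have fwd: "resets (bwords 3) (\<lambda>j p. tl (s (p @ [j])))"
    unfolding resets_def fold_dest
    using surj_input_cycle_unique[OF s' surj'] by (auto simp: bwords_def)
  define \<pi> where "\<pi> i q = snd (inv_into (UNIV \<times> bwords 3) ?\<Phi> (i, q))" for i q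
  have \<pi>: "\<pi> i q \<in> bwords 3 \<and> (\<exists>j. hd (s (\<pi> i q @ [j])) = i \<and> tl (s (\<pi> i q @ [j])) = q)"
    if "q \<in> bwords 3" for i q
  proof -
    have "(i, q) \<in> ?\<Phi> ` (UNIV \<times> bwords 3)"
      unfolding bij_betw_imp_surj_on[OF bij] using that by simp
    from inv_into_into[OF this] f_inv_into_f[OF this] show ?thesis
      unfolding \<pi>_def by (cases "inv_into (UNIV \<times> bwords 3) ?\<Phi> (i, q)") auto
  qed
  \<comment> \<open>Following predecessors along \<open>w\<close> and walking back forwards writes
    \<open>w\<close> in reverse. Hence cycles of \<pi> with a common word are cycles of the
    transducer with equal outputs.\<close>
  have return_path: "fold \<pi> w q \<in> bwords 3 \<and> (\<exists>J. dest s (fold \<pi> w q) J = q \<and> outs s (fold \<pi> w q) J = rev w)"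
    if "q \<in> bwords 3" for w q
    using that
  proof (induction w arbitrary: q)
    case Nil
    have "dest s q [] = q" "outs s q [] = rev []" by simp_all
    with Nil show ?case by (metis fold_simps(1))
  next
    case (Cons i w)
    from \<pi>[OF Cons.prems] obtain j where
      j: "\<pi> i q \<in> bwords 3" "hd (s (\<pi> i q @ [j])) = i" "tl (s (\<pi> i q @ [j])) = q" by blast
    from Cons.IH[OF j(1)] obtain J where
      J: "fold \<pi> w (\<pi> i q) \<in> bwords 3" "dest s (fold \<pi> w (\<pi> i q)) J = \<pi> i q"
        "outs s (fold \<pi> w (\<pi> i q)) J = rev w" by blast
    have "dest s (fold \<pi> w (\<pi> i q)) (J @ [j]) = q" "outs s (fold \<pi> w (\<pi> i q)) (J @ [j]) = rev (i # w)"
      by (simp_all add: dest_append outs_append J j)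
    with J(1) show ?case by auto
  qed
  have "p = q" if w: "w \<noteq> []" and p: "p \<in> bwords 3" "fold \<pi> w p = p" and q: "q \<in> bwords 3" "fold \<pi> w q = q"
    for w p q
  proof -
    from return_path[OF p(1), of w] obtain J where J: "dest s p J = p" "outs s p J = rev w" by (auto simp: p)
    from return_path[OF q(1), of w] obtain K where K: "dest s q K = q" "outs s q K = rev w" by (auto simp: q)
    have "J \<noteq> []" using J(2) w by auto
    with J K p(1) q(1) show ?thesis
      using surj_output_cycle_unique[OF s' surj', of p J q K] by (simp add: bwords_def)
  qed
  hence bwd: "resets (bwords 3) \<pi>" unfolding resets_def by blast
  have "card (bwords 3) = 8"
    using card_lists_length_eq[of "UNIV :: bool set" 3] by (simp add: bwords_def)
  with bij fwd bwd show ?thesis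
    unfolding transducer_def by (simp add: \<pi>_def[abs_def])
qed

text \<open>A solution labels the states of \<open>s\<close> by \<open>e\<close> and those of some
  representative \<open>r\<close> by \<open>W\<close>. Matching labels is an isomorphism of
  transducers, to which \<open>\<Lambda>_conj\<close> applies.\<close>

lemma \<Lambda>4_classification:
  assumes s: "bij_betw s (bwords 4) (bwords 4)" and surj: "surj (\<Lambda> 4 s)"
  shows "\<exists>r\<in>set rep_words. out_class (\<Lambda> 4 s) = out_class (\<Lambda> 4 r)"
proof -
  interpret T: transducer "bwords 3" "\<lambda>(j, p). (hd (s (p @ [j])), tl (s (p @ [j])))"
    using transducer_if_surj[OF s surj] .
  obtain x where x: "x \<in> set models" "solution_of x = failure \<or> (\<exists>e. T.describes e (solution_of x))"
    using T.ex_solution[of 15] unfolding search_result by auto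
  obtain r W where rW: "x = (r, W)" by fastforce
  have W: "full_table W" using models_full x(1) unfolding rW by (auto simp: list_all_iff model_ok_def)
  then obtain e where e': "T.describes e (solution_of (r, W))"
    using x(2) solution_not_failure unfolding rW by blast
  obtain F G A B where sol: "solution_of (r, W) = (F, G, A, B)" by (metis prod_cases4)
  have r: "r \<in> set rep_words" using x(1) models_reps unfolding rW by force
  define w where "w v = the (entry W v)" for v
  have w: "bij_betw w UNIV (bwords 3)" using full_table_bij[OF W] by (simp add: w_def[abs_def])
  have Ww: "entry W v = Some (w v)" for v
    using full_table_entry[OF W, of v] by (auto simp: w_def)
  have e: "bij_betw e UNIV (bwords 3)" using e' unfolding sol T.describes_def by simp
  have rb: "bij_betw r (bwords 4) (bwords 4)"
    using permutation_reps r by (auto simp: list_all_iff intro: permutation_bij)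
  define z where "z = w \<circ> inv_into UNIV e"
  have z: "bij_betw z (bwords 3) (bwords 3)"
    unfolding z_def using bij_betw_trans[OF bij_betw_inv_into[OF e] w] .
  have ze: "z (e v) = w v" for v
    using inv_into_f_f[OF bij_betw_imp_inj_on[OF e]] by (simp add: z_def)
  have iso: "r (z p @ [j]) = hd (s (p @ [j])) # z (tl (s (p @ [j])))" if p: "length p = 3" for p j
  proof -
    obtain v where v: "p = e v"
    proof -
      have "p \<in> e ` UNIV" unfolding bij_betw_imp_surj_on[OF e] using p by (simp add: bwords_def)
      thus ?thesis using that by auto
    qed
    have "\<exists>t. successor r W j v = Some t \<and> out_letter r W j v = Some (hd (s (e v @ [j]))) \<and>
        tl (s (e v @ [j])) = e t"
    proof -
      from e' obtain t u a b where "successor r W I v = Some t" "successor r W II v = Some u"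
        "out_letter r W I v = Some a" "out_letter r W II v = Some b"
        "(hd (s (e v @ [I])), tl (s (e v @ [I]))) = (a, e t)"
        "(hd (s (e v @ [II])), tl (s (e v @ [II]))) = (b, e u)"
        unfolding sol T.describes_def prod.case solution_entry[OF sol] by blast
      thus ?thesis by (cases j) auto
    qed
    then obtain t where t: "label_in labels W (tl (r (w v @ [j]))) = Some t"
      "hd (r (w v @ [j])) = hd (s (e v @ [j]))" "tl (s (e v @ [j])) = e t"
      by (auto simp: successor_def out_letter_def Ww)
    have "w t = tl (r (w v @ [j]))" using label_inD[OF t(1)] by (simp add: Ww)
    moreover have "r (w v @ [j]) \<noteq> []"
    proof -
      have "w v @ [j] \<in> bwords 4" using bij_betwE[OF w] by (simp add: bwords_def)
      with bij_betwE[OF rb] have "r (w v @ [j]) \<in> bwords 4" by blast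
      thus ?thesis by (auto simp: bwords_def)
    qed
    ultimately show ?thesis by (simp add: v ze t(3) flip: t(2))
  qed
  have "\<Lambda> (Suc 3) r = (\<lambda>x. U 3 z * x * star (U 3 z)) \<circ> \<Lambda> (Suc 3) s"
    using s rb by (intro \<Lambda>_conj z iso) simp_all
  hence "out_class (\<Lambda> 4 r) = out_class (\<Lambda> 4 s)"
    using out_class_conj[OF unitary_U[OF z]] by simp
  with r show ?thesis by metis
qed

lemma perm_automorphisms_eq:
  "perm_automorphisms S 4 = {\<Lambda> 4 s | s. bij_betw s (bwords 4) (bwords 4) \<and> bij (\<Lambda> 4 s)}"
  unfolding perm_automorphisms_def perm_unitaries_eq using \<Lambda>_endo by (auto simp: Aut_def)

section \<open>Composition with the flip\<close>

definition lF :: "'a \<Rightarrow> 'a" where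
  "lF = \<Lambda> 1 (map Not)"

lemma perm_Not: "bij_betw (map Not) (bwords k) (bwords k)"
  by (rule bij_betw_byWitness[where f' = "map Not"]) (auto simp: bwords_def comp_def)

lemma unitary_F_eq: "unitary_F S = U 1 (map Not)"
proof -
  have "bwords 1 = {[I], [II]}" by (auto simp: bwords_def length_Suc_conv)
  thus ?thesis by (simp add: unitary_F_def U_def V_Cons letter_def add.commute)
qed

lemma lF_endo: "unital_star_endomorphism lF"
  unfolding lF_def by (rule \<Lambda>_endo[OF perm_Not])

lemma lF_S: "lF (S (letter b)) = S (letter (\<not> b))"
  using \<Lambda>_step[OF perm_Not[of 1], of "[\<not> b]" b "[]"]
  unfolding lF_def by (simp add: V_Cons)

lemma lF_V: "lF (V w) = V (map Not w)"
  by (induction w) (simp_all add: V_Cons endo_simps[OF lF_endo] lF_S)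

lemma lF_lF: "lF \<circ> lF = id"
proof -
  have "lF \<circ> lF = (\<lambda>x. 1 * x * star 1)"
    by (rule endo_eqI[OF endo_comp[OF lF_endo lF_endo] endo_conj[OF unitary_one]]) (simp add: lF_S)
  thus ?thesis by (simp add: id_def)
qed

lemma flip_out_perm:
  assumes "bij_betw s (bwords (Suc n)) (bwords (Suc n))"
  shows "bij_betw (flip_out s) (bwords (Suc n)) (bwords (Suc n))"
proof -
  let ?h = "\<lambda>w. (\<not> hd w) # tl w"
  have "bij_betw ?h (bwords (Suc n)) (bwords (Suc n))"
    by (rule bij_betw_byWitness[where f' = ?h]) (auto simp: bwords_def length_Suc_conv)
  from bij_betw_trans[OF assms this] show ?thesis
  proof (subst bij_betw_cong)
    fix w :: "bool list" assume "w \<in> bwords (Suc n)"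
    with bij_betwE[OF assms] have "s w \<in> bwords (Suc n)" by blast
    thus "flip_out s w = (?h \<circ> s) w"
      by (auto simp: flip_out_def bwords_def length_Suc_conv split: list.split)
  qed
qed

lemma flip_in_perm:
  assumes "bij_betw s (bwords (Suc n)) (bwords (Suc n))"
  shows "bij_betw (flip_in s) (bwords (Suc n)) (bwords (Suc n))"
proof -
  let ?h = "\<lambda>w. hd w # map Not (tl w)"
  have "bij_betw ?h (bwords (Suc n)) (bwords (Suc n))"
    by (rule bij_betw_byWitness[where f' = ?h]) (auto simp: bwords_def length_Suc_conv comp_def)
  from bij_betw_trans[OF bij_betw_trans[OF perm_Not assms] this] show ?thesis
  proof (subst bij_betw_cong)
    fix w :: "bool list" assume "w \<in> bwords (Suc n)"
    hence "map Not w \<in> bwords (Suc n)" by (simp add: bwords_def)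
    with bij_betwE[OF assms] have "s (map Not w) \<in> bwords (Suc n)" by blast
    thus "flip_in s w = (?h \<circ> (s \<circ> map Not)) w"
      by (auto simp: flip_in_def bwords_def length_Suc_conv split: list.split)
  qed
qed

lemma \<Lambda>_flip_out:
  assumes s: "bij_betw s (bwords (Suc n)) (bwords (Suc n))"
  shows "\<Lambda> (Suc n) (flip_out s) = \<Lambda> (Suc n) s \<circ> lF"
proof (rule endo_eqI)
  fix b
  show "\<Lambda> (Suc n) (flip_out s) (S (letter b)) = (\<Lambda> (Suc n) s \<circ> lF) (S (letter b))"
  proof (rule eq_if_eq_on_words[of n])
    fix q :: "bool list" assume "length q = n"
    then obtain w where w: "length w = Suc n" "s w = (\<not> b) # q" using perm_ConsE[OF s] by metis
    have "flip_out s w = b # q" by (simp add: flip_out_def w)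
    with \<Lambda>_step[OF s w] \<Lambda>_step[OF flip_out_perm[OF s] w(1)]
    show "\<Lambda> (Suc n) (flip_out s) (S (letter b)) * V q = (\<Lambda> (Suc n) s \<circ> lF) (S (letter b)) * V q"
      by (simp add: lF_S)
  qed
qed (intro endo_comp \<Lambda>_endo flip_out_perm s lF_endo)+

lemma \<Lambda>_flip_in:
  assumes s: "bij_betw s (bwords (Suc n)) (bwords (Suc n))"
  shows "\<Lambda> (Suc n) (flip_in s) = lF \<circ> \<Lambda> (Suc n) s"
proof (rule endo_eqI)
  fix b
  show "\<Lambda> (Suc n) (flip_in s) (S (letter b)) = (lF \<circ> \<Lambda> (Suc n) s) (S (letter b))"
  proof (rule eq_if_eq_on_words[of n])
    fix q :: "bool list" assume q: "length q = n"
    then obtain w where w: "length w = Suc n" "s w = b # map Not q"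
      using perm_ConsE[OF s, of "map Not q"] by (metis length_map)
    have "flip_in s (map Not w) = b # q" by (simp add: flip_in_def w comp_def)
    with \<Lambda>_step[OF flip_in_perm[OF s], of "map Not w" b q] w(1)
    have "\<Lambda> (Suc n) (flip_in s) (S (letter b)) * V q = V (map Not w)" by simp
    moreover have "lF (\<Lambda> (Suc n) s (S (letter b))) * lF (V (map Not q)) = lF (V w)"
      using \<Lambda>_step[OF s w] by (simp flip: endo_simps(3)[OF lF_endo])
    ultimately show "\<Lambda> (Suc n) (flip_in s) (S (letter b)) * V q = (lF \<circ> \<Lambda> (Suc n) s) (S (letter b)) * V q"
      by (simp add: lF_V comp_def)
  qed
qed (intro endo_comp \<Lambda>_endo flip_in_perm s lF_endo)+

lemma \<Lambda>_id: "\<Lambda> k id = id"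
proof -
  have "bij_betw id (bwords k) (bwords k)" by simp
  note id = this
  have "\<Lambda> k id (S (letter b)) = S (letter b)" for b
    unfolding \<Lambda>_S[OF id] by (simp add: U_def sum_V)
  hence "\<Lambda> k id = (\<lambda>x. 1 * x * star 1)"
    by (intro endo_eqI \<Lambda>_endo id endo_conj unitary_one) simp
  thus ?thesis by (simp add: id_def)
qed

section \<open>Necklace actions of the representatives\<close>

lemma rotation_rotate: "rotation n p q \<Longrightarrow> \<exists>k. q = rotate k p"
proof (induction n arbitrary: p)
  case 0
  thus ?case by (metis rotate0 id_apply rotation.simps(1))
next
  case (Suc n)
  show ?case
  proof (cases "p = q")
    case True
    thus ?thesis by (metis rotate0 id_apply)
  next
    case False
    with Suc obtain k where "q = rotate k (rotate1 p)" by auto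
    thus ?thesis by (metis rotate_Suc rotate1_rotate_swap)
  qed
qed

lemma rotate_rotation: "k \<le> n \<Longrightarrow> rotation n p (rotate k p)"
proof (induction n arbitrary: p k)
  case (Suc n)
  show ?case
  proof (cases k)
    case (Suc l)
    with Suc.IH[of l "rotate1 p"] Suc.prems show ?thesis by (simp add: rotate1_rotate_swap)
  qed simp
qed simp

lemma necklace_in_rotate: "\<exists>k. necklace_in qs p = rotate k p"
proof (induction qs)
  case Nil
  show ?case by (metis necklace_in.simps(1) rotate0 id_apply)
next
  case (Cons q qs)
  thus ?case using rotation_rotate[of 5 p q] by simp
qed

lemma sends_moves:
  assumes s: "bij_betw s (bwords (Suc n)) (bwords (Suc n))" and cs: "list_all (cycle_ok n s) cs"
    and p: "moves s cs p \<noteq> []"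
  shows "sends (\<Lambda> (Suc n) s) p (moves s cs p)"
  using cs p
proof (induction cs)
  case (Cons cJ cs)
  obtain c J where cJ: "cJ = (c, J)" by fastforce
  show ?case
  proof (cases "outs s c J = p")
    case True
    obtain k where "necklace_in necklaces J = rotate k J" using necklace_in_rotate by blast
    moreover have "sends (\<Lambda> (Suc n) s) p J"
      using sends_\<Lambda>[OF s, of c J] Cons.prems True by (simp add: cJ cycle_ok_def has_length_def)
    ultimately show ?thesis using sends_rotate True by (simp add: cJ)
  next
    case False
    with Cons show ?thesis by (simp add: cJ)
  qed
qed simp

abbreviation "tracks' \<equiv> tracks (set necklaces)"
abbreviation "tracked' \<equiv> tracked (set necklaces)"

lemma length_necklace: "p \<in> set necklaces \<Longrightarrow> length p = 6"
  using length_necklaces by (simp add: list_all_iff has_length_def)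

lemma tracks_moves:
  assumes "bij_betw s (bwords (Suc n)) (bwords (Suc n))" "list_all (cycle_ok n s) cs"
    "list_all (moves_ok s cs) necklaces"
  shows "tracks' (\<Lambda> (Suc n) s) (moves s cs)"
  unfolding tracks_def
proof (intro conjI ballI)
  fix p assume "p \<in> set necklaces"
  thus m: "moves s cs p \<in> set necklaces"
    using assms(3) by (simp add: list_all_iff moves_ok_def)
  hence "moves s cs p \<noteq> []" using length_necklace by force
  thus "sends (\<Lambda> (Suc n) s) p (moves s cs p)" using sends_moves assms by blast
qed (rule \<Lambda>_endo[OF assms(1)])

lemma moves_inverseD:
  assumes "map f (map g necklaces) = necklaces"
  shows "\<forall>q\<in>set necklaces. f (g q) = q"
proof -
  have "map (f \<circ> g) necklaces = map (\<lambda>q. q) necklaces" using assms by simp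
  thus ?thesis unfolding map_eq_conv by simp
qed

text \<open>The square is bijective, which makes the map both injective and surjective.\<close>

lemma bij_if_square_inner:
  assumes "\<phi> \<circ> \<phi> = (\<lambda>x. u * x * star u)" "unitary u"
  shows "bij (\<phi> :: 'a \<Rightarrow> 'a)"
proof -
  have uu: "star u * u = 1" "u * star u = 1" using assms(2) by (simp_all add: unitary_def)
  have "star u * (u * x * star u) * u = x" "u * (star u * x * u) * star u = x" for x
  proof -
    have "star u * (u * x * star u) * u = star u * u * x * (star u * u)"
      "u * (star u * x * u) * star u = u * star u * x * (u * star u)" by (simp_all add: mult.assoc)
    thus "star u * (u * x * star u) * u = x" "u * (star u * x * u) * star u = x" by (simp_all add: uu)
  qed
  hence "bij (\<phi> \<circ> \<phi>)" unfolding assms(1) by (intro o_bij[of "\<lambda>x. star u * x * u"]) (auto simp: comp_def)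
  hence "inj (\<phi> \<circ> \<phi>)" "surj (\<phi> \<circ> \<phi>)" by (simp_all add: bij_def)
  hence "inj \<phi>" "surj \<phi>"
    by (auto intro: inj_on_imageI2 simp: surj_def)
  thus ?thesis by (simp add: bij_def)
qed

lemma tracked_F: "tracked' lF move_F"
proof -
  have "bij lF" using lF_lF by (rule o_bij[OF lF_lF])
  moreover have "tracks' lF move_F"
    using tracks_moves[of "map Not" 0 cycles_F] perm_Not cycles_ok(1,2)
    by (simp add: move_F_def lF_def)
  moreover have "lF \<circ> lF = (\<lambda>x. 1 * x * star 1)" by (simp add: lF_lF id_def)
  ultimately show ?thesis
    unfolding tracked_def using moves_inverseD[OF moves_inverse(1)] unitary_one by blast
qed

lemma composes_allD:
  assumes "list_all (composes_all t k r z l (words_list N)) (words_list m)"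
    "length w = m" "length x = N"
  shows "composes t k r z l w x"
  using assms by (simp add: list_all_iff composes_all_def set_words_list bwords_def)

lemma tracked_AF: "tracked' (\<Lambda> 4 (flip_out A_word)) move_AF"
proof -
  let ?s = "flip_out A_word"
  have s: "bij_betw ?s (bwords (Suc 3)) (bwords (Suc 3))"
    using inverts_bij(2)[OF inverse_words(1)] by simp
  have z: "bij_betw twist_word (bwords 6) (bwords 6)" by (rule permutation_bij[OF permutation_twist])
  have sq: "\<Lambda> 4 ?s \<circ> \<Lambda> 4 ?s = (\<lambda>x. star (U 6 twist_word) * x * star (star (U 6 twist_word)))"
    using \<Lambda>_comp_\<Lambda>[OF s _ s z, of AF_inv_word 3] invertsD[OF inverse_words(1)]
      composes_allD[OF composes_AF] by simp
  moreover have "bij (\<Lambda> 4 ?s)" by (rule bij_if_square_inner[OF sq unitary_star[OF unitary_U[OF z]]])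
  moreover have "tracks' (\<Lambda> 4 ?s) move_AF"
    using tracks_moves[OF s, of cycles_AF] cycles_ok(5,6) by (simp add: move_AF_def)
  ultimately show ?thesis
    unfolding tracked_def using moves_inverseD[OF moves_inverse(3)] unitary_star[OF unitary_U[OF z]] by blast
qed

lemma tracked_J: "tracked' (\<Lambda> 4 J_word) move_J"
proof -
  have s: "bij_betw J_word (bwords (Suc 3)) (bwords (Suc 3))"
    using inverts_bij(2)[OF inverse_words(2)] by simp
  have z: "bij_betw id (bwords 0) (bwords 0)" by simp
  have sq: "\<Lambda> 4 J_word \<circ> \<Lambda> 4 J_word = (\<lambda>x. star (U 0 id) * x * star (star (U 0 id)))"
    using \<Lambda>_comp_\<Lambda>[OF s _ s z, of J_word 3] invertsD[OF inverse_words(2)]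
      composes_allD[OF composes_J] by simp
  moreover have "bij (\<Lambda> 4 J_word)" by (rule bij_if_square_inner[OF sq unitary_star[OF unitary_U[OF z]]])
  moreover have "tracks' (\<Lambda> 4 J_word) move_J"
    using tracks_moves[OF s, of cycles_J] cycles_ok(3,4) by (simp add: move_J_def)
  ultimately show ?thesis
    unfolding tracked_def using moves_inverseD[OF moves_inverse(2)] unitary_star[OF unitary_U[OF z]] by blast
qed

lemma tracked_G: "tracked' (\<Lambda> 4 G_word) move_G"
proof -
  have s: "bij_betw G_word (bwords (Suc 3)) (bwords (Suc 3))"
    using inverts_bij(2)[OF inverse_words(3)] by simp
  have r: "bij_betw G6_word (bwords (Suc 5)) (bwords (Suc 5))"
    using inverts_bij(2)[OF inverse_words(4)] by simp
  have z: "bij_betw id (bwords 0) (bwords 0)" by simp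
  have one: "U 0 id = 1" by (simp add: U_def bwords_0)
  have sr: "\<Lambda> 4 G_word \<circ> \<Lambda> 6 G6_word = (\<lambda>x. 1 * x * star 1)"
    using \<Lambda>_comp_\<Lambda>[OF s _ r z, of G_inv_word 3] invertsD[OF inverse_words(3)]
      composes_allD[OF composes_G(1)] by (simp add: one)
  have rs: "\<Lambda> 6 G6_word \<circ> \<Lambda> 4 G_word = (\<lambda>x. 1 * x * star 1)"
    using \<Lambda>_comp_\<Lambda>[OF r _ s z, of G6_inv_word 5] invertsD[OF inverse_words(4)]
      composes_allD[OF composes_G(2)] by (simp add: one)
  have "bij (\<Lambda> 4 G_word)" using sr rs by (intro o_bij[of "\<Lambda> 6 G6_word"]) (simp_all add: id_def)
  moreover have "tracks' (\<Lambda> 4 G_word) move_G"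
    using tracks_moves[OF s, of cycles_G] cycles_ok(7,8) by (simp add: move_G_def)
  moreover have "tracks' (\<Lambda> 6 G6_word) move_G6"
    using tracks_moves[OF r, of cycles_G6] cycles_ok(9,10) by (simp add: move_G6_def)
  ultimately show ?thesis
    unfolding tracked_def using rs moves_inverseD[OF moves_inverse(4)] unitary_one by blast
qed

end

section \<open>The fourteen classes\<close>

context cuntz_algebra
begin

lemma necklaces_rotate:
  assumes "p \<in> set necklaces" "q \<in> set necklaces" "q = rotate k p"
  shows "q = p"
proof -
  have "q = rotate (k mod 6) p" using assms(3) length_necklace[OF assms(1)] rotate_conv_mod by metis
  moreover have "k mod 6 \<le> 5" using mod_less_divisor[of 6 k] by linarith
  ultimately have "rotation 5 p q" using rotate_rotation by metis
  moreover have "apart p q" using necklaces_apart assms(1,2) by (simp add: list_all_iff all_apart_def)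
  ultimately show ?thesis by (simp add: apart_def)
qed

lemma length_4E:
  assumes "length w = 4"
  obtains a b c d where "w = [a, b, c, d]"
proof -
  have "length w = Suc (Suc (Suc (Suc 0)))" using assms by simp
  with that show ?thesis by (auto simp: length_Suc_conv)
qed

lemma perm_A_word: "length w = 4 \<Longrightarrow> perm_A (map letter w) = map letter (A_word w)"
  by (erule length_4E, rename_tac a b c d, case_tac a; case_tac b; case_tac c; case_tac d;
    simp add: perm_A_def letter_def)

lemma perm_J_word: "length w = 4 \<Longrightarrow> perm_J (map letter w) = map letter (J_word w)"
  by (erule length_4E, rename_tac a b c d, case_tac a; case_tac b; case_tac c; case_tac d;
    simp add: perm_J_def letter_def transpose_def)

lemma perm_G_word: "length w = 4 \<Longrightarrow> perm_G (map letter w) = map letter (G_word w)"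
  by (erule length_4E, rename_tac a b c d, case_tac a; case_tac b; case_tac c; case_tac d;
    simp add: perm_G_def letter_def G_word_def cycle3_def)

lemma rep_perm: "r \<in> set rep_words \<Longrightarrow> bij_betw r (bwords 4) (bwords 4)"
  using permutation_reps by (auto simp: list_all_iff intro: permutation_bij)

definition reps :: "('a \<Rightarrow> 'a) list" where
  "reps = map (\<Lambda> 4) rep_words"

lemma reps_eq:
  "reps = [id, lF, \<Lambda> 4 A_word, \<Lambda> 4 A_word \<circ> lF, lF \<circ> \<Lambda> 4 A_word, lF \<circ> \<Lambda> 4 A_word \<circ> lF,
    \<Lambda> 4 J_word, \<Lambda> 4 J_word \<circ> lF, lF \<circ> \<Lambda> 4 J_word, lF \<circ> \<Lambda> 4 J_word \<circ> lF,
    \<Lambda> 4 G_word, \<Lambda> 4 G_word \<circ> lF, lF \<circ> \<Lambda> 4 G_word, lF \<circ> \<Lambda> 4 G_word \<circ> lF]"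
proof -
  have out: "\<Lambda> 4 (flip_out s) = \<Lambda> 4 s \<circ> lF" and "in": "\<Lambda> 4 (flip_in s) = lF \<circ> \<Lambda> 4 s"
    and perm: "bij_betw (flip_in s) (bwords 4) (bwords 4)"
    if "bij_betw s (bwords 4) (bwords 4)" for s
    using \<Lambda>_flip_out[of s 3] \<Lambda>_flip_in[of s 3] flip_in_perm[of s 3] that by simp_all
  have "bij_betw id (bwords 4) (bwords 4)" "bij_betw A_word (bwords 4) (bwords 4)"
    "bij_betw J_word (bwords 4) (bwords 4)" "bij_betw G_word (bwords 4) (bwords 4)"
    by (rule rep_perm, simp add: rep_words_def)+
  thus ?thesis by (simp add: reps_def rep_words_def out "in" perm \<Lambda>_id)
qed

lemma tracked_id: "tracked' id id"
proof -
  have "tracks' id id"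
    unfolding tracks_def sends_def
    by (auto simp: unital_star_endomorphism_def intro!: exI[of _ 1])
  moreover have "id \<circ> id = (\<lambda>x. 1 * x * star 1)" by (simp add: id_def comp_def)
  moreover have "\<forall>q\<in>set necklaces. id (id q) = q" by simp
  ultimately show ?thesis unfolding tracked_def using unitary_one bij_id by blast
qed

lemma tracked_reps: "list_all2 tracked' reps rep_moves"
proof -
  have "\<Lambda> 4 (flip_out A_word) = \<Lambda> 4 A_word \<circ> lF"
    using \<Lambda>_flip_out[of A_word 3] rep_perm[of A_word] by (simp add: rep_words_def)
  hence AF: "tracked' (\<Lambda> 4 A_word \<circ> lF) move_AF" using tracked_AF by simp
  have "\<Lambda> 4 A_word = \<Lambda> 4 A_word \<circ> lF \<circ> lF" by (simp add: comp_assoc lF_lF)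
  hence A: "tracked' (\<Lambda> 4 A_word) (move_AF \<circ> move_F)"
    using tracked_comp[OF AF tracked_F] by metis
  have FAF: "tracked' (lF \<circ> \<Lambda> 4 A_word \<circ> lF) (move_F \<circ> move_AF)"
    using tracked_comp[OF tracked_F AF] by (simp add: comp_assoc)
  show ?thesis
    unfolding reps_eq rep_moves_def
    by (intro list_all2_Cons[THEN iffD2] conjI list_all2_Nil[THEN iffD2] tracked_id tracked_F A AF FAF
        tracked_comp[OF tracked_F A] tracked_J tracked_G tracked_comp[OF tracked_J tracked_F]
        tracked_comp[OF tracked_F tracked_J] tracked_comp[OF tracked_comp[OF tracked_F tracked_J] tracked_F]
        tracked_comp[OF tracked_G tracked_F] tracked_comp[OF tracked_F tracked_G]
        tracked_comp[OF tracked_comp[OF tracked_F tracked_G] tracked_F] refl)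
qed

lemma reps_Aut: "set reps \<subseteq> carrier Aut"
proof
  fix \<phi> assume "\<phi> \<in> set reps"
  then obtain f where "tracked' \<phi> f"
    using tracked_reps by (metis in_set_conv_nth list_all2_conv_all_nth)
  thus "\<phi> \<in> carrier Aut" by (simp add: Aut_def tracked_def tracks_def)
qed

lemma distinct_reps: "distinct (map out_class reps)"
  unfolding distinct_conv_nth
proof (intro allI impI)
  fix i j assume i: "i < length (map out_class reps)" and j: "j < length (map out_class reps)" and "i \<noteq> j"
  have len: "length rep_moves = length reps" using tracked_reps by (simp add: list_all2_conv_all_nth)
  have "image_of necklaces (rep_moves ! i) \<noteq> image_of necklaces (rep_moves ! j)"
    using distinct_rep_moves i j \<open>i \<noteq> j\<close> len by (simp add: distinct_conv_nth)
  then obtain p where p: "p \<in> set necklaces" "(rep_moves ! i) p \<noteq> (rep_moves ! j) p"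
    by (auto simp: image_of_def)
  show "map out_class reps ! i \<noteq> map out_class reps ! j"
  proof
    assume "map out_class reps ! i = map out_class reps ! j"
    hence eq: "out_class (reps ! i) = out_class (reps ! j)" using i j by simp
    have "tracked' (reps ! i) (rep_moves ! i)" "tracked' (reps ! j) (rep_moves ! j)"
      using tracked_reps i j by (simp_all add: list_all2_conv_all_nth)
    from tracked_out_class[OF necklaces_rotate _ _ this eq p(1)] length_necklace p(2)
    show False by force
  qed
qed

lemma out_class_reps: "out_class ` set reps = out_class ` perm_automorphisms S 4"
proof
  show "out_class ` set reps \<subseteq> out_class ` perm_automorphisms S 4"
  proof (rule image_mono, rule subsetI)
    fix \<phi> assume \<phi>: "\<phi> \<in> set reps"
    then obtain r where "r \<in> set rep_words" "\<phi> = \<Lambda> 4 r" by (auto simp: reps_def)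
    with \<phi> reps_Aut rep_perm show "\<phi> \<in> perm_automorphisms S 4"
      unfolding perm_automorphisms_eq by (auto simp: Aut_def)
  qed
  show "out_class ` perm_automorphisms S 4 \<subseteq> out_class ` set reps"
  proof (rule image_subsetI)
    fix \<phi> assume "\<phi> \<in> perm_automorphisms S 4"
    then obtain s where s: "\<phi> = \<Lambda> 4 s" "bij_betw s (bwords 4) (bwords 4)" "bij (\<Lambda> 4 s)"
      unfolding perm_automorphisms_eq by blast
    from \<Lambda>4_classification[OF s(2)] s(3) obtain r where
      "r \<in> set rep_words" "out_class (\<Lambda> 4 s) = out_class (\<Lambda> 4 r)" by (auto simp: bij_def)
    thus "out_class \<phi> \<in> out_class ` set reps" unfolding s(1) reps_def by auto
  qed
qed

end

theorem theorem5p7: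
  fixes S :: "nat \<Rightarrow> 'a::unital_cstar_algebra"
  assumes "cuntz_algebra S"
  shows
    "let lF = cuntz_endo S (unitary_F S);
         lA = cuntz_endo S (perm_unitary S 4 perm_A);
         lJ = cuntz_endo S (perm_unitary S 4 perm_J);
         lG = cuntz_endo S (perm_unitary S 4 perm_G);
         reps = [id, lF,
                 lA, lA \<circ> lF, lF \<circ> lA, lF \<circ> lA \<circ> lF,
                 lJ, lJ \<circ> lF, lF \<circ> lJ, lF \<circ> lJ \<circ> lF,
                 lG, lG \<circ> lF, lF \<circ> lG, lF \<circ> lG \<circ> lF]
     in set reps \<subseteq> carrier Aut \<and>
        distinct (map out_class reps) \<and>
        out_class ` set reps = out_class ` perm_automorphisms S 4"
proof -
  interpret cuntz_algebra S by fact
  have "cuntz_endo S (unitary_F S) = lF" by (simp only: unitary_F_eq lF_def)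
  moreover have "cuntz_endo S (perm_unitary S 4 perm_A) = \<Lambda> 4 A_word"
    "cuntz_endo S (perm_unitary S 4 perm_J) = \<Lambda> 4 J_word"
    "cuntz_endo S (perm_unitary S 4 perm_G) = \<Lambda> 4 G_word"
    by (simp_all only: perm_unitary_eq_U[of 4 perm_A A_word, OF perm_A_word]
        perm_unitary_eq_U[of 4 perm_J J_word, OF perm_J_word]
        perm_unitary_eq_U[of 4 perm_G G_word, OF perm_G_word])
  ultimately show ?thesis
    unfolding Let_def using reps_Aut distinct_reps out_class_reps by (simp only: reps_eq[symmetric])
qed

end
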